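(* Let $A:D(A)\subset H\to H$ be the generator of a strongly continuous semigroup $(T(t))_{t\ge 0}$ on $H$; let $\mathscr{C}:\mathscr{Z}\subset H\to H$ be a linear operator with $D(A)\subset\mathscr{Z}\subset H$ such that $C:=\mathscr{C}|_{D(A)}\in\mathcal{L}(D(A),H)$ is an admissible operator for $A$; and let $F:H\to H$ and $\mathscr{M}:H\to L_2^0(V,H)$ be (nonlinear) maps for which there is $k>0$ with $\|F(x)-F(y)\|+\|\mathscr{M}(x)-\mathscr{M}(y)\|_2\le k\|x-y\|$ for all $x,y\in H$. Let $T>0$, and for $\xi\in L^2(\mathcal{F}_0,H)$ let $X(\cdot,\xi)\in\mathcal{C}_{\mathcal{F}}([0,T];H)$ denote the unique mild solution of $$dX(t)=[AX(t)+F(\mathscr{C}X(t))]\,dt+\mathscr{M}(X(t))\,dW(t),\quad t\in[0,T],\qquad X(0)=\xi.$$ Then there exists $C_T>0$ such that, for arbitrary $\xi,\eta\in L^2(\mathcal{F}_0,H)$ and $t\in[0,T]$, $$\mathbb{E}\|X(t,\xi)-X(t,\eta)\|^2\le C_T\,\mathbb{E}\|\xi-\eta\|^2.$$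
   Context: $H$ and $V$ are real separable Hilbert spaces. $D(A)$ carries the graph norm. $(\Omega,\mathcal{F},\mathbb{P})$ is a complete probability space with a normal filtration $(\mathcal{F}_t)_{t\ge 0}$. $W(t)=\sum_k\sqrt{\lambda_k}\,\beta_k(t)e_k$ is a $V$-valued $Q$-Wiener process, where $(\beta_k)$ are mutually independent real standard Brownian motions (with respect to the filtration), $(e_k)$ is a complete orthonormal basis of $V$, $\lambda_k\ge 0$, $Qe_k=\lambda_ke_k$ and $\operatorname{tr}Q=\sum_k\lambda_k<\infty$. $L_2^0(V,H)$ is the space of Hilbert-Schmidt operators from $Q^{1/2}(V)$ to $H$, with norm $\|D\|_2=\big(\sum_k\|\sqrt{\lambda_k}De_k\|^2\big)^{1/2}$. $L^2(\mathcal{F}_0,H)$ is the space of $\mathcal{F}_0$-measurable square integrable $H$-valued random variables. $\mathcal{C}_{\mathcal{F}}([0,T];H)$ is the space of $\mathcal{F}_t$-adapted, $H$-valued measurable processes $u(t,\omega)$ on $[0,T]$ such that $t\mapsto(\mathbb{E}\|u(t)\|^2)^{1/2}$ is continuous. Admissibility: $C\in\mathcal{L}(D(A),H)$ is admissible for $A$ if for some (hence all) $\alpha>0$ there is $\gamma(\alpha)>0$ with $\int_0^\alpha\|CT(t)x\|^2dt\le\gamma(\alpha)^2\|x\|^2$ for all $x\in D(A)$. Yosida extension of $C$ for $A$: $D(C_\Lambda)=\{x\in H:\lim_{\lambda\in\mathbb{R},\,\lambda\to+\infty}C\lambda(\lambda-A)^{-1}x\text{ exists in }H\}$ and $C_\Lambda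 x$ is this limit. The unique mild solution is the unique $X\in\mathcal{C}_{\mathcal{F}}([0,T];H)$ such that $X(t)\in D(C_\Lambda)$ for a.e. $t\in[0,T]$, $\mathbb{P}$-a.s., $X$ and $C_\Lambda X$ are measurable with $\int_0^T\|X(t)\|^2dt<\infty$ and $\int_0^T\|C_\Lambda X(t)\|^2dt<\infty$ $\mathbb{P}$-a.s., and $X(t)=T(t)\xi+\int_0^tT(t-s)F(C_\Lambda X(s))\,ds+\int_0^tT(t-s)\mathscr{M}(X(s))\,dW(s)$ for all $t\in[0,T]$, $\mathbb{P}$-a.s. (its existence and uniqueness for every $\xi\in L^2(\mathcal{F}_0,H)$ under the stated hypotheses is an earlier theorem of the paper). *)

theory Defs
  imports "HOL-Probability.Probability"
begin

text \<open>
  Real separable Hilbert spaces are types of sort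
  \<open>{real_inner, banach, second_countable_topology}\<close>.
  Unbounded operators are total functions paired with a carrier set for their domain; their
  values off the domain never matter.
\<close>

section \<open>Semigroups, generators, admissibility, Yosida extension\<close>

definition C0_semigroup :: "(real \<Rightarrow> 'h::real_normed_vector \<Rightarrow>\<^sub>L 'h) \<Rightarrow> bool" where
  "C0_semigroup T \<longleftrightarrow>
     T 0 = id_blinfun \<and>
     (\<forall>s\<ge>0. \<forall>t\<ge>0. T (s + t) = T s o\<^sub>L T t) \<and>
     (\<forall>x. ((\<lambda>t. T t x) \<longlongrightarrow> x) (at_right 0))"

definition is_generator ::
  "(real \<Rightarrow> 'h::real_normed_vector \<Rightarrow>\<^sub>L 'h) \<Rightarrow> 'h set \<Rightarrow> ('h \<Rightarrow> 'h) \<Rightarrow> bool" where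
  "is_generator T DA A \<longleftrightarrow>
     DA = {x. \<exists>y. ((\<lambda>h. (T h x - x) /\<^sub>R h) \<longlongrightarrow> y) (at_right 0)} \<and>
     (\<forall>x\<in>DA. ((\<lambda>h. (T h x - x) /\<^sub>R h) \<longlongrightarrow> A x) (at_right 0))"

definition linear_operator_on :: "'a::real_vector set \<Rightarrow> ('a \<Rightarrow> 'b::real_vector) \<Rightarrow> bool" where
  "linear_operator_on D L \<longleftrightarrow>
     subspace D \<and>
     (\<forall>x\<in>D. \<forall>y\<in>D. L (x + y) = L x + L y) \<and>
     (\<forall>c. \<forall>x\<in>D. L (c *\<^sub>R x) = c *\<^sub>R L x)"

definition graph_norm :: "('h::real_normed_vector \<Rightarrow> 'h) \<Rightarrow> 'h \<Rightarrow> real" where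
  "graph_norm A x = norm x + norm (A x)"

definition graph_bounded_operator ::
  "'h::real_normed_vector set \<Rightarrow> ('h \<Rightarrow> 'h) \<Rightarrow> ('h \<Rightarrow> 'h) \<Rightarrow> bool" where
  "graph_bounded_operator DA A C \<longleftrightarrow>
     linear_operator_on DA C \<and> (\<exists>K. \<forall>x\<in>DA. norm (C x) \<le> K * graph_norm A x)"

definition admissible ::
  "(real \<Rightarrow> 'h::real_normed_vector \<Rightarrow>\<^sub>L 'h) \<Rightarrow> 'h set \<Rightarrow> ('h \<Rightarrow> 'h) \<Rightarrow> bool" where
  "admissible T DA C \<longleftrightarrow>
     (\<exists>\<alpha>>0. \<exists>\<gamma>>0. \<forall>x\<in>DA.
        (\<integral>\<^sup>+t\<in>{0..\<alpha>}. ennreal ((norm (C (T t x)))\<^sup>2) \<partial>lborel) \<le> ennreal (\<gamma>\<^sup>2 * (norm x)\<^sup>2))"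

text \<open>\<open>\<lambda>I - A\<close> is a bijection from \<open>DA\<close> onto the space for all large real \<open>\<lambda>\<close>; only those
  \<open>\<lambda>\<close> matter below.\<close>

definition resolvent :: "'h::real_vector set \<Rightarrow> ('h \<Rightarrow> 'h) \<Rightarrow> real \<Rightarrow> 'h \<Rightarrow> 'h" where
  "resolvent DA A l = inv_into DA (\<lambda>y. l *\<^sub>R y - A y)"

definition yosida_domain ::
  "'h::real_normed_vector set \<Rightarrow> ('h \<Rightarrow> 'h) \<Rightarrow> ('h \<Rightarrow> 'h) \<Rightarrow> 'h set" where
  "yosida_domain DA A C = {x. \<exists>y. ((\<lambda>l. C (l *\<^sub>R resolvent DA A l x)) \<longlongrightarrow> y) at_top}"

definition yosida_extension ::
  "'h::real_normed_vector set \<Rightarrow> ('h \<Rightarrow> 'h) \<Rightarrow> ('h \<Rightarrow> 'h) \<Rightarrow> 'h \<Rightarrow> 'h" where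
  "yosida_extension DA A C x =
     (if x \<in> yosida_domain DA A C
      then Lim at_top (\<lambda>l. C (l *\<^sub>R resolvent DA A l x)) else 0)"


section \<open>Filtrations and Wiener processes\<close>

definition normal_filtration :: "'w measure \<Rightarrow> (real \<Rightarrow> 'w measure) \<Rightarrow> bool" where
  "normal_filtration M F \<longleftrightarrow>
     (\<forall>t\<ge>0. subalgebra M (F t)) \<and>
     (\<forall>s\<ge>0. \<forall>t\<ge>s. sets (F s) \<subseteq> sets (F t)) \<and>
     null_sets M \<subseteq> sets (F 0) \<and>
     (\<forall>t\<ge>0. sets (F t) = (\<Inter>s\<in>{t<..}. sets (F s)))"

definition brownian_motion ::
  "'w measure \<Rightarrow> (real \<Rightarrow> 'w measure) \<Rightarrow> (real \<Rightarrow> 'w \<Rightarrow> real) \<Rightarrow> bool" where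
  "brownian_motion M F b \<longleftrightarrow>
     (\<forall>t\<ge>0. b t \<in> borel_measurable (F t)) \<and>
     (AE \<omega> in M. b 0 \<omega> = 0) \<and>
     (AE \<omega> in M. continuous_on {0..} (\<lambda>t. b t \<omega>)) \<and>
     (\<forall>s\<ge>0. \<forall>t>s.
        distributed M lborel (\<lambda>\<omega>. b t \<omega> - b s \<omega>) (normal_density 0 (sqrt (t - s))) \<and>
        prob_space.indep_set M (sets (F s))
          {(\<lambda>\<omega>. b t \<omega> - b s \<omega>) -` B \<inter> space M | B. B \<in> sets borel})"

text \<open>The index set \<open>K\<close> may be finite, so that finite-dimensional spaces are included.\<close>

definition complete_orthonormal :: "nat set \<Rightarrow> (nat \<Rightarrow> 'v::real_inner) \<Rightarrow> bool" where
  "complete_orthonormal K e \<longleftrightarrow>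
     (\<forall>j\<in>K. \<forall>k\<in>K. e j \<bullet> e k = (if j = k then 1 else 0)) \<and> closure (span (e ` K)) = UNIV"

definition Q_wiener_process ::
  "'w measure \<Rightarrow> (real \<Rightarrow> 'w measure) \<Rightarrow> nat set \<Rightarrow> ('v::real_inner \<Rightarrow>\<^sub>L 'v) \<Rightarrow> (nat \<Rightarrow> real) \<Rightarrow>
   (nat \<Rightarrow> 'v) \<Rightarrow> (nat \<Rightarrow> real \<Rightarrow> 'w \<Rightarrow> real) \<Rightarrow> (real \<Rightarrow> 'w \<Rightarrow> 'v) \<Rightarrow> bool" where
  "Q_wiener_process M F K Q lam e \<beta> W \<longleftrightarrow>
     complete_orthonormal K e \<and>
     (\<forall>k\<in>K. lam k \<ge> 0 \<and> Q (e k) = lam k *\<^sub>R e k) \<and> lam summable_on K \<and>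
     (\<forall>k\<in>K. brownian_motion M F (\<beta> k)) \<and>
     prob_space.indep_vars M (\<lambda>_. \<Pi>\<^sub>M t\<in>{0..}. borel) (\<lambda>k \<omega>. \<lambda>t\<in>{0..}. \<beta> k t \<omega>) K \<and>
     (\<forall>t\<ge>0. AE \<omega> in M. ((\<lambda>k. (sqrt (lam k) * \<beta> k t \<omega>) *\<^sub>R e k) has_sum W t \<omega>) K)"


section \<open>Hilbert-Schmidt operators on the range of the square root of the covariance\<close>

definition sqrt_cov ::
  "nat set \<Rightarrow> (nat \<Rightarrow> real) \<Rightarrow> (nat \<Rightarrow> 'v::real_inner) \<Rightarrow> 'v \<Rightarrow> 'v" where
  "sqrt_cov K lam e v = (\<Sum>\<^sub>\<infinity>k\<in>K. (sqrt (lam k) * (e k \<bullet> v)) *\<^sub>R e k)"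

text \<open>
  An operator \<open>D\<close> in \<open>L\<^sub>2\<^sup>0(V,H)\<close> is given by a function on \<open>V\<close> of which only the values on
  \<open>Q^(1/2)(V)\<close> count.  As \<open>Q^(1/2)(V)\<close> carries the norm that makes \<open>Q^(1/2)\<close> a quotient map, \<open>D\<close> is
  linear and bounded on it iff \<open>D \<circ> Q^(1/2)\<close> is a bounded linear operator on \<open>V\<close>.  If
  \<open>lam k = 0\<close> then \<open>e k\<close> is not in \<open>Q^(1/2)(V)\<close>, but \<open>D (e k)\<close> has weight 0 in the norm.
\<close>

definition hs_operators ::
  "nat set \<Rightarrow> (nat \<Rightarrow> real) \<Rightarrow> (nat \<Rightarrow> 'v::real_inner) \<Rightarrow> ('v \<Rightarrow> 'h::real_normed_vector) set" where
  "hs_operators K lam e =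
     {D. bounded_linear (\<lambda>v. D (sqrt_cov K lam e v)) \<and>
         (\<lambda>k. (norm (sqrt (lam k) *\<^sub>R D (e k)))\<^sup>2) summable_on K}"

definition hs_norm ::
  "nat set \<Rightarrow> (nat \<Rightarrow> real) \<Rightarrow> (nat \<Rightarrow> 'v) \<Rightarrow> ('v \<Rightarrow> 'h::real_normed_vector) \<Rightarrow> real" where
  "hs_norm K lam e D = sqrt (\<Sum>\<^sub>\<infinity>k\<in>K. (norm (sqrt (lam k) *\<^sub>R D (e k)))\<^sup>2)"


section \<open>The stochastic integral\<close>

text \<open>
  An entry \<open>(a, b, G, D)\<close> stands for the process that equals \<open>D\<close> for \<open>a < s \<le> b\<close> and
  \<open>\<omega> \<in> G\<close>, and 0 otherwise; a list stands for the sum of its entries.  These sums are the usual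
  elementary processes: constant in time on each interval \<open>(t\<^sub>j, t\<^sub>j\<^sub>+\<^sub>1]\<close> of a partition, with a
  finitely valued, \<open>F (t\<^sub>j)\<close>-measurable, \<open>L(V,H)\<close>-valued random variable as value there.
\<close>

type_synonym ('w, 'v, 'h) elementary = "(real \<times> real \<times> 'w set \<times> ('v \<Rightarrow>\<^sub>L 'h)) list"

definition elementary_adapted ::
  "(real \<Rightarrow> 'w measure) \<Rightarrow>
   ('w, 'v::real_normed_vector, 'h::real_normed_vector) elementary \<Rightarrow> bool" where
  "elementary_adapted F xs \<longleftrightarrow> (\<forall>(a, b, G, D) \<in> set xs. 0 \<le> a \<and> a \<le> b \<and> G \<in> sets (F a))"

definition elementary_process ::
  "('w, 'v::real_normed_vector, 'h::real_normed_vector) elementary \<Rightarrow> real \<Rightarrow> 'w \<Rightarrow> 'v \<Rightarrow> 'h" where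
  "elementary_process xs s \<omega> v =
     (\<Sum>(a, b, G, D)\<leftarrow>xs. (indicator {a<..b} s * indicator G \<omega> :: real) *\<^sub>R blinfun_apply D v)"

definition elementary_integral ::
  "(real \<Rightarrow> 'w \<Rightarrow> 'v) \<Rightarrow>
   ('w, 'v::real_normed_vector, 'h::real_normed_vector) elementary \<Rightarrow> real \<Rightarrow> 'w \<Rightarrow> 'h" where
  "elementary_integral W xs t \<omega> =
     (\<Sum>(a, b, G, D)\<leftarrow>xs.
        (indicator G \<omega> :: real) *\<^sub>R blinfun_apply D (W (min b t) \<omega> - W (min a t) \<omega>))"

text \<open>
  \<open>I\<close> is (a version of) \<open>\<integral>\<^sub>0\<^sup>t \<Phi>(s) dW(s)\<close>: the mean-square limit of the integrals of elementary
  processes that converge to \<open>\<Phi>\<close> in \<open>L\<^sup>2([0,t] \<times> \<Omega>; L\<^sub>2\<^sup>0(V,H))\<close>.  Nonanticipativity of \<open>\<Phi>\<close>, up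
  to null sets, is a consequence of the existence of such an approximation.
\<close>

definition has_stochastic_integral ::
  "'w measure \<Rightarrow> (real \<Rightarrow> 'w measure) \<Rightarrow> nat set \<Rightarrow> (nat \<Rightarrow> real) \<Rightarrow> (nat \<Rightarrow> 'v::real_inner) \<Rightarrow>
   (real \<Rightarrow> 'w \<Rightarrow> 'v) \<Rightarrow>
   (real \<Rightarrow> 'w \<Rightarrow> 'v \<Rightarrow> 'h::{real_inner, banach, second_countable_topology}) \<Rightarrow>
   real \<Rightarrow> ('w \<Rightarrow> 'h) \<Rightarrow> bool" where
  "has_stochastic_integral M F K lam e W \<Phi> t I \<longleftrightarrow>
     (\<forall>s\<in>{0..t}. \<forall>\<omega>\<in>space M. \<Phi> s \<omega> \<in> hs_operators K lam e) \<and>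
     (\<forall>k\<in>K. (\<lambda>(s, \<omega>). sqrt (lam k) *\<^sub>R \<Phi> s \<omega> (e k))
        \<in> borel_measurable (restrict_space lborel {0..t} \<Otimes>\<^sub>M M)) \<and>
     I \<in> borel_measurable M \<and>
     (\<exists>xs :: nat \<Rightarrow> ('w, 'v, 'h) elementary.
        (\<forall>n. elementary_adapted F (xs n)) \<and>
        (\<lambda>n. \<integral>\<^sup>+(s, \<omega>). ennreal ((hs_norm K lam e
                 (\<lambda>v. elementary_process (xs n) s \<omega> v - \<Phi> s \<omega> v))\<^sup>2)
              \<partial>(restrict_space lborel {0..t} \<Otimes>\<^sub>M M)) \<longlonglongrightarrow> 0 \<and>
        (\<lambda>n. \<integral>\<^sup>+\<omega>. ennreal ((norm (elementary_integral W (xs n) t \<omega> - I \<omega>))\<^sup>2) \<partial>M)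
          \<longlonglongrightarrow> 0)"


section \<open>Mild solutions\<close>

definition L2_random_variable ::
  "'w measure \<Rightarrow> 'w measure \<Rightarrow> ('w \<Rightarrow> 'h::real_normed_vector) \<Rightarrow> bool" where
  "L2_random_variable M G \<xi> \<longleftrightarrow>
     \<xi> \<in> borel_measurable G \<and> integrable M (\<lambda>\<omega>. (norm (\<xi> \<omega>))\<^sup>2)"

definition process_space ::
  "'w measure \<Rightarrow> (real \<Rightarrow> 'w measure) \<Rightarrow> real \<Rightarrow>
   (real \<Rightarrow> 'w \<Rightarrow> 'h::real_normed_vector) set" where
  "process_space M F \<tau> =
     {u. (\<forall>t\<in>{0..\<tau>}. L2_random_variable M (F t) (u t)) \<and>
         (\<lambda>(t, \<omega>). u t \<omega>) \<in> borel_measurable (restrict_space lborel {0..\<tau>} \<Otimes>\<^sub>M M) \<and>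
         continuous_on {0..\<tau>} (\<lambda>t. sqrt (\<integral>\<omega>. (norm (u t \<omega>))\<^sup>2 \<partial>M))}"

text \<open>The mild equation holds for each \<open>t\<close> outside a null set that may depend on \<open>t\<close>, as the
  stochastic integral is only determined up to null sets.  Accordingly, uniqueness of the mild
  solution is uniqueness up to modification.\<close>

definition mild_solution ::
  "'w measure \<Rightarrow> (real \<Rightarrow> 'w measure) \<Rightarrow> nat set \<Rightarrow> (nat \<Rightarrow> real) \<Rightarrow> (nat \<Rightarrow> 'v::real_inner) \<Rightarrow>
   (real \<Rightarrow> 'w \<Rightarrow> 'v) \<Rightarrow>
   (real \<Rightarrow> 'h \<Rightarrow>\<^sub>L 'h) \<Rightarrow> 'h set \<Rightarrow> ('h \<Rightarrow> 'h) \<Rightarrow> ('h \<Rightarrow> 'h) \<Rightarrow>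
   ('h \<Rightarrow> 'h) \<Rightarrow> ('h \<Rightarrow> 'v \<Rightarrow> 'h) \<Rightarrow> real \<Rightarrow> ('w \<Rightarrow> 'h) \<Rightarrow>
   (real \<Rightarrow> 'w \<Rightarrow> 'h::{real_inner, banach, second_countable_topology}) \<Rightarrow> bool" where
  "mild_solution M F K lam e W T DA A C f m \<tau> \<xi> X \<longleftrightarrow>
     X \<in> process_space M F \<tau> \<and>
     (AE \<omega> in M. AE t in lborel. t \<in> {0..\<tau>} \<longrightarrow> X t \<omega> \<in> yosida_domain DA A C) \<and>
     (\<lambda>(t, \<omega>). yosida_extension DA A C (X t \<omega>))
       \<in> borel_measurable (restrict_space lborel {0..\<tau>} \<Otimes>\<^sub>M M) \<and>
     (AE \<omega> in M. (\<integral>\<^sup>+t\<in>{0..\<tau>}. ennreal ((norm (X t \<omega>))\<^sup>2) \<partial>lborel) < \<infinity>) \<and>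
     (AE \<omega> in M. (\<integral>\<^sup>+t\<in>{0..\<tau>}.
        ennreal ((norm (yosida_extension DA A C (X t \<omega>)))\<^sup>2) \<partial>lborel) < \<infinity>) \<and>
     (\<forall>t\<in>{0..\<tau>}. \<exists>I.
        has_stochastic_integral M F K lam e W (\<lambda>s \<omega> v. T (t - s) (m (X s \<omega>) v)) t I \<and>
        (AE \<omega> in M. X t \<omega> = T t (\<xi> \<omega>)
           + (LINT s:{0..t}|lborel. T (t - s) (f (yosida_extension DA A C (X s \<omega>))))
           + I \<omega>))"

end

theory Submission
  imports Defs
begin

text \<open>
  The difference of two mild solutions \<open>X\<close>, \<open>Y\<close> with initial values \<open>\<xi>\<close>, \<open>\<eta>\<close> is the sum of
  \<open>T(t)(\<xi> - \<eta>)\<close>, of the convolution of the semigroup with \<open>f(C\<^sub>\<Lambda> X) - f(C\<^sub>\<Lambda> Y)\<close>, and of a stochastic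
  convolution with \<open>m(X) - m(Y)\<close>.  By the Lipschitz condition its mean square is controlled by
  \<open>E|\<xi> - \<eta>|\<^sup>2\<close>, by the time integral of \<open>E|X - Y|\<^sup>2\<close>, and by the output energy
  \<open>E \<integral> |C\<^sub>\<Lambda> X - C\<^sub>\<Lambda> Y|\<^sup>2\<close>.  The whole difficulty is the output energy, as \<open>C\<^sub>\<Lambda>\<close> is unbounded.

  The operators \<open>C J\<^sub>n\<close> with \<open>J\<^sub>n = l\<^sub>n R(l\<^sub>n, A)\<close> and \<open>l\<^sub>n \<rightarrow> \<infinity>\<close> are bounded, and they converge to
  \<open>C\<^sub>\<Lambda>\<close> on its domain.  As \<open>J\<^sub>n\<close> is
  bounded uniformly in \<open>n\<close> and commutes with the semigroup, admissibility of \<open>C\<close> yields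
  \<open>\<integral> |C J\<^sub>n T(t) x|\<^sup>2 dt \<le> \<gamma> |x|\<^sup>2\<close> with one constant for all \<open>n\<close> (\<open>yosida_approximation\<close>).
  Tonelli's theorem, applied to the triangle \<open>0 \<le> s \<le> t\<close>, carries this bound over to
  convolutions: to deterministic ones by the Cauchy-Schwarz inequality, to stochastic ones by the
  isometry of the stochastic integral.  Fatou's lemma then removes \<open>n\<close>
  (\<open>observed_output_bound\<close>, \<open>output_energy\<close>).

  The drift term contains \<open>C\<^sub>\<Lambda> X - C\<^sub>\<Lambda> Y\<close> itself and has to be absorbed into the left-hand side.
  A weight \<open>exp(-\<mu>t)\<close> with large \<open>\<mu>\<close> gives it the factor \<open>1/(2\<mu>)\<close>, so that no subdivision of the
  time interval and no restart of the equation is necessary.  The definition of a mild solution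
  makes the output square integrable along almost every path, but not in mean; hence the
  absorption is done path by path, before expectations are taken.

  With the output energy under control the function \<open>\<phi>(t) = E|X(t) - Y(t)|\<^sup>2\<close> satisfies
  \<open>\<phi>(t) \<le> a E|\<xi> - \<eta>|\<^sup>2 + r \<integral>\<^sub>0\<^sup>t \<phi>\<close>, and Gronwall's lemma finishes the proof.

  On the stochastic side, the second moment of an elementary integral is computed from the
  covariances of Brownian increments restricted to events of the past.  For increments of two
  different Brownian motions these covariances vanish by an argument of quadratic covariation
  (\<open>expectation_past_incr_incr_distinct\<close>).
\<close>

text \<open>Squared norms enter the estimates as extended nonnegative reals: Tonelli's theorem, Fatou's
  lemma and monotonicity then apply without any integrability being known beforehand.\<close>

abbreviation nsq :: "'a::real_normed_vector \<Rightarrow> ennreal" where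
  "nsq x \<equiv> ennreal ((norm x)\<^sup>2)"

section \<open>The uniform boundedness principle and strongly continuous semigroups\<close>

text \<open>By Baire's theorem one of the closed sets on which the family is bounded by a fixed number
  contains a ball; the difference of two points of that ball reaches every direction.\<close>

lemma uniform_boundedness:
  fixes f :: "'i \<Rightarrow> 'a::banach \<Rightarrow>\<^sub>L 'b::real_normed_vector"
  assumes "\<And>x. \<exists>B. \<forall>i\<in>I. norm (f i x) \<le> B"
  shows "\<exists>B. \<forall>i\<in>I. norm (f i) \<le> B"
proof -
  define S where "S n = {x. \<forall>i\<in>I. norm (f i x) \<le> real n}" for n
  have closed: "closed (S n)" for n
  proof -
    have "S n = (\<Inter>i\<in>I. {x. norm (f i x) \<le> real n})"
      by (auto simp: S_def)
    then show ?thesis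
      by (auto intro!: closed_INT closed_Collect_le continuous_intros)
  qed
  have "(\<Union>n. S n) = UNIV"
  proof (intro set_eqI iffI UNIV_I)
    fix x
    obtain B where B: "\<forall>i\<in>I. norm (f i x) \<le> B" using assms by blast
    obtain n where "B \<le> real n" using real_arch_simple by blast
    then have "x \<in> S n" using B by (force simp: S_def)
    then show "x \<in> (\<Union>n. S n)" by blast
  qed
  then have "interior (\<Union>(range S)) \<noteq> {}" by simp
  then have "\<exists>n. interior (S n) \<noteq> {}"
    using Baire_category_alt[of "euclidean :: 'a topology" "range S"] closed
    by (auto simp: completely_metrizable_space_euclidean)
  then obtain n x0 where "x0 \<in> interior (S n)" by blast
  then obtain r where r: "r > 0" "cball x0 r \<subseteq> S n"
    unfolding mem_interior_cball by blast
  have "norm (f i) \<le> 2 * real n / r" if i: "i \<in> I" for i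
  proof (rule norm_blinfun_bound)
    show "0 \<le> 2 * real n / r" using r by simp
    fix x
    show "norm (f i x) \<le> 2 * real n / r * norm x"
    proof (cases "x = 0")
      case False
      define y where "y = (r / norm x) *\<^sub>R x"
      have "x0 + y \<in> S n" "x0 \<in> S n"
        using r False by (auto simp: y_def dist_norm intro!: subsetD[OF r(2)])
      then have "norm (f i (x0 + y)) \<le> n" "norm (f i x0) \<le> n"
        using i by (auto simp: S_def)
      then have "norm (f i (x0 + y) - f i x0) \<le> 2 * n"
        using norm_triangle_ineq4[of "f i (x0 + y)" "f i x0"] by linarith
      then have "norm (f i y) \<le> 2 * n" by (simp add: blinfun.add_right)
      then show ?thesis using False r
        by (simp add: y_def blinfun.scaleR_right field_simps)
    qed simp
  qed
  then show ?thesis by blast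
qed

locale c0_semigroup =
  fixes T :: "real \<Rightarrow> 'h::{banach, second_countable_topology} \<Rightarrow>\<^sub>L 'h"
  assumes C0: "C0_semigroup T"
begin

lemma T_0 [simp]: "T 0 = id_blinfun"
  and T_add: "s \<ge> 0 \<Longrightarrow> t \<ge> 0 \<Longrightarrow> T (s + t) = T s o\<^sub>L T t"
  and T_tendsto_0: "((\<lambda>t. T t x) \<longlongrightarrow> x) (at_right 0)"
  using C0 by (auto simp: C0_semigroup_def)

lemma T_add_apply: "s \<ge> 0 \<Longrightarrow> t \<ge> 0 \<Longrightarrow> T (s + t) x = T s (T t x)"
  by (simp add: T_add)

lemma T_commute: "s \<ge> 0 \<Longrightarrow> t \<ge> 0 \<Longrightarrow> T s (T t x) = T t (T s x)"
  by (metis T_add_apply add.commute)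

text \<open>If this failed there would be \<open>t\<^sub>n \<rightarrow> 0\<close> with \<open>|T(t\<^sub>n)| > n + 1\<close>; but strong continuity at 0 makes every
  sequence \<open>T(t\<^sub>n) x\<close> convergent, hence bounded.\<close>

lemma bounded_near_0: "\<exists>d>0. \<exists>B\<ge>1. \<forall>t\<in>{0..d}. norm (T t) \<le> B"
proof (rule ccontr)
  assume neg: "\<not> ?thesis"
  have "\<exists>t. 0 < t \<and> t < inverse (Suc n) \<and> norm (T t) > real n + 1" for n
  proof -
    have "\<not> (\<forall>t\<in>{0..inverse (Suc n) / 2}. norm (T t) \<le> real n + 1)"
      using neg by (auto simp del: of_nat_Suc dest!: spec[of _ "inverse (Suc n) / 2"] spec[of _ "real n + 1"])
    then obtain t where t: "0 \<le> t" "t \<le> inverse (Suc n) / 2" "norm (T t) > real n + 1"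
      by force
    have "t \<noteq> 0"
    proof
      assume "t = 0"
      have "norm (id_blinfun :: 'h \<Rightarrow>\<^sub>L 'h) \<le> 1" by (rule norm_blinfun_id_le)
      with t \<open>t = 0\<close> show False by simp
    qed
    moreover have "t < inverse (Suc n)"
      using t(2) by (rule order_le_less_trans) simp
    ultimately show ?thesis using t by (intro exI[of _ t]) auto
  qed
  then obtain t where t: "\<And>n. 0 < t n" "\<And>n. t n < inverse (Suc n)" "\<And>n. norm (T (t n)) > real n + 1"
    by metis
  have "t \<longlonglongrightarrow> 0"
    by (rule tendsto_sandwich[OF _ _ tendsto_const LIMSEQ_inverse_real_of_nat])
       (use t in \<open>auto simp: less_imp_le\<close>)
  then have "filterlim t (at_right 0) sequentially"
    using t by (intro tendsto_imp_filterlim_at_right) auto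
  then have "(\<lambda>n. T (t n) x) \<longlonglongrightarrow> x" for x
    using T_tendsto_0 by (rule filterlim_compose[rotated])
  then have "Bseq (\<lambda>n. T (t n) x)" for x
    using convergent_imp_Bseq convergentI by blast
  then have "\<exists>B. \<forall>n\<in>UNIV. norm (T (t n) x) \<le> B" for x
    unfolding Bseq_def by blast
  from uniform_boundedness[OF this] obtain B where B: "\<And>n. norm (T (t n)) \<le> B" by auto
  obtain n where "B \<le> real n" using real_arch_simple by blast
  with B[of n] t(3)[of n] show False by simp
qed

text \<open>Walking from 0 to \<open>t\<close> in steps of length at most \<open>d\<close> costs a factor \<open>B\<close> per step.\<close>

lemma exponential_bound: "\<exists>B\<ge>1. \<exists>w\<ge>0. \<forall>t\<ge>0. norm (T t) \<le> B * exp (w * t)"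
proof -
  obtain d B where d: "d > 0" "B \<ge> 1" "\<And>t. 0 \<le> t \<Longrightarrow> t \<le> d \<Longrightarrow> norm (T t) \<le> B"
    using bounded_near_0 by auto
  have *: "0 \<le> t \<Longrightarrow> t \<le> real n * d \<Longrightarrow> norm (T t) \<le> B ^ n" for n t
  proof (induction n arbitrary: t)
    case 0
    then show ?case by (auto simp: norm_blinfun_id_le)
  next
    case (Suc n)
    show ?case
    proof (cases "t \<le> d")
      case True
      then have "norm (T t) \<le> B" using Suc d by auto
      also have "B \<le> B ^ Suc n" using d(2) self_le_power[of B "Suc n"] by auto
      finally show ?thesis .
    next
      case False
      then have "T t = T d o\<^sub>L T (t - d)" using T_add[of d "t - d"] d by auto
      then have "norm (T t) \<le> norm (T d) * norm (T (t - d))"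
        by (simp add: norm_blinfun_compose)
      also have "\<dots> \<le> B * B ^ n"
        using Suc False d by (intro mult_mono Suc.IH) (auto simp: algebra_simps)
      finally show ?thesis by simp
    qed
  qed
  have "norm (T t) \<le> B * exp (ln B / d * t)" if "t \<ge> 0" for t
  proof -
    define n where "n = nat \<lceil>t / d\<rceil>"
    have n: "t / d \<le> real n" "real n \<le> t / d + 1"
      using that d by (auto simp: n_def)
    have "norm (T t) \<le> B ^ n"
      using n d that by (intro *) (auto simp: field_simps)
    also have "\<dots> = exp (real n * ln B)"
      using d by (simp add: exp_of_nat_mult)
    also have "\<dots> \<le> exp ((t / d + 1) * ln B)"
      using n d by (auto intro!: mult_right_mono)
    also have "\<dots> = B * exp (ln B / d * t)"
      using d by (simp add: algebra_simps exp_add)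
    finally show ?thesis .
  qed
  moreover have "ln B / d \<ge> 0" using d by simp
  ultimately show ?thesis using d(2) by blast
qed

lemma bounded_on_interval: "\<exists>B\<ge>1. \<forall>t\<in>{0..b}. norm (T t) \<le> B"
proof -
  obtain B w where B: "B \<ge> 1" "w \<ge> 0" "\<And>t. t \<ge> 0 \<Longrightarrow> norm (T t) \<le> B * exp (w * t)"
    using exponential_bound by blast
  have "norm (T t) \<le> B * exp (w * \<bar>b\<bar>)" if "t \<in> {0..b}" for t
  proof -
    have "norm (T t) \<le> B * exp (w * t)" using B(3) that by auto
    also have "\<dots> \<le> B * exp (w * \<bar>b\<bar>)"
      using that B by (auto intro!: mult_left_mono)
    finally show ?thesis .
  qed
  moreover have "1 \<le> B * exp (w * \<bar>b\<bar>)"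
    using B mult_mono[of 1 B 1 "exp (w * \<bar>b\<bar>)"] by simp
  ultimately show ?thesis by blast
qed

text \<open>Composing with \<open>max 0\<close> extends orbits constantly to negative times, where \<open>T\<close> is arbitrary.
  Right continuity at 0 propagates to both sides of every time through
  \<open>T(t) x - T(s) x = T(s) (T(t - s) x - x)\<close>.\<close>

lemma orbit_tendsto: "((\<lambda>t. T (max 0 t) x) \<longlongrightarrow> T (max 0 t0) x) (at t0)"
proof -
  obtain B where B: "B \<ge> 1" "\<And>t. t \<in> {0..\<bar>t0\<bar> + 1} \<Longrightarrow> norm (T t) \<le> B"
    using bounded_on_interval by blast
  have *: "norm (T t x - T s x) \<le> B * norm (T (t - s) x - x)" if "0 \<le> s" "s \<le> t" "t \<le> \<bar>t0\<bar> + 1" for s t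
  proof -
    have "T t x - T s x = T s (T (t - s) x - x)"
      using T_add_apply[of s "t - s" x] that by (simp add: blinfun.diff_right)
    then have "norm (T t x - T s x) \<le> norm (T s) * norm (T (t - s) x - x)"
      by (simp add: norm_blinfun)
    also have "\<dots> \<le> B * norm (T (t - s) x - x)"
      using that by (intro mult_right_mono B) auto
    finally show ?thesis .
  qed
  have abs: "filterlim (\<lambda>h::real. \<bar>h\<bar>) (at_right 0) (at 0)"
    by (auto simp: filterlim_at eventually_at_filter intro!: tendsto_eq_intros)
  have "((\<lambda>h. T \<bar>h\<bar> x - x) \<longlongrightarrow> 0) (at 0)"
    by (rule LIM_zero) (rule filterlim_compose[OF T_tendsto_0 abs])
  then have "((\<lambda>h. T \<bar>h\<bar> x - x) \<longlongrightarrow> T \<bar>0\<bar> x - x) (at 0)" by simp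
  moreover have "((\<lambda>t. max 0 t - max 0 t0) \<longlongrightarrow> 0) (at t0)"
    by (auto intro!: tendsto_eq_intros)
  ultimately have "((\<lambda>t. T \<bar>max 0 t - max 0 t0\<bar> x - x) \<longlongrightarrow> T \<bar>0\<bar> x - x) (at t0)"
    by (rule tendsto_compose)
  then have lim: "((\<lambda>t. T \<bar>max 0 t - max 0 t0\<bar> x - x) \<longlongrightarrow> 0) (at t0)"
    by simp
  show ?thesis
  proof (rule LIM_zero_cancel, rule Lim_null_comparison)
    show "((\<lambda>t. B * norm (T \<bar>max 0 t - max 0 t0\<bar> x - x)) \<longlongrightarrow> 0) (at t0)"
      using tendsto_mult_right_zero[OF tendsto_norm_zero[OF lim]] by simp
    have "\<forall>\<^sub>F t in at t0. dist t t0 < 1"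
      by (rule eventually_at_ball'[THEN eventually_mono, of 1]) (auto simp: dist_commute)
    then show "\<forall>\<^sub>F t in at t0. norm (T (max 0 t) x - T (max 0 t0) x) \<le> B * norm (T \<bar>max 0 t - max 0 t0\<bar> x - x)"
    proof (eventually_elim)
      case (elim t)
      define a b where "a = max 0 t" and "b = max 0 t0"
      have "0 \<le> a" "0 \<le> b" "a \<le> \<bar>t0\<bar> + 1" "b \<le> \<bar>t0\<bar> + 1"
        using elim by (auto simp: dist_norm a_def b_def)
      then have "norm (T a x - T b x) \<le> B * norm (T \<bar>a - b\<bar> x - x)"
        using *[of a b] *[of b a] by (cases "a \<le> b") (simp_all add: norm_minus_commute)
      then show ?case by (simp add: a_def b_def)
    qed
  qed
qed

text \<open>Continuity in both variables together is what makes the integrands of convolutions jointly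
  measurable.\<close>

lemma continuous_semigroup_action: "continuous_on UNIV (\<lambda>(t, x). T (max 0 t) x)"
proof -
  have "isCont (\<lambda>(t, x). T (max 0 t) x) p" for p
  proof -
    obtain t0 x0 where p: "p = (t0, x0)" by force
    obtain B where B: "B \<ge> 1" "\<And>t. t \<in> {0..\<bar>t0\<bar> + 1} \<Longrightarrow> norm (T t) \<le> B"
      using bounded_on_interval by blast
    have fst: "((\<lambda>q. fst q) \<longlongrightarrow> t0) (at p)" and snd: "((\<lambda>q. snd q) \<longlongrightarrow> x0) (at p)"
      unfolding p by (auto intro!: tendsto_eq_intros)
    have 1: "((\<lambda>q. T (max 0 (fst q)) (snd q - x0)) \<longlongrightarrow> 0) (at p)"
    proof (rule Lim_null_comparison)
      show "((\<lambda>q. B * norm (snd q - x0)) \<longlongrightarrow> 0) (at p)"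
        by (rule tendsto_eq_intros snd refl)+ simp
      have "\<forall>\<^sub>F q in at p. dist (fst q) t0 < 1" using tendstoD[OF fst, of 1] by simp
      then show "\<forall>\<^sub>F q in at p. norm (T (max 0 (fst q)) (snd q - x0)) \<le> B * norm (snd q - x0)"
      proof (eventually_elim)
        case (elim q)
        have "norm (T (max 0 (fst q)) (snd q - x0)) \<le> norm (T (max 0 (fst q))) * norm (snd q - x0)"
          by (rule norm_blinfun)
        also have "\<dots> \<le> B * norm (snd q - x0)"
          using elim by (intro mult_right_mono B(2)) (auto simp: dist_norm)
        finally show ?case .
      qed
    qed
    have 2: "((\<lambda>q. T (max 0 (fst q)) x0) \<longlongrightarrow> T (max 0 t0) x0) (at p)"
      by (rule tendsto_compose[OF orbit_tendsto fst])
        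
    have "((\<lambda>q. T (max 0 (fst q)) (snd q - x0) + T (max 0 (fst q)) x0) \<longlongrightarrow> 0 + T (max 0 t0) x0) (at p)"
      by (intro tendsto_add 1 2)
    then show ?thesis
      by (simp add: p isCont_def case_prod_beta' blinfun.diff_right)
  qed
  then show ?thesis by (simp add: continuous_on_eq_continuous_at)
qed

lemma measurable_semigroup_action [measurable (raw)]:
  assumes "f \<in> borel_measurable N" "g \<in> borel_measurable N"
  shows "(\<lambda>x. T (max 0 (f x)) (g x)) \<in> borel_measurable N"
  using borel_measurable_continuous_Pair[OF assms, of "\<lambda>t x. T (max 0 t) x"]
    continuous_semigroup_action by (simp add: split_beta)

end

section \<open>The resolvent as a Laplace transform\<close>

locale c0_generator = c0_semigroup T
  for T :: "real \<Rightarrow> 'h::{banach, second_countable_topology} \<Rightarrow>\<^sub>L 'h" +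
  fixes DA :: "'h set" and A :: "'h \<Rightarrow> 'h"
  assumes gen: "is_generator T DA A"
begin

lemma A_tendsto: "x \<in> DA \<Longrightarrow> ((\<lambda>h. (T h x - x) /\<^sub>R h) \<longlongrightarrow> A x) (at_right 0)"
  using gen by (auto simp: is_generator_def)

lemma generatorI:
  assumes "((\<lambda>h. (T h x - x) /\<^sub>R h) \<longlongrightarrow> y) (at_right 0)"
  shows "x \<in> DA" and "A x = y"
proof -
  show "x \<in> DA" using gen assms by (auto simp: is_generator_def)
  then show "A x = y" using tendsto_unique[OF _ A_tendsto assms] by simp
qed

lemma
  assumes "x \<in> DA" "y \<in> DA"
  shows DA_diff: "x - y \<in> DA" and A_diff: "A (x - y) = A x - A y"
proof -
  have "((\<lambda>h. (T h (x - y) - (x - y)) /\<^sub>R h) \<longlongrightarrow> A x - A y) (at_right 0)"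
    using tendsto_diff[OF A_tendsto A_tendsto, OF assms]
    by (rule Lim_transform_eventually) (simp add: blinfun.diff_right algebra_simps)
  then show "x - y \<in> DA" "A (x - y) = A x - A y" by (rule generatorI)+
qed

lemma
  assumes "x \<in> DA" "t \<ge> 0"
  shows T_in_DA: "T t x \<in> DA" and A_T: "A (T t x) = T t (A x)"
proof -
  have "((\<lambda>h. T t ((T h x - x) /\<^sub>R h)) \<longlongrightarrow> T t (A x)) (at_right 0)"
    by (intro blinfun.tendsto tendsto_const A_tendsto assms)
  moreover have "\<forall>\<^sub>F h in at_right 0. T t ((T h x - x) /\<^sub>R h) = (T h (T t x) - T t x) /\<^sub>R h"
    using eventually_at_right_less[of 0]
    by eventually_elim (use assms in \<open>simp add: blinfun.diff_right blinfun.scaleR_right T_commute\<close>)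
  ultimately have "((\<lambda>h. (T h (T t x) - T t x) /\<^sub>R h) \<longlongrightarrow> T t (A x)) (at_right 0)"
    by (rule Lim_transform_eventually)
  then show "T t x \<in> DA" "A (T t x) = T t (A x)" by (rule generatorI)+
qed

text \<open>The Laplace transform of an orbit; for large \<open>l\<close> this is the resolvent \<open>R(l, A) x\<close>.\<close>

definition laplace :: "real \<Rightarrow> 'h \<Rightarrow> 'h" where
  "laplace l x = (\<integral>t. (indicator {0<..} t * exp (- l * t)) *\<^sub>R T (max 0 t) x \<partial>lborel)"

end

lemma average_tendsto:
  fixes \<phi> :: "real \<Rightarrow> 'a::{banach, second_countable_topology}"
  assumes meas [measurable]: "\<phi> \<in> borel_measurable borel" and cont: "(\<phi> \<longlongrightarrow> \<phi> 0) (at_right 0)"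
  shows "((\<lambda>h. (\<integral>t. indicator {0<..h} t *\<^sub>R \<phi> t \<partial>lborel) /\<^sub>R h) \<longlongrightarrow> \<phi> 0) (at_right 0)"
proof (rule tendstoI)
  fix r :: real assume "r > 0"
  then have "\<forall>\<^sub>F t in at_right 0. dist (\<phi> t) (\<phi> 0) < r / 2"
    using tendstoD[OF cont, of "r / 2"] by simp
  then obtain d where d: "d > 0" "\<And>t. 0 < t \<Longrightarrow> t < d \<Longrightarrow> dist (\<phi> t) (\<phi> 0) < r / 2"
    unfolding eventually_at_right_field by auto
  have d': "norm (\<phi> t - \<phi> 0) \<le> r / 2" if "0 \<le> t" "t < d" for t
    using d(2)[of t] that \<open>r > 0\<close> by (cases "t = 0") (auto simp: dist_norm)
  have "dist ((\<integral>t. indicator {0<..h} t *\<^sub>R \<phi> t \<partial>lborel) /\<^sub>R h) (\<phi> 0) < r" if h: "0 < h" "h < d" for h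
  proof -
    have i1: "integrable lborel (\<lambda>t. indicator {0<..h} t *\<^sub>R (\<phi> t - \<phi> 0))"
    proof (rule Bochner_Integration.integrable_bound)
      show "integrable lborel (\<lambda>t. (r / 2) * indicator {0<..h} t :: real)"
        using h by (intro integrable_mult_right integrable_real_indicator) auto
      show "AE t in lborel. norm (indicator {0<..h} t *\<^sub>R (\<phi> t - \<phi> 0)) \<le> norm ((r / 2) * indicator {0<..h} t :: real)"
        using d' h \<open>r > 0\<close> by (auto simp: indicator_def)
    qed simp
    have i0: "integrable lborel (\<lambda>t. (r / 2) * indicator {0<..h} t :: real)"
      using h by (intro integrable_mult_right integrable_real_indicator) auto
    have i2: "integrable lborel (\<lambda>t. indicator {0<..h} t *\<^sub>R \<phi> 0)"
      using h by (intro integrable_scaleR_left integrable_real_indicator) auto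
    have "(\<integral>t. indicator {0<..h} t *\<^sub>R \<phi> t \<partial>lborel)
        = (\<integral>t. indicator {0<..h} t *\<^sub>R (\<phi> t - \<phi> 0) + indicator {0<..h} t *\<^sub>R \<phi> 0 \<partial>lborel)"
      by (intro Bochner_Integration.integral_cong) (auto simp: scaleR_diff_right)
    also have "\<dots> = (\<integral>t. indicator {0<..h} t *\<^sub>R (\<phi> t - \<phi> 0) \<partial>lborel) + h *\<^sub>R \<phi> 0"
      using i1 i2 h by simp
    finally have eq: "(\<integral>t. indicator {0<..h} t *\<^sub>R \<phi> t \<partial>lborel) /\<^sub>R h - \<phi> 0
        = (\<integral>t. indicator {0<..h} t *\<^sub>R (\<phi> t - \<phi> 0) \<partial>lborel) /\<^sub>R h"
      using h by (simp add: scaleR_add_right)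
    have "norm (\<integral>t. indicator {0<..h} t *\<^sub>R (\<phi> t - \<phi> 0) \<partial>lborel)
        \<le> (\<integral>t. (r / 2) * indicator {0<..h} t \<partial>lborel)"
      using d' h \<open>r > 0\<close>
      by (intro Bochner_Integration.integral_norm_bound_integral[OF i1 i0]) (auto simp: indicator_def)
    also have "\<dots> = r * h / 2" using h by simp
    also have "\<dots> < r * h" using mult_pos_pos[OF \<open>r > 0\<close> h(1)] by linarith
    finally show ?thesis
      using h unfolding dist_norm eq by (simp add: field_simps)
  qed
  then show "\<forall>\<^sub>F h in at_right 0. dist ((\<integral>t. indicator {0<..h} t *\<^sub>R \<phi> t \<partial>lborel) /\<^sub>R h) (\<phi> 0) < r"
    unfolding eventually_at_right_field using d by auto
qed

context c0_generator
begin

text \<open>The substitution \<open>t \<rightarrow> t + h\<close> gives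
  \<open>T(h) R = exp(lh) (R - \<integral>\<^sub>0\<^sup>h exp(-lt) T(t) dt)\<close>, and the difference quotient of the right-hand side at
  \<open>h = 0\<close> is \<open>l R - I\<close>.\<close>

lemma resolvent_laplace:
  "\<exists>w\<ge>0. \<exists>B\<ge>1. \<forall>l>w. bounded_linear (laplace l) \<and> (\<forall>x. norm (laplace l x) \<le> B / (l - w) * norm x) \<and>
     (\<forall>x. laplace l x \<in> DA \<and> A (laplace l x) = l *\<^sub>R laplace l x - x) \<and>
     (\<forall>x. \<forall>t\<ge>0. laplace l (T t x) = T t (laplace l x))"
proof -
  obtain B w where B: "B \<ge> 1" "w \<ge> 0" "\<And>t. t \<ge> 0 \<Longrightarrow> norm (T t) \<le> B * exp (w * t)"
    using exponential_bound by blast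
  have "bounded_linear (laplace l) \<and> (\<forall>x. norm (laplace l x) \<le> B / (l - w) * norm x) \<and>
     (\<forall>x. laplace l x \<in> DA \<and> A (laplace l x) = l *\<^sub>R laplace l x - x) \<and>
     (\<forall>x. \<forall>t\<ge>0. laplace l (T t x) = T t (laplace l x))" if l: "l > w" for l
  proof -
    define \<phi> where "\<phi> x t = exp (- l * t) *\<^sub>R T (max 0 t) x" for x t
    have lap: "laplace l x = (\<integral>t. indicator {0<..} t *\<^sub>R \<phi> x t \<partial>lborel)" for x
      by (simp add: laplace_def \<phi>_def)
    have [measurable]: "\<phi> x \<in> borel_measurable borel" for x
      unfolding \<phi>_def by measurable
    define E where "E t = indicator {0<..} t * exp (- (t * (l - w)))" for t
    have E: "integrable lborel E"
      using integrable_I0i_exp_mscale[of "l - w"] l unfolding E_def set_integrable_def by simp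
    have E_int: "(\<integral>t. E t \<partial>lborel) = 1 / (l - w)"
      using LBINT_I0i_exp_mscale[of "l - w"] l unfolding E_def
      by (simp add: interval_lebesgue_integral_0_infty set_lebesgue_integral_def)
    have bd: "norm (indicator {0<..} t *\<^sub>R \<phi> x t) \<le> B * norm x * E t" for x t
    proof (cases "t > 0")
      case True
      have "norm (T t x) \<le> norm (T t) * norm x" by (rule norm_blinfun)
      also have "\<dots> \<le> (B * exp (w * t)) * norm x" using True by (intro mult_right_mono B) auto
      finally have "exp (- l * t) * norm (T t x) \<le> exp (- l * t) * (B * exp (w * t) * norm x)"
        by (intro mult_left_mono) auto
      also have "\<dots> = B * norm x * exp (- (t * (l - w)))"
        by (simp add: algebra_simps exp_diff exp_minus field_simps flip: exp_add)
      finally show ?thesis using True by (simp add: \<phi>_def E_def)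
    qed (simp add: E_def)
    have int: "integrable lborel (\<lambda>t. indicator {0<..} t *\<^sub>R \<phi> x t)" for x
      by (rule Bochner_Integration.integrable_bound[of _ "\<lambda>t. B * norm x * E t"])
         (use E in \<open>auto intro!: AE_I2 order_trans[OF bd] simp del: norm_scaleR\<close>)
    have norm: "norm (laplace l x) \<le> B / (l - w) * norm x" for x
    proof -
      have "norm (laplace l x) \<le> (\<integral>t. B * norm x * E t \<partial>lborel)"
        unfolding lap using E by (intro Bochner_Integration.integral_norm_bound_integral int bd) auto
      then show ?thesis by (simp add: E_int)
    qed
    have lin: "bounded_linear (laplace l)"
    proof (rule bounded_linear_intro[where K = "B / (l - w)"])
      show "laplace l (x + y) = laplace l x + laplace l y" for x y
        unfolding lap using int[of x] int[of y]
        by (simp add: \<phi>_def blinfun.add_right scaleR_add_right)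
      show "laplace l (c *\<^sub>R x) = c *\<^sub>R laplace l x" for c x
        unfolding lap by (simp add: \<phi>_def blinfun.scaleR_right mult_ac flip: integral_scaleR_right)
      show "norm (laplace l x) \<le> norm x * (B / (l - w))" for x
        using norm[of x] by (simp add: mult.commute)
    qed
    have comm: "laplace l (T h x) = T h (laplace l x)" if "h \<ge> 0" for h x
    proof -
      have "T h (laplace l x) = (\<integral>t. T h (indicator {0<..} t *\<^sub>R \<phi> x t) \<partial>lborel)"
        unfolding lap by (rule integral_bounded_linear[symmetric]) (auto intro: int blinfun.bounded_linear_right)
      also have "\<dots> = laplace l (T h x)"
        unfolding lap \<phi>_def using that
        by (intro Bochner_Integration.integral_cong) (auto simp: blinfun.scaleR_right T_commute)
      finally show ?thesis ..
    qed
    have shift: "T h (laplace l x) = exp (l * h) *\<^sub>R (laplace l x - (\<integral>t. indicator {0<..h} t *\<^sub>R \<phi> x t \<partial>lborel))"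
      if h: "h > 0" for h x
    proof -
      have i2: "integrable lborel (\<lambda>t. indicator {0<..h} t *\<^sub>R \<phi> x t)"
        using integrable_mult_indicator[OF _ int[of x], of "{0<..h}"]
        by (rule back_subst[where P = "integrable lborel"]) (auto simp: indicator_def)
      have "laplace l x - (\<integral>t. indicator {0<..h} t *\<^sub>R \<phi> x t \<partial>lborel)
          = (\<integral>t. indicator {0<..} t *\<^sub>R \<phi> x t - indicator {0<..h} t *\<^sub>R \<phi> x t \<partial>lborel)"
        unfolding lap using int[of x] i2 by simp
      also have "\<dots> = (\<integral>t. indicator {h<..} t *\<^sub>R \<phi> x t \<partial>lborel)"
        using h by (intro Bochner_Integration.integral_cong) (auto simp: indicator_def)
      also have "\<dots> = (\<integral>t. indicator {h<..} (h + t) *\<^sub>R \<phi> x (h + t) \<partial>lborel)"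
        using lborel_integral_real_affine[of 1 "\<lambda>t. indicator {h<..} t *\<^sub>R \<phi> x t" h] by simp
      also have "\<dots> = (\<integral>t. exp (- l * h) *\<^sub>R (indicator {0<..} t *\<^sub>R \<phi> (T h x) t) \<partial>lborel)"
      proof (intro Bochner_Integration.integral_cong refl)
        fix t :: real
        show "indicator {h<..} (h + t) *\<^sub>R \<phi> x (h + t) = exp (- l * h) *\<^sub>R (indicator {0<..} t *\<^sub>R \<phi> (T h x) t)"
          using h T_add_apply[of t h x]
          by (auto simp: indicator_def \<phi>_def exp_add algebra_simps exp_diff exp_minus field_simps add.commute)
      qed
      also have "\<dots> = exp (- l * h) *\<^sub>R T h (laplace l x)"
        using comm[of h x] h by (subst integral_scaleR_right) (simp add: lap)
      finally show ?thesis by (simp flip: exp_add)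
    qed
    have gen: "((\<lambda>h. (T h (laplace l x) - laplace l x) /\<^sub>R h) \<longlongrightarrow> l *\<^sub>R laplace l x - x) (at_right 0)" for x
    proof -
      have exp_lim: "((\<lambda>h. (exp (l * h) - 1) / h) \<longlongrightarrow> l) (at_right 0)"
      proof -
        have "((\<lambda>h. exp (l * h)) has_real_derivative l) (at 0)"
          by (auto intro!: derivative_eq_intros)
        then have "((\<lambda>h. (exp (l * h) - 1) / h) \<longlongrightarrow> l) (at 0)"
          by (simp add: has_field_derivative_iff)
        then show ?thesis by (rule filterlim_mono) (auto simp: at_le)
      qed
      have \<phi>0: "\<phi> x 0 = x" by (simp add: \<phi>_def)
      have "(\<phi> x \<longlongrightarrow> \<phi> x 0) (at 0)"
        unfolding \<phi>_def by (intro tendsto_intros orbit_tendsto)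
      then have "(\<phi> x \<longlongrightarrow> \<phi> x 0) (at_right 0)"
        by (rule filterlim_mono) (auto simp: at_le)
      then have avg: "((\<lambda>h. (\<integral>t. indicator {0<..h} t *\<^sub>R \<phi> x t \<partial>lborel) /\<^sub>R h) \<longlongrightarrow> x) (at_right 0)"
        using average_tendsto[of "\<phi> x"] \<phi>0 by simp
      have "((\<lambda>h. exp (l * h)) \<longlongrightarrow> 1) (at_right 0)"
        by (auto intro!: tendsto_eq_intros)
      from tendsto_diff[OF tendsto_scaleR[OF exp_lim tendsto_const[of "laplace l x"]] tendsto_scaleR[OF this avg]]
      have "((\<lambda>h. ((exp (l * h) - 1) / h) *\<^sub>R laplace l x
          - exp (l * h) *\<^sub>R ((\<integral>t. indicator {0<..h} t *\<^sub>R \<phi> x t \<partial>lborel) /\<^sub>R h)) \<longlongrightarrow> l *\<^sub>R laplace l x - x) (at_right 0)"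
        by simp
      then show ?thesis
      proof (rule Lim_transform_eventually)
        show "\<forall>\<^sub>F h in at_right 0. ((exp (l * h) - 1) / h) *\<^sub>R laplace l x
          - exp (l * h) *\<^sub>R ((\<integral>t. indicator {0<..h} t *\<^sub>R \<phi> x t \<partial>lborel) /\<^sub>R h)
          = (T h (laplace l x) - laplace l x) /\<^sub>R h"
          using eventually_at_right_less[of 0]
          by eventually_elim
             (simp add: shift scaleR_diff_right scaleR_diff_left right_diff_distrib divide_inverse mult.commute)
      qed
    qed
    show ?thesis using lin norm comm generatorI[OF gen] by blast
  qed
  then show ?thesis using B by blast
qed

text \<open>The hypotheses say that \<open>laplace l\<close> is a right inverse of \<open>l - A\<close>.  It is also a left inverse
  on the domain, because it commutes with the difference quotients that define \<open>A\<close>; hence \<open>l - A\<close> is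
  injective there, and the inverse function chosen in the definition of the resolvent is
  \<open>laplace l\<close>.\<close>

lemma resolvent_eq:
  assumes lap: "bounded_linear (laplace l)"
    "\<And>x. laplace l x \<in> DA" "\<And>x. A (laplace l x) = l *\<^sub>R laplace l x - x"
    "\<And>x t. t \<ge> 0 \<Longrightarrow> laplace l (T t x) = T t (laplace l x)"
  shows "resolvent DA A l = laplace l"
proof
  fix x
  interpret L: bounded_linear "laplace l" by fact
  have left_inv: "laplace l (l *\<^sub>R y - A y) = y" if "y \<in> DA" for y
  proof -
    have "((\<lambda>h. laplace l ((T h y - y) /\<^sub>R h)) \<longlongrightarrow> laplace l (A y)) (at_right 0)"
      by (intro L.tendsto A_tendsto that)
    moreover have "\<forall>\<^sub>F h in at_right 0. laplace l ((T h y - y) /\<^sub>R h) = (T h (laplace l y) - laplace l y) /\<^sub>R h"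
      using eventually_at_right_less[of 0]
      by eventually_elim (simp add: L.diff L.scaleR lap)
    ultimately have "((\<lambda>h. (T h (laplace l y) - laplace l y) /\<^sub>R h) \<longlongrightarrow> laplace l (A y)) (at_right 0)"
      by (rule Lim_transform_eventually)
    then have "A (laplace l y) = laplace l (A y)" by (rule generatorI)
    then have "laplace l (A y) = l *\<^sub>R laplace l y - y" by (rule trans[OF sym lap(3)])
    then show ?thesis by (simp add: L.diff L.scaleR)
  qed
  have "inj_on (\<lambda>y. l *\<^sub>R y - A y) DA"
    by (rule inj_on_inverseI) (rule left_inv)
  moreover have "l *\<^sub>R laplace l x - A (laplace l x) = x" by (simp add: lap)
  ultimately show "resolvent DA A l x = laplace l x"
    unfolding resolvent_def using lap(2)[of x] inv_into_f_f[of "\<lambda>y. l *\<^sub>R y - A y" DA "laplace l x"] by simp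
qed

end

section \<open>Admissible observation operators\<close>

locale observed_semigroup = c0_generator T DA A
  for T :: "real \<Rightarrow> 'h::{banach, second_countable_topology} \<Rightarrow>\<^sub>L 'h" and DA A +
  fixes C :: "'h \<Rightarrow> 'h"
  assumes C_graph: "graph_bounded_operator DA A C"
    and C_adm: "admissible T DA C"
begin

lemma C_add: "x \<in> DA \<Longrightarrow> y \<in> DA \<Longrightarrow> C (x + y) = C x + C y"
  and C_scaleR: "x \<in> DA \<Longrightarrow> C (c *\<^sub>R x) = c *\<^sub>R C x"
  and subspace_DA: "subspace DA"
  using C_graph by (auto simp: graph_bounded_operator_def linear_operator_on_def)

lemma C_diff: "x \<in> DA \<Longrightarrow> y \<in> DA \<Longrightarrow> C (x - y) = C x - C y"
  using C_add[of x "(- 1) *\<^sub>R y"] C_scaleR[of y "- 1"] subspace_scale[OF subspace_DA, of y "-1"] by simp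

lemma graph_bound: "\<exists>c\<ge>0. \<forall>x\<in>DA. norm (C x) \<le> c * (norm x + norm (A x))"
proof -
  obtain c where c: "\<And>x. x \<in> DA \<Longrightarrow> norm (C x) \<le> c * graph_norm A x"
    using C_graph by (auto simp: graph_bounded_operator_def)
  have "norm (C x) \<le> \<bar>c\<bar> * (norm x + norm (A x))" if "x \<in> DA" for x
    using c[OF that] unfolding graph_norm_def
    by (rule order_trans) (intro mult_right_mono, auto)
  then show ?thesis by (intro exI[of _ "\<bar>c\<bar>"]) auto
qed

text \<open>Since \<open>A\<close> commutes with \<open>T(t)\<close>, orbits in the domain are continuous for the graph norm.\<close>

lemma continuous_observed_orbit:
  assumes "x \<in> DA"
  shows "continuous_on UNIV (\<lambda>t. C (T (max 0 t) x))"
proof -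
  obtain c where c: "c \<ge> 0" "\<And>x. x \<in> DA \<Longrightarrow> norm (C x) \<le> c * (norm x + norm (A x))"
    using graph_bound by blast
  have "((\<lambda>t. C (T (max 0 t) x)) \<longlongrightarrow> C (T (max 0 t0) x)) (at t0)" for t0
  proof (rule LIM_zero_cancel, rule Lim_null_comparison)
    have "((\<lambda>t. c * (norm (T (max 0 t) x - T (max 0 t0) x) + norm (T (max 0 t) (A x) - T (max 0 t0) (A x))))
        \<longlongrightarrow> c * (norm (T (max 0 t0) x - T (max 0 t0) x) + norm (T (max 0 t0) (A x) - T (max 0 t0) (A x)))) (at t0)"
      by (intro tendsto_intros orbit_tendsto)
    then show "((\<lambda>t. c * (norm (T (max 0 t) x - T (max 0 t0) x) + norm (T (max 0 t) (A x) - T (max 0 t0) (A x)))) \<longlongrightarrow> 0) (at t0)"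
      by simp
    show "\<forall>\<^sub>F t in at t0. norm (C (T (max 0 t) x) - C (T (max 0 t0) x))
        \<le> c * (norm (T (max 0 t) x - T (max 0 t0) x) + norm (T (max 0 t) (A x) - T (max 0 t0) (A x)))"
    proof (intro always_eventually allI)
      fix t
      have "T (max 0 t) x \<in> DA" "T (max 0 t0) x \<in> DA" using assms by (auto intro: T_in_DA)
      then show "norm (C (T (max 0 t) x) - C (T (max 0 t0) x))
        \<le> c * (norm (T (max 0 t) x - T (max 0 t0) x) + norm (T (max 0 t) (A x) - T (max 0 t0) (A x)))"
        using c(2)[OF DA_diff, of "T (max 0 t) x" "T (max 0 t0) x"] assms
        by (simp add: C_diff A_diff A_T)
    qed
  qed
  then show ?thesis by (simp add: continuous_on_eq_continuous_at isCont_def)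
qed

text \<open>The admissibility estimate is given on some \<open>[0, \<alpha>]\<close>.  On the piece \<open>[n\<alpha>, (n + 1)\<alpha>]\<close> the orbit of
  \<open>x\<close> is the orbit of \<open>T(n\<alpha>) x\<close> on \<open>[0, \<alpha>]\<close>, and finitely many pieces cover \<open>[0, \<tau>]\<close>.\<close>

lemma admissible_on_interval:
  "\<exists>\<gamma>\<ge>0. \<forall>x\<in>DA. (\<integral>\<^sup>+t\<in>{0..\<tau>}. nsq (C (T t x)) \<partial>lborel) \<le> ennreal (\<gamma> * (norm x)\<^sup>2)"
proof -
  obtain \<alpha> \<gamma>0 where adm: "\<alpha> > 0" "\<gamma>0 > 0"
    "\<And>x. x \<in> DA \<Longrightarrow> (\<integral>\<^sup>+t\<in>{0..\<alpha>}. nsq (C (T t x)) \<partial>lborel) \<le> ennreal (\<gamma>0\<^sup>2 * (norm x)\<^sup>2)"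
    using C_adm unfolding admissible_def by blast
  obtain N :: nat where N: "\<tau> / \<alpha> \<le> real N" using real_arch_simple by blast
  obtain B where B: "B \<ge> 1" "\<And>t. t \<in> {0..real N * \<alpha>} \<Longrightarrow> norm (T t) \<le> B"
    using bounded_on_interval by blast
  define \<phi> where "\<phi> x t = nsq (C (T (max 0 t) x))" for x t
  have meas: "\<phi> x \<in> borel_measurable borel" if "x \<in> DA" for x
    unfolding \<phi>_def
    using borel_measurable_continuous_onI[OF continuous_observed_orbit[OF that]] by measurable
  have adm': "(\<integral>\<^sup>+t\<in>{0..\<alpha>}. \<phi> x t \<partial>lborel) \<le> ennreal (\<gamma>0\<^sup>2 * (norm x)\<^sup>2)" if "x \<in> DA" for x
    using adm(3)[OF that] unfolding \<phi>_def
    by (rule back_subst[where P = "\<lambda>u. u \<le> _"])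
       (auto intro!: nn_integral_cong simp: indicator_def max_absorb2)
  have "n \<le> N \<Longrightarrow> (\<integral>\<^sup>+t\<in>{0..real n * \<alpha>}. \<phi> x t \<partial>lborel) \<le> ennreal (real n * (\<gamma>0\<^sup>2 * (B * norm x)\<^sup>2))"
    if x: "x \<in> DA" for x n
  proof (induction n)
    case 0
    have "(\<integral>\<^sup>+t\<in>{0..0}. \<phi> x t \<partial>lborel) = (\<integral>\<^sup>+(t::real). 0 \<partial>lborel)"
      by (intro nn_integral_cong_AE eventually_mono[OF AE_lborel_singleton[of 0]]) (simp add: indicator_def)
    then show ?case by simp
  next
    case (Suc n)
    define y where "y = T (real n * \<alpha>) x"
    have n: "real n * \<alpha> \<ge> 0" using adm(1) by simp
    have y: "y \<in> DA" unfolding y_def using x n by (rule T_in_DA)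
    have "norm y \<le> norm (T (real n * \<alpha>)) * norm x" unfolding y_def by (rule norm_blinfun)
    also have "\<dots> \<le> B * norm x"
      using n Suc.prems adm(1) by (intro mult_right_mono B) auto
    finally have y_le: "norm y \<le> B * norm x" .
    note [measurable] = meas[OF x] meas[OF y]
    have split: "(\<integral>\<^sup>+t\<in>{0..real (Suc n) * \<alpha>}. \<phi> x t \<partial>lborel)
        \<le> (\<integral>\<^sup>+t\<in>{0..real n * \<alpha>}. \<phi> x t \<partial>lborel) + (\<integral>\<^sup>+t\<in>{real n * \<alpha>..real (Suc n) * \<alpha>}. \<phi> x t \<partial>lborel)"
      by (subst nn_integral_add[symmetric]) (auto intro!: nn_integral_mono simp: indicator_def)
    have "(\<integral>\<^sup>+t\<in>{real n * \<alpha>..real (Suc n) * \<alpha>}. \<phi> x t \<partial>lborel)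
        = (\<integral>\<^sup>+t. \<phi> x (real n * \<alpha> + t) * indicator {real n * \<alpha>..real (Suc n) * \<alpha>} (real n * \<alpha> + t) \<partial>lborel)"
      by (subst nn_integral_real_affine[of _ 1 "real n * \<alpha>"]) simp_all
    also have "\<dots> = (\<integral>\<^sup>+t\<in>{0..\<alpha>}. \<phi> y t \<partial>lborel)"
    proof (intro nn_integral_cong)
      fix t
      have "T (real n * \<alpha> + t) x = T t y" if "t \<ge> 0"
        using T_add_apply[of t "real n * \<alpha>" x] n that by (simp add: y_def add.commute)
      moreover have "real (Suc n) * \<alpha> = real n * \<alpha> + \<alpha>" by (simp add: distrib_right)
      ultimately show "\<phi> x (real n * \<alpha> + t) * indicator {real n * \<alpha>..real (Suc n) * \<alpha>} (real n * \<alpha> + t) = \<phi> y t * indicator {0..\<alpha>} t"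
        using n by (simp add: indicator_def \<phi>_def)
    qed
    also have "\<dots> \<le> ennreal (\<gamma>0\<^sup>2 * (B * norm x)\<^sup>2)"
      using y_le by (intro order_trans[OF adm'[OF y]] ennreal_leI mult_left_mono power_mono) auto
    finally have "(\<integral>\<^sup>+t\<in>{0..real (Suc n) * \<alpha>}. \<phi> x t \<partial>lborel)
        \<le> ennreal (real n * (\<gamma>0\<^sup>2 * (B * norm x)\<^sup>2)) + ennreal (\<gamma>0\<^sup>2 * (B * norm x)\<^sup>2)"
      using Suc by (intro order_trans[OF split] add_mono) simp_all
    then show ?case by (simp add: distrib_right add.commute flip: ennreal_plus)
  qed
  then have *: "(\<integral>\<^sup>+t\<in>{0..real N * \<alpha>}. \<phi> x t \<partial>lborel) \<le> ennreal (real N * \<gamma>0\<^sup>2 * B\<^sup>2 * (norm x)\<^sup>2)" if "x \<in> DA" for x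
    using that by (simp add: power_mult_distrib mult.assoc)
  have "(\<integral>\<^sup>+t\<in>{0..\<tau>}. nsq (C (T t x)) \<partial>lborel) \<le> ennreal (real N * \<gamma>0\<^sup>2 * B\<^sup>2 * (norm x)\<^sup>2)" if "x \<in> DA" for x
  proof -
    have "\<tau> \<le> real N * \<alpha>" using N adm(1) by (simp add: field_simps)
    then have "(\<integral>\<^sup>+t\<in>{0..\<tau>}. nsq (C (T t x)) \<partial>lborel) \<le> (\<integral>\<^sup>+t\<in>{0..real N * \<alpha>}. \<phi> x t \<partial>lborel)"
      by (intro nn_integral_mono) (auto simp: indicator_def \<phi>_def max_absorb2)
    then show ?thesis using *[OF that] by (rule order_trans)
  qed
  then show ?thesis by (intro exI[of _ "real N * \<gamma>0\<^sup>2 * B\<^sup>2"]) auto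
qed

text \<open>With \<open>J\<^sub>n = l\<^sub>n R(l\<^sub>n, A)\<close> and \<open>L\<^sub>n = C J\<^sub>n\<close> one has \<open>L\<^sub>n T(t) x = C T(t) J\<^sub>n x\<close>, so the admissibility
  estimate for the vector \<open>J\<^sub>n x\<close> of the domain bounds \<open>L\<^sub>n T(t) x\<close> for every \<open>x\<close>.  The operators \<open>L\<^sub>n\<close>
  themselves are bounded, but not uniformly in \<open>n\<close>; only their energies along orbits are.\<close>

lemma yosida_approximation:
  obtains L :: "nat \<Rightarrow> 'h \<Rightarrow>\<^sub>L 'h" and \<gamma> :: real
  where "\<gamma> \<ge> 0"
    and "\<And>n x. (\<integral>\<^sup>+t\<in>{0..\<tau>}. nsq (L n (T t x)) \<partial>lborel) \<le> ennreal (\<gamma> * (norm x)\<^sup>2)"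
    and "\<And>x. x \<in> yosida_domain DA A C \<Longrightarrow> (\<lambda>n. L n x) \<longlonglongrightarrow> yosida_extension DA A C x"
proof -
  obtain w B where w: "w \<ge> 0" "B \<ge> 1"
    and lin: "\<And>l. l > w \<Longrightarrow> bounded_linear (laplace l)"
    and bd: "\<And>l x. l > w \<Longrightarrow> norm (laplace l x) \<le> B / (l - w) * norm x"
    and dom: "\<And>l x. l > w \<Longrightarrow> laplace l x \<in> DA"
    and A_lap: "\<And>l x. l > w \<Longrightarrow> A (laplace l x) = l *\<^sub>R laplace l x - x"
    and comm: "\<And>l x t. l > w \<Longrightarrow> t \<ge> 0 \<Longrightarrow> laplace l (T t x) = T t (laplace l x)"
    using resolvent_laplace by blast
  obtain c where c: "c \<ge> 0" "\<And>x. x \<in> DA \<Longrightarrow> norm (C x) \<le> c * (norm x + norm (A x))"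
    using graph_bound by blast
  obtain g where g: "g \<ge> 0"
    "\<And>x. x \<in> DA \<Longrightarrow> (\<integral>\<^sup>+t\<in>{0..\<tau>}. nsq (C (T t x)) \<partial>lborel) \<le> ennreal (g * (norm x)\<^sup>2)"
    using admissible_on_interval by blast
  \<comment> \<open>The choice \<open>l n > 2 w\<close> makes \<open>l n / (l n - w) \<le> 2\<close>, which bounds the \<open>J n\<close> uniformly.\<close>
  define l where "l n = 2 * w + 1 + real n" for n
  have l: "l n > w" "l n > 0" "l n \<le> 2 * (l n - w)" for n using w by (auto simp: l_def)
  have res: "resolvent DA A (l n) = laplace (l n)" for n
    by (rule resolvent_eq) (use l lin dom A_lap comm in auto)
  define J where "J n x = l n *\<^sub>R laplace (l n) x" for n x
  have J_lin: "bounded_linear (J n)" for n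
    unfolding J_def by (intro bounded_linear_compose[OF bounded_linear_scaleR_right] lin l)
  have J_dom: "J n x \<in> DA" for n x
    unfolding J_def by (intro subspace_scale subspace_DA dom l)
  have J_comm: "t \<ge> 0 \<Longrightarrow> J n (T t x) = T t (J n x)" for n t x
    unfolding J_def using comm l by (simp add: blinfun.scaleR_right)
  have J_bd: "norm (J n x) \<le> 2 * B * norm x" for n x
  proof -
    have "norm (J n x) \<le> l n * (B / (l n - w) * norm x)"
      using mult_left_mono[OF bd[OF l(1)[of n], of x] less_imp_le[OF l(2)[of n]]] l(2)[of n]
      by (simp add: J_def)
    also have "\<dots> \<le> 2 * (l n - w) * (B / (l n - w) * norm x)"
      using l[of n] w by (intro mult_right_mono) auto
    also have "\<dots> = 2 * B * norm x" using l(1)[of n] by (simp add: field_simps)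
    finally show ?thesis .
  qed
  have CJ_lin: "bounded_linear (\<lambda>x. C (J n x))" for n
  proof -
    interpret J: bounded_linear "J n" by (rule J_lin)
    have AJ: "A (J n x) = l n *\<^sub>R (J n x - x)" for x
    proof -
      have "((\<lambda>h. l n *\<^sub>R ((T h (laplace (l n) x) - laplace (l n) x) /\<^sub>R h)) \<longlongrightarrow> l n *\<^sub>R A (laplace (l n) x)) (at_right 0)"
        by (intro tendsto_intros A_tendsto dom l)
      then have "((\<lambda>h. (T h (J n x) - J n x) /\<^sub>R h) \<longlongrightarrow> l n *\<^sub>R A (laplace (l n) x)) (at_right 0)"
        by (rule Lim_transform_eventually) (simp add: J_def blinfun.scaleR_right scaleR_diff_right mult.commute)
      then have "A (J n x) = l n *\<^sub>R A (laplace (l n) x)" by (rule generatorI)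
      then show ?thesis using A_lap[OF l(1)] by (simp add: J_def)
    qed
    show ?thesis
    proof (rule bounded_linear_intro[where K = "c * (2 * B + l n * (2 * B + 1))"])
      show "C (J n (x + y)) = C (J n x) + C (J n y)" for x y
        by (simp add: J.add C_add J_dom)
      show "C (J n (r *\<^sub>R x)) = r *\<^sub>R C (J n x)" for r x
        by (simp add: J.scaleR C_scaleR J_dom)
      show "norm (C (J n x)) \<le> norm x * (c * (2 * B + l n * (2 * B + 1)))" for x
      proof -
        have "norm (J n x - x) \<le> (2 * B + 1) * norm x"
          using norm_triangle_ineq4[of "J n x" x] J_bd[of n x] by (simp add: algebra_simps)
        then have "norm (A (J n x)) \<le> l n * ((2 * B + 1) * norm x)"
          using l(2)[of n] by (simp add: AJ)
        then have "norm (J n x) + norm (A (J n x)) \<le> norm x * (2 * B + l n * (2 * B + 1))"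
          using J_bd[of n x] by (simp add: algebra_simps)
        then have "c * (norm (J n x) + norm (A (J n x))) \<le> c * (norm x * (2 * B + l n * (2 * B + 1)))"
          using c(1) by (rule mult_left_mono)
        then show ?thesis using c(2)[OF J_dom[of n x]] by (simp add: mult_ac)
      qed
    qed
  qed
  define L where "L n = Blinfun (\<lambda>x. C (J n x))" for n
  have L: "blinfun_apply (L n) = (\<lambda>x. C (J n x))" for n
    unfolding L_def by (rule bounded_linear_Blinfun_apply[OF CJ_lin])
  show thesis
  proof (rule that[of "g * (2 * B)\<^sup>2" L])
    show "0 \<le> g * (2 * B)\<^sup>2" using g by simp
    show "(\<integral>\<^sup>+t\<in>{0..\<tau>}. nsq (L n (T t x)) \<partial>lborel) \<le> ennreal (g * (2 * B)\<^sup>2 * (norm x)\<^sup>2)" for n x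
    proof -
      have "(\<integral>\<^sup>+t\<in>{0..\<tau>}. nsq (L n (T t x)) \<partial>lborel) = (\<integral>\<^sup>+t\<in>{0..\<tau>}. nsq (C (T t (J n x))) \<partial>lborel)"
        by (intro nn_integral_cong) (auto simp: indicator_def L J_comm)
      also have "\<dots> \<le> ennreal (g * (norm (J n x))\<^sup>2)" by (rule g(2)[OF J_dom])
      also have "\<dots> \<le> ennreal (g * (2 * B * norm x)\<^sup>2)"
        using g(1) J_bd by (intro ennreal_leI mult_left_mono power_mono) auto
      finally show ?thesis by (simp add: power_mult_distrib mult.assoc)
    qed
    fix x assume "x \<in> yosida_domain DA A C"
    then obtain y where y: "((\<lambda>l. C (l *\<^sub>R resolvent DA A l x)) \<longlongrightarrow> y) at_top"
      by (auto simp: yosida_domain_def)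
    have lt: "filterlim l at_top sequentially"
      unfolding l_def by (intro filterlim_tendsto_add_at_top[OF tendsto_const] filterlim_real_sequentially)
    have "yosida_extension DA A C x = y"
      using y \<open>x \<in> yosida_domain DA A C\<close> by (auto simp: yosida_extension_def intro!: tendsto_Lim)
    then show "(\<lambda>n. L n x) \<longlonglongrightarrow> yosida_extension DA A C x"
      using filterlim_compose[OF y lt] by (simp add: L J_def res)
  qed
qed

end

section \<open>Covariances of Brownian increments\<close>

lemma Int_stable_vimages: "Int_stable {Z -` A \<inter> D |A. A \<in> sets L}"
proof (rule Int_stableI, clarsimp)
  fix A B assume "A \<in> sets L" "B \<in> sets L"
  then show "\<exists>C. Z -` A \<inter> D \<inter> (Z -` B \<inter> D) = Z -` C \<inter> D \<and> C \<in> sets L"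
    by (intro exI[of _ "A \<inter> B"]) auto
qed

context prob_space
begin

lemma indep_varI:
  assumes [measurable]: "X \<in> measurable M S" "Y \<in> measurable M N"
    and prod: "\<And>A B. A \<in> sets S \<Longrightarrow> B \<in> sets N \<Longrightarrow>
      prob ((X -` A \<inter> space M) \<inter> (Y -` B \<inter> space M)) = prob (X -` A \<inter> space M) * prob (Y -` B \<inter> space M)"
  shows "indep_var S X N Y"
  unfolding indep_var_eq
proof (intro conjI indep_set_sigma_sets)
  show "indep_set {X -` A \<inter> space M |A. A \<in> sets S} {Y -` A \<inter> space M |A. A \<in> sets N}"
    unfolding indep_sets2_eq using prod by auto
  show "Int_stable {X -` A \<inter> space M |A. A \<in> sets S}" by (rule Int_stable_vimages)
  show "Int_stable {Y -` A \<inter> space M |A. A \<in> sets N}" by (rule Int_stable_vimages)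
qed (use assms in auto)

lemma integrable_mult_L2:
  fixes f g :: "'a \<Rightarrow> real"
  assumes [measurable]: "f \<in> borel_measurable M" "g \<in> borel_measurable M"
    and "integrable M (\<lambda>x. (f x)\<^sup>2)" "integrable M (\<lambda>x. (g x)\<^sup>2)"
  shows "integrable M (\<lambda>x. f x * g x)"
proof (rule Bochner_Integration.integrable_bound)
  show "integrable M (\<lambda>x. (f x)\<^sup>2 + (g x)\<^sup>2)" using assms by simp
  show "AE x in M. norm (f x * g x) \<le> norm ((f x)\<^sup>2 + (g x)\<^sup>2)"
  proof (rule AE_I2)
    fix x
    have "2 * \<bar>f x\<bar> * \<bar>g x\<bar> \<le> \<bar>f x\<bar>\<^sup>2 + \<bar>g x\<bar>\<^sup>2" by (rule sum_squares_bound)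
    then have "\<bar>f x\<bar> * \<bar>g x\<bar> \<le> (f x)\<^sup>2 + (g x)\<^sup>2"
      using mult_nonneg_nonneg[OF abs_ge_zero[of "f x"] abs_ge_zero[of "g x"]]
      unfolding mult.assoc power2_abs by linarith
    then show "norm (f x * g x) \<le> norm ((f x)\<^sup>2 + (g x)\<^sup>2)"
      by (simp add: abs_mult)
  qed
qed measurable

text \<open>The variance is nonnegative.\<close>

lemma expectation_square_le:
  assumes "random_variable borel X" "integrable M (\<lambda>x. (X x)\<^sup>2)"
  shows "(expectation X)\<^sup>2 \<le> expectation (\<lambda>x. (X x :: real)\<^sup>2)"
  using variance_eq[OF square_integrable_imp_integrable[OF assms] assms(2)] variance_positive[of X] by simp

end

locale brownian_family = prob_space M
  for M :: "'w measure" +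
  fixes F :: "real \<Rightarrow> 'w measure" and K :: "nat set" and \<beta> :: "nat \<Rightarrow> real \<Rightarrow> 'w \<Rightarrow> real"
  assumes filtration: "normal_filtration M F"
    and brownian: "\<And>k. k \<in> K \<Longrightarrow> brownian_motion M F (\<beta> k)"
    and indep_paths: "indep_vars (\<lambda>_. \<Pi>\<^sub>M t\<in>{0..}. borel) (\<lambda>k \<omega>. \<lambda>t\<in>{0..}. \<beta> k t \<omega>) K"
begin

lemma subalgebra_F: "t \<ge> 0 \<Longrightarrow> subalgebra M (F t)"
  using conjunct1[OF filtration[unfolded normal_filtration_def]] by simp

lemma sets_F_mono: "0 \<le> s \<Longrightarrow> s \<le> t \<Longrightarrow> G \<in> sets (F s) \<Longrightarrow> G \<in> sets (F t)"
  using conjunct1[OF conjunct2[OF filtration[unfolded normal_filtration_def]]] by blast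

lemma sets_F: "t \<ge> 0 \<Longrightarrow> G \<in> sets (F t) \<Longrightarrow> G \<in> sets M"
  using subalgebra_F[of t] by (auto simp: subalgebra_def)

lemma measurable_F: "t \<ge> 0 \<Longrightarrow> f \<in> measurable (F t) N \<Longrightarrow> f \<in> measurable M N"
  by (rule measurable_from_subalg[OF subalgebra_F])

lemma measurable_F_mono:
  assumes "0 \<le> s" "s \<le> t" "f \<in> measurable (F s) N"
  shows "f \<in> measurable (F t) N"
proof -
  have "subalgebra (F t) (F s)"
    using sets_F_mono[OF assms(1,2)] subalgebra_F[of s] subalgebra_F[of t] assms
    by (auto simp: subalgebra_def)
  then show ?thesis using assms(3) by (rule measurable_from_subalg)
qed

lemma \<beta>_measurable_F: "k \<in> K \<Longrightarrow> t \<ge> 0 \<Longrightarrow> \<beta> k t \<in> borel_measurable (F t)"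
  using brownian by (auto simp: brownian_motion_def)

lemma \<beta>_measurable: "k \<in> K \<Longrightarrow> t \<ge> 0 \<Longrightarrow> \<beta> k t \<in> borel_measurable M"
  by (rule measurable_F[OF _ \<beta>_measurable_F])

definition incr :: "nat \<Rightarrow> real \<Rightarrow> real \<Rightarrow> 'w \<Rightarrow> real" where
  "incr k s t \<omega> = \<beta> k t \<omega> - \<beta> k s \<omega>"

lemma incr_refl [simp]: "incr k s s \<omega> = 0"
  by (simp add: incr_def)

lemma incr_measurable_F:
  assumes "k \<in> K" "0 \<le> s" "s \<le> t"
  shows "incr k s t \<in> borel_measurable (F t)"
proof -
  have "\<beta> k s \<in> borel_measurable (F t)"
    by (rule measurable_F_mono[OF assms(2,3) \<beta>_measurable_F[OF assms(1,2)]])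
  moreover have "\<beta> k t \<in> borel_measurable (F t)"
    using assms by (intro \<beta>_measurable_F) auto
  ultimately show ?thesis unfolding incr_def by (rule borel_measurable_diff[rotated])
qed

lemma incr_measurable: "k \<in> K \<Longrightarrow> 0 \<le> s \<Longrightarrow> s \<le> t \<Longrightarrow> incr k s t \<in> borel_measurable M"
  unfolding incr_def[abs_def] by (intro borel_measurable_diff \<beta>_measurable) simp_all

lemma
  assumes "k \<in> K" "0 \<le> s" "s \<le> t"
  shows integrable_incr_sq: "integrable M (\<lambda>\<omega>. (incr k s t \<omega>)\<^sup>2)"
    and expectation_incr_sq: "expectation (\<lambda>\<omega>. (incr k s t \<omega>)\<^sup>2) = t - s"
    and expectation_incr: "expectation (incr k s t) = 0"
proof -
  have "integrable M (\<lambda>\<omega>. (incr k s t \<omega>)\<^sup>2) \<and> expectation (\<lambda>\<omega>. (incr k s t \<omega>)\<^sup>2) = t - s \<and> expectation (incr k s t) = 0"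
  proof (cases "s = t")
    case True
    moreover have "incr k t t = (\<lambda>_. 0)" by auto
    ultimately show ?thesis by simp
  next
    case False
    then have st: "s < t" using assms by simp
    then have D: "distributed M lborel (incr k s t) (normal_density 0 (sqrt (t - s)))"
      using brownian[OF assms(1)] assms by (auto simp: brownian_motion_def incr_def[abs_def])
    have pos: "0 < sqrt (t - s)" using st by simp
    have "integrable M (\<lambda>\<omega>. (incr k s t \<omega>)\<^sup>2)"
      using integrable_normal_moment[OF pos, of 0 2]
      by (subst distributed_integrable[OF D, symmetric]) auto
    moreover have E: "expectation (incr k s t) = 0"
      by (rule normal_distributed_expectation[OF pos D])
    moreover have "expectation (\<lambda>\<omega>. (incr k s t \<omega>)\<^sup>2) = t - s"
      using normal_distributed_variance[OF pos D] E st by simp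
    ultimately show ?thesis by simp
  qed
  then show "integrable M (\<lambda>\<omega>. (incr k s t \<omega>)\<^sup>2)" "expectation (\<lambda>\<omega>. (incr k s t \<omega>)\<^sup>2) = t - s"
    "expectation (incr k s t) = 0" by auto
qed

lemma integrable_incr: "k \<in> K \<Longrightarrow> 0 \<le> s \<Longrightarrow> s \<le> t \<Longrightarrow> integrable M (incr k s t)"
  by (rule square_integrable_imp_integrable[OF incr_measurable integrable_incr_sq])

lemma integrable_incr_mult:
  "j \<in> K \<Longrightarrow> k \<in> K \<Longrightarrow> 0 \<le> s \<Longrightarrow> s \<le> t \<Longrightarrow> 0 \<le> s' \<Longrightarrow> s' \<le> t' \<Longrightarrow>
    integrable M (\<lambda>\<omega>. incr j s t \<omega> * incr k s' t' \<omega>)"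
  by (intro integrable_mult_L2 incr_measurable integrable_incr_sq)

lemma indep_past_incr:
  assumes k: "k \<in> K" and st: "0 \<le> s" "s \<le> t" and Y: "Y \<in> borel_measurable (F s)"
  shows "indep_var borel Y borel (incr k s t)"
proof (rule indep_varI)
  show [measurable]: "random_variable borel Y" by (rule measurable_F[OF st(1) Y])
  show [measurable]: "random_variable borel (incr k s t)" using k st by (rule incr_measurable)
  fix A B :: "real set" assume A: "A \<in> sets borel" and B: "B \<in> sets borel"
  show "prob ((Y -` A \<inter> space M) \<inter> (incr k s t -` B \<inter> space M))
      = prob (Y -` A \<inter> space M) * prob (incr k s t -` B \<inter> space M)"
  proof (cases "s = t")
    case True
    then show ?thesis by (cases "0 \<in> B") (auto simp: vimage_def prob_space)
  next
    case False
    then have "indep_set (sets (F s)) {(\<lambda>\<omega>. \<beta> k t \<omega> - \<beta> k s \<omega>) -` B \<inter> space M | B. B \<in> sets borel}"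
      using brownian[OF k] st by (auto simp: brownian_motion_def)
    moreover have "Y -` A \<inter> space M \<in> sets (F s)"
      using measurable_sets[OF Y A] subalgebra_F[OF st(1)] by (simp add: subalgebra_def)
    ultimately show ?thesis
      using B unfolding indep_sets2_eq incr_def by blast
  qed
qed

lemma
  assumes "k \<in> K" "0 \<le> s" "s \<le> t" "Y \<in> borel_measurable (F s)" "integrable M Y"
  shows integrable_past_mult_incr: "integrable M (\<lambda>\<omega>. Y \<omega> * incr k s t \<omega>)"
    and expectation_past_mult_incr: "expectation (\<lambda>\<omega>. Y \<omega> * incr k s t \<omega>) = 0"
proof -
  note indep = indep_past_incr[OF assms(1-4)] and int = integrable_incr[OF assms(1-3)]
  show "integrable M (\<lambda>\<omega>. Y \<omega> * incr k s t \<omega>)"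
    by (rule indep_var_integrable[OF indep assms(5) int])
  show "expectation (\<lambda>\<omega>. Y \<omega> * incr k s t \<omega>) = 0"
    by (simp add: indep_var_lebesgue_integral[OF indep assms(5) int] expectation_incr[OF assms(1-3)])
qed

lemma indep_incr_products:
  assumes jk: "j \<in> K" "k \<in> K" "j \<noteq> k"
    and "0 \<le> a" "0 \<le> b" "0 \<le> c" "0 \<le> d"
  shows "indep_var borel (\<lambda>\<omega>. incr j a b \<omega> * incr j c d \<omega>) borel (\<lambda>\<omega>. incr k a b \<omega> * incr k c d \<omega>)"
proof -
  let ?P = "\<Pi>\<^sub>M t\<in>{0..}. borel :: real measure"
  define X where "X i \<omega> = (\<lambda>t\<in>{0..}. \<beta> i t \<omega>)" for i \<omega>
  define g where "g x = (x b - x a) * (x d - x c)" for x :: "real \<Rightarrow> real"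
  have [measurable]: "g \<in> borel_measurable ?P"
    unfolding g_def using assms(4-7)
    by (intro borel_measurable_times borel_measurable_diff measurable_component_singleton) simp_all
  have indep_X: "indep_vars (\<lambda>_. ?P) X K"
    unfolding X_def[abs_def] by (rule indep_paths)
  have "X i \<in> measurable M ?P" if "i \<in> K" for i
    using conjunct1[OF indep_X[unfolded indep_vars_def]] that by (rule bspec)
  then have rv [measurable]: "X j \<in> measurable M ?P" "X k \<in> measurable M ?P"
    using jk by blast+
  have "indep_var ?P (X j) ?P (X k)"
  proof (rule indep_varI[OF rv])
    fix A B :: "(real \<Rightarrow> real) set" assume "A \<in> sets ?P" "B \<in> sets ?P"
    then have "prob (\<Inter>i\<in>{j, k}. X i -` (if i = j then A else B) \<inter> space M)
        = (\<Prod>i\<in>{j, k}. prob (X i -` (if i = j then A else B) \<inter> space M))"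
      using jk indep_varsD[OF indep_X, of "{j, k}" "\<lambda>i. if i = j then A else B"] by simp
    then show "prob ((X j -` A \<inter> space M) \<inter> (X k -` B \<inter> space M)) = prob (X j -` A \<inter> space M) * prob (X k -` B \<inter> space M)"
      using jk by (simp add: Int_ac)
  qed
  then have "indep_var borel (g \<circ> X j) borel (g \<circ> X k)"
    by (rule indep_var_compose) measurable
  then show ?thesis
    using assms by (simp add: comp_def g_def X_def incr_def)
qed

text \<open>Each Brownian motion has increments independent of the past, but this alone says nothing about
  products of increments of two of them.  Cut \<open>[s, t]\<close> into \<open>n\<close> equal steps.  The discrete product
  rule writes the product of the two increments over \<open>[s, t]\<close> as a discrete covariation \<open>S\<close> plus terms
  in which the increment over a step multiplies something known before that step; those terms have
  mean 0 on \<open>G\<close>.  Independence of the two paths gives \<open>E S\<^sup>2 = (t - s)\<^sup>2 / n\<close>, so the contribution of \<open>S\<close>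
  vanishes as \<open>n\<close> grows.\<close>

lemma expectation_past_incr_incr_distinct:
  assumes jk: "j \<in> K" "k \<in> K" "j \<noteq> k" and st: "0 \<le> s" "s \<le> t" and G: "G \<in> sets (F s)"
  shows "expectation (\<lambda>\<omega>. indicator G \<omega> * (incr j s t \<omega> * incr k s t \<omega>)) = 0"
proof -
  define c where "c = expectation (\<lambda>\<omega>. indicator G \<omega> * (incr j s t \<omega> * incr k s t \<omega>))"
  have [measurable]: "G \<in> sets M" using sets_F[OF st(1) G] .
  have c_le: "c\<^sup>2 \<le> (t - s)\<^sup>2 / real (Suc m)" for m
  proof -
    define n where "n = Suc m"
    define d where "d = (t - s) / n"
    define p where "p i = s + real i * d" for i
    have n: "n > 0" by (simp add: n_def)
    have p_step: "p (Suc i) - p i = (t - s) / n" for i by (simp add: p_def distrib_right flip: d_def)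
    have d: "d \<ge> 0" using st by (simp add: d_def)
    have p_mono: "i \<le> l \<Longrightarrow> p i \<le> p l" for i l
      unfolding p_def using d by (intro add_left_mono mult_right_mono) auto
    have p0: "p 0 = s" and pn: "p n = t" using n by (auto simp: p_def d_def)
    have p_ge: "p i \<ge> 0" "s \<le> p i" for i using p_mono[of 0 i] p0 st by auto
    have p_le: "p i \<le> p (Suc i)" for i by (rule p_mono) simp
    define \<delta> where "\<delta> k i = incr k (p i) (p (Suc i))" for k i
    define S where "S \<omega> = (\<Sum>i<n. \<delta> j i \<omega> * \<delta> k i \<omega>)" for \<omega>
    have \<delta>_meas [measurable]: "\<delta> l i \<in> borel_measurable M" if "l \<in> K" for l i
      unfolding \<delta>_def using that p_ge p_le by (intro incr_measurable)
    note [measurable] = \<delta>_meas[OF jk(1)] \<delta>_meas[OF jk(2)] incr_measurable[OF jk(1)] incr_measurable[OF jk(2)]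
    have G_F: "(indicator G :: _ \<Rightarrow> real) \<in> borel_measurable (F (p i))" for i
      using sets_F_mono[OF st(1) p_ge(2) G] by simp
    have past: "integrable M (\<lambda>\<omega>. indicator G \<omega> * incr q s (p i) \<omega> * \<delta> r i \<omega>)
        \<and> expectation (\<lambda>\<omega>. indicator G \<omega> * incr q s (p i) \<omega> * \<delta> r i \<omega>) = 0" if "q \<in> K" "r \<in> K" for q r i
    proof -
      have "(\<lambda>\<omega>. indicator G \<omega> * incr q s (p i) \<omega>) \<in> borel_measurable (F (p i))"
        using that st p_ge by (intro borel_measurable_times G_F incr_measurable_F) auto
      moreover have "integrable M (\<lambda>\<omega>. indicator G \<omega> * incr q s (p i) \<omega>)"
        using integrable_mult_indicator[of G M "incr q s (p i)"] integrable_incr[OF \<open>q \<in> K\<close> st(1) p_ge(2)] by simp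
      ultimately show ?thesis
        unfolding \<delta>_def using that p_ge p_le
          integrable_past_mult_incr[of r "p i" "p (Suc i)" "\<lambda>\<omega>. indicator G \<omega> * incr q s (p i) \<omega>"]
          expectation_past_mult_incr[of r "p i" "p (Suc i)" "\<lambda>\<omega>. indicator G \<omega> * incr q s (p i) \<omega>"]
        by simp
    qed
    have decomp: "incr j s t \<omega> * incr k s t \<omega>
        = S \<omega> + (\<Sum>i<n. incr j s (p i) \<omega> * \<delta> k i \<omega>) + (\<Sum>i<n. incr k s (p i) \<omega> * \<delta> j i \<omega>)" for \<omega>
    proof -
      have "incr j s (p n) \<omega> * incr k s (p n) \<omega> - incr j s (p 0) \<omega> * incr k s (p 0) \<omega>
          = (\<Sum>i<n. incr j s (p (Suc i)) \<omega> * incr k s (p (Suc i)) \<omega> - incr j s (p i) \<omega> * incr k s (p i) \<omega>)"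
        by (rule sum_lessThan_telescope[symmetric])
      also have "\<dots> = (\<Sum>i<n. \<delta> j i \<omega> * \<delta> k i \<omega> + incr j s (p i) \<omega> * \<delta> k i \<omega> + incr k s (p i) \<omega> * \<delta> j i \<omega>)"
        by (intro sum.cong refl) (simp add: \<delta>_def incr_def algebra_simps)
      finally show ?thesis by (simp add: S_def p0 pn sum.distrib)
    qed
    have S_int: "integrable M (\<lambda>\<omega>. indicator G \<omega> * S \<omega>)"
    proof -
      have "integrable M S"
        unfolding S_def \<delta>_def using jk p_ge p_le
        by (intro Bochner_Integration.integrable_sum integrable_incr_mult)
      then show ?thesis using integrable_mult_indicator[of G M S] by simp
    qed
    have "c = expectation (\<lambda>\<omega>. indicator G \<omega> * S \<omega>
        + (\<Sum>i<n. indicator G \<omega> * incr j s (p i) \<omega> * \<delta> k i \<omega>) + (\<Sum>i<n. indicator G \<omega> * incr k s (p i) \<omega> * \<delta> j i \<omega>))"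
      unfolding c_def decomp by (simp add: distrib_left sum_distrib_left mult.assoc)
    also have "\<dots> = expectation (\<lambda>\<omega>. indicator G \<omega> * S \<omega>)"
      using S_int past jk by simp
    finally have c_S: "c = expectation (\<lambda>\<omega>. indicator G \<omega> * S \<omega>)" .
    have sq: "(S \<omega>)\<^sup>2 = (\<Sum>i<n. \<Sum>l<n. (\<delta> j i \<omega> * \<delta> j l \<omega>) * (\<delta> k i \<omega> * \<delta> k l \<omega>))" for \<omega>
      by (simp add: S_def power2_eq_square sum_product mult_ac)
    have entry: "integrable M (\<lambda>\<omega>. (\<delta> j i \<omega> * \<delta> j l \<omega>) * (\<delta> k i \<omega> * \<delta> k l \<omega>))
        \<and> expectation (\<lambda>\<omega>. (\<delta> j i \<omega> * \<delta> j l \<omega>) * (\<delta> k i \<omega> * \<delta> k l \<omega>)) = (if i = l then ((t - s) / n)\<^sup>2 else 0)" for i l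
    proof -
      have I: "indep_var borel (\<lambda>\<omega>. \<delta> j i \<omega> * \<delta> j l \<omega>) borel (\<lambda>\<omega>. \<delta> k i \<omega> * \<delta> k l \<omega>)"
        unfolding \<delta>_def using jk p_ge by (intro indep_incr_products)
      have i1: "integrable M (\<lambda>\<omega>. \<delta> q i \<omega> * \<delta> q l \<omega>)" if "q \<in> K" for q
        unfolding \<delta>_def using that p_ge p_le by (intro integrable_incr_mult)
      have E_lt: "expectation (\<lambda>\<omega>. \<delta> q x \<omega> * \<delta> q y \<omega>) = 0" if "q \<in> K" "x < y" for q x y
      proof -
        have "\<delta> q x \<in> borel_measurable (F (p y))"
          unfolding \<delta>_def using that p_ge p_le
          by (intro measurable_F_mono[OF _ p_mono incr_measurable_F, of "Suc x"]) auto
        then show ?thesis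
          unfolding \<delta>_def[of q y] using that p_ge p_le
          by (intro expectation_past_mult_incr) (auto simp: \<delta>_def intro!: integrable_incr)
      qed
      have E: "expectation (\<lambda>\<omega>. \<delta> q i \<omega> * \<delta> q l \<omega>) = (if i = l then (t - s) / n else 0)" if "q \<in> K" for q
      proof (cases i l rule: linorder_cases)
        case less then show ?thesis using E_lt[OF that less] by simp
      next
        case greater then show ?thesis using E_lt[OF that greater] by (simp add: mult.commute)
      next
        case equal
        then show ?thesis
          using expectation_incr_sq[OF that p_ge(1) p_le, of i] by (simp add: \<delta>_def p_step flip: power2_eq_square)
      qed
      show ?thesis
        using indep_var_integrable[OF I i1 i1] indep_var_lebesgue_integral[OF I i1 i1] jk E
        by (simp add: power2_eq_square)
    qed
    have S2_int: "integrable M (\<lambda>\<omega>. (S \<omega>)\<^sup>2)"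
      unfolding sq using entry by (intro Bochner_Integration.integrable_sum) auto
    have "expectation (\<lambda>\<omega>. (S \<omega>)\<^sup>2) = (\<Sum>i<n. \<Sum>l<n. if i = l then ((t - s) / n)\<^sup>2 else 0)"
      unfolding sq using entry by simp
    also have "\<dots> = (t - s)\<^sup>2 / n"
      using n by (simp add: power2_eq_square field_simps)
    finally have S2: "expectation (\<lambda>\<omega>. (S \<omega>)\<^sup>2) = (t - s)\<^sup>2 / n" .
    have G2: "(indicator G \<omega> * S \<omega>)\<^sup>2 = indicator G \<omega> * (S \<omega>)\<^sup>2" for \<omega>
      by (simp add: indicator_def)
    have [measurable]: "S \<in> borel_measurable M" unfolding S_def by measurable
    have GS2_int: "integrable M (\<lambda>\<omega>. (indicator G \<omega> * S \<omega>)\<^sup>2)"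
      unfolding G2 using integrable_mult_indicator[OF _ S2_int, of G] by simp
    have "c\<^sup>2 \<le> expectation (\<lambda>\<omega>. (indicator G \<omega> * S \<omega>)\<^sup>2)"
      unfolding c_S by (rule expectation_square_le[OF _ GS2_int]) measurable
    also have "\<dots> \<le> expectation (\<lambda>\<omega>. (S \<omega>)\<^sup>2)"
      by (intro integral_mono GS2_int S2_int) (simp add: indicator_def)
    finally show ?thesis using S2 by (simp add: n_def)
  qed
  have "(\<lambda>m. (t - s)\<^sup>2 / real (Suc m)) \<longlonglongrightarrow> 0"
    using tendsto_mult_right_zero[OF LIMSEQ_inverse_real_of_nat, of "(t - s)\<^sup>2"] by (simp add: divide_inverse)
  then have "c\<^sup>2 \<le> 0"
    by (rule LIMSEQ_le_const) (use c_le in auto)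
  then show ?thesis by (simp add: c_def)
qed

lemma expectation_past_incr_sq:
  assumes k: "k \<in> K" and st: "0 \<le> s" "s \<le> t" and G: "G \<in> sets (F s)"
  shows "expectation (\<lambda>\<omega>. indicator G \<omega> * (incr k s t \<omega> * incr k s t \<omega>)) = prob G * (t - s)"
proof -
  have [measurable]: "G \<in> sets M" using sets_F[OF st(1) G] .
  have "indep_var borel (indicator G :: _ \<Rightarrow> real) borel (incr k s t)"
    using k st G by (intro indep_past_incr) auto
  then have "indep_var borel (indicator G :: _ \<Rightarrow> real) borel ((\<lambda>x. x * x) \<circ> incr k s t)"
    using indep_var_compose[of borel "indicator G" borel "incr k s t" "\<lambda>x. x" borel "\<lambda>x. x * x" borel]
    by (simp add: comp_def)
  then have "expectation (\<lambda>\<omega>. indicator G \<omega> * (incr k s t \<omega> * incr k s t \<omega>))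
      = expectation (indicator G) * expectation (\<lambda>\<omega>. (incr k s t \<omega>)\<^sup>2)"
    using integrable_incr_sq[OF k st]
    by (subst indep_var_lebesgue_integral[symmetric])
       (auto simp: comp_def power2_eq_square intro!: integrable_real_indicator simp: emeasure_eq_measure)
  then show ?thesis using expectation_incr_sq[OF k st] by simp
qed

lemma integrable_indicator_incr_incr:
  assumes "j \<in> K" "k \<in> K" "0 \<le> a" "a \<le> b" "0 \<le> a'" "a' \<le> b'" "G \<in> sets M"
  shows "integrable M (\<lambda>\<omega>. indicator G \<omega> * (incr j a b \<omega> * incr k a' b' \<omega>))"
  using integrable_mult_indicator[OF assms(7) integrable_incr_mult[OF assms(1-6)]] by simp

text \<open>Only the overlap of the two intervals contributes: after both are cut at its end points, every
  other pair of pieces consists of an increment and something that lies in its past.\<close>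

lemma incr_covariance_ordered:
  assumes jk: "j \<in> K" "k \<in> K" and ab: "0 \<le> a" "a \<le> b" "a' \<le> b'" "a \<le> a'"
    and G: "G \<in> sets (F a')"
  shows "expectation (\<lambda>\<omega>. indicator G \<omega> * (incr j a b \<omega> * incr k a' b' \<omega>))
    = (if j = k then prob G * measure lborel ({a<..b} \<inter> {a'<..b'}) else 0)"
proof -
  have a': "0 \<le> a'" using ab by simp
  have G_M: "G \<in> sets M" by (rule sets_F[OF a' G])

  have past: "expectation (\<lambda>\<omega>. indicator G \<omega> * (incr q x y \<omega> * incr r x' y' \<omega>)) = 0"
    if "q \<in> K" "r \<in> K" "0 \<le> x" "x \<le> y" "y \<le> x'" "a' \<le> x'" "x' \<le> y'" for q r x y x' y'
  proof -
    have G': "G \<in> sets (F x')" using sets_F_mono[OF a' that(6) G] .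
    have "(\<lambda>\<omega>. indicator G \<omega> * incr q x y \<omega>) \<in> borel_measurable (F x')"
      using G' that by (intro borel_measurable_times borel_measurable_indicator measurable_F_mono[OF _ \<open>y \<le> x'\<close> incr_measurable_F]) auto
    moreover have "integrable M (\<lambda>\<omega>. indicator G \<omega> * incr q x y \<omega>)"
      using integrable_mult_indicator[OF G_M integrable_incr[OF that(1,3,4)]] by simp
    ultimately show ?thesis
      using expectation_past_mult_incr[of r x' y' "\<lambda>\<omega>. indicator G \<omega> * incr q x y \<omega>"] that
      by (simp add: mult.assoc)
  qed
  show ?thesis
  proof (cases "b \<le> a'")
    case True
    then have "{a<..b} \<inter> {a'<..b'} = {}" by auto
    then show ?thesis using past[of j k a b a' b'] True jk ab by simp
  next
    case False
    \<comment> \<open>The overlap is \<open>{a'<..v}\<close>, and one of the two increments after \<open>v\<close> is over an empty interval.\<close>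
    define v where "v = min b b'"
    have v: "a' \<le> v" "v \<le> b" "v \<le> b'" "v = b \<or> v = b'" using False ab by (auto simp: v_def)
    note int = integrable_indicator_incr_incr[OF _ _ _ _ _ _ G_M]
    have "expectation (\<lambda>\<omega>. indicator G \<omega> * (incr j a b \<omega> * incr k a' b' \<omega>))
        = expectation (\<lambda>\<omega>. indicator G \<omega> * (incr j a a' \<omega> * incr k a' b' \<omega>) + indicator G \<omega> * (incr j a' v \<omega> * incr k a' v \<omega>)
          + indicator G \<omega> * (incr j a' v \<omega> * incr k v b' \<omega>) + indicator G \<omega> * (incr k a' v \<omega> * incr j v b \<omega>)
          + indicator G \<omega> * (incr j v b \<omega> * incr k v b' \<omega>))"
      by (intro Bochner_Integration.integral_cong refl) (simp add: incr_def algebra_simps)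
    also have "\<dots> = expectation (\<lambda>\<omega>. indicator G \<omega> * (incr j a a' \<omega> * incr k a' b' \<omega>))
        + expectation (\<lambda>\<omega>. indicator G \<omega> * (incr j a' v \<omega> * incr k a' v \<omega>))
        + expectation (\<lambda>\<omega>. indicator G \<omega> * (incr j a' v \<omega> * incr k v b' \<omega>))
        + expectation (\<lambda>\<omega>. indicator G \<omega> * (incr k a' v \<omega> * incr j v b \<omega>))
        + expectation (\<lambda>\<omega>. indicator G \<omega> * (incr j v b \<omega> * incr k v b' \<omega>))"
      using ab v a' jk by (simp add: int del: integral_indicator)
    also have "\<dots> = expectation (\<lambda>\<omega>. indicator G \<omega> * (incr j a' v \<omega> * incr k a' v \<omega>))"
    proof -
      have z1: "expectation (\<lambda>\<omega>. indicator G \<omega> * (incr j a a' \<omega> * incr k a' b' \<omega>)) = 0"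
        by (rule past) (use ab jk in auto)
      have z2: "expectation (\<lambda>\<omega>. indicator G \<omega> * (incr j a' v \<omega> * incr k v b' \<omega>)) = 0"
        by (rule past) (use ab jk v a' in auto)
      have z3: "expectation (\<lambda>\<omega>. indicator G \<omega> * (incr k a' v \<omega> * incr j v b \<omega>)) = 0"
        by (rule past) (use ab jk v a' in auto)
      have z4: "(\<lambda>\<omega>. indicator G \<omega> * (incr j v b \<omega> * incr k v b' \<omega>)) = (\<lambda>\<omega>. 0 :: real)"
        using v(4) by auto
      show ?thesis by (simp only: z1 z2 z3 z4) simp
    qed
    also have "\<dots> = (if j = k then prob G * (v - a') else 0)"
    proof (cases "j = k")
      case True
      then show ?thesis using expectation_past_incr_sq[OF jk(2) a' v(1) G] by simp
    next
      case False
      then show ?thesis using expectation_past_incr_incr_distinct[OF jk False a' v(1) G] by simp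
    qed
    also have "v - a' = measure lborel ({a<..b} \<inter> {a'<..b'})"
    proof -
      have "{a<..b} \<inter> {a'<..b'} = {a'<..v}" using ab False by (auto simp: v_def)
      then show ?thesis using v by simp
    qed
    finally show ?thesis .
  qed
qed

lemma incr_covariance:
  assumes jk: "j \<in> K" "k \<in> K" and ab: "0 \<le> a" "a \<le> b" "0 \<le> a'" "a' \<le> b'"
    and G: "G \<in> sets (F a)" "G' \<in> sets (F a')"
  shows "expectation (\<lambda>\<omega>. (indicator G \<omega> * incr j a b \<omega>) * (indicator G' \<omega> * incr k a' b' \<omega>))
    = (if j = k then prob (G \<inter> G') * measure lborel ({a<..b} \<inter> {a'<..b'}) else 0)"
proof (cases "a \<le> a'")
  case True
  have "G \<inter> G' \<in> sets (F a')" using sets_F_mono[OF ab(1) True G(1)] G(2) by auto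
  from incr_covariance_ordered[OF jk ab(1,2,4) True this] show ?thesis
    by (simp add: indicator_inter_arith mult_ac)
next
  case False
  then have "a' \<le> a" by simp
  have "G' \<inter> G \<in> sets (F a)" using sets_F_mono[OF ab(3) \<open>a' \<le> a\<close> G(2)] G(1) by auto
  from incr_covariance_ordered[OF jk(2,1) ab(3,4,2) \<open>a' \<le> a\<close> this] show ?thesis
    by (simp add: indicator_inter_arith mult_ac Int_commute)
qed

end

section \<open>Hilbert-Schmidt norms\<close>

text \<open>The squared Hilbert-Schmidt norm as a series of extended nonnegative reals.  A divergent series
  has the value infinity here, whereas \<open>hs_norm\<close> is then 0 by the convention for infinite sums;
  thus \<open>hs2\<close> is monotone and can be integrated term by term without a summability condition.\<close>

definition hs2 :: "nat set \<Rightarrow> (nat \<Rightarrow> real) \<Rightarrow> (nat \<Rightarrow> 'v) \<Rightarrow> ('v \<Rightarrow> 'h::real_normed_vector) \<Rightarrow> ennreal" where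
  "hs2 K lam e D = (\<Sum>k. if k \<in> K then nsq (sqrt (lam k) *\<^sub>R D (e k)) else 0)"

lemma hs2_eq_hs_norm:
  assumes "(\<lambda>k. (norm (sqrt (lam k) *\<^sub>R D (e k)))\<^sup>2) summable_on K"
  shows "hs2 K lam e D = ennreal ((hs_norm K lam e D)\<^sup>2)"
proof -
  define g where "g k = (norm (sqrt (lam k) *\<^sub>R D (e k)))\<^sup>2" for k
  have "(g has_sum infsum g K) K" using assms unfolding g_def by (rule has_sum_infsum)
  then have "((\<lambda>k. if k \<in> K then g k else 0) has_sum infsum g K) UNIV"
    by (rule has_sum_cong_neutral[THEN iffD2, rotated 3]) auto
  then have sums: "(\<lambda>k. if k \<in> K then g k else 0) sums infsum g K"
    by (rule has_sum_imp_sums)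
  have "hs2 K lam e D = (\<Sum>k. ennreal (if k \<in> K then g k else 0))"
    unfolding hs2_def g_def by (intro suminf_cong) simp
  also have "\<dots> = ennreal (infsum g K)"
    by (rule suminf_ennreal_eq[OF _ sums]) (simp add: g_def)
  also have "infsum g K = (hs_norm K lam e D)\<^sup>2"
    unfolding hs_norm_def g_def by (simp add: infsum_nonneg)
  finally show ?thesis .
qed

lemma norm_add_sq_le: "(norm (a + b :: 'a::real_normed_vector))\<^sup>2 \<le> 2 * (norm a)\<^sup>2 + 2 * (norm b)\<^sup>2"
proof -
  have "(norm (a + b))\<^sup>2 \<le> (norm a + norm b)\<^sup>2"
    by (intro power_mono norm_triangle_ineq) simp
  also have "\<dots> \<le> 2 * (norm a)\<^sup>2 + 2 * (norm b)\<^sup>2"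
    using sum_squares_bound[of "norm a" "norm b"] by (simp add: power2_sum)
  finally show ?thesis .
qed

lemma ennreal_norm_add_sq_le:
  "nsq (a + b :: 'a::real_normed_vector) \<le> 2 * nsq a + 2 * nsq b"
proof -
  have "nsq (a + b) \<le> ennreal (2 * (norm a)\<^sup>2 + 2 * (norm b)\<^sup>2)"
    by (intro ennreal_leI norm_add_sq_le)
  then show ?thesis by (simp add: ennreal_mult')
qed

lemma ennreal_norm_diff_sq_le:
  "nsq (a - b :: 'a::real_normed_vector) \<le> 2 * nsq a + 2 * nsq b"
  using ennreal_norm_add_sq_le[of a "- b"] by simp

lemma ennreal_norm_blinfun_sq_le:
  "nsq (blinfun_apply L x) \<le> nsq L * nsq x"
proof -
  have "(norm (blinfun_apply L x))\<^sup>2 \<le> (norm L * norm x)\<^sup>2"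
    by (intro power_mono norm_blinfun) simp
  then show ?thesis by (simp add: power_mult_distrib flip: ennreal_mult)
qed

lemma hs2_add: "hs2 K lam e (\<lambda>v. D v + E v) \<le> 2 * hs2 K lam e D + 2 * hs2 K lam e E"
proof -
  have "hs2 K lam e (\<lambda>v. D v + E v) \<le> (\<Sum>k. 2 * (if k \<in> K then nsq (sqrt (lam k) *\<^sub>R D (e k)) else 0)
      + 2 * (if k \<in> K then nsq (sqrt (lam k) *\<^sub>R E (e k)) else 0))"
    unfolding hs2_def
    by (intro suminf_le) (use ennreal_norm_add_sq_le in \<open>auto simp: scaleR_add_right simp del: norm_scaleR\<close>)
  also have "\<dots> = 2 * hs2 K lam e D + 2 * hs2 K lam e E"
    unfolding hs2_def by (simp add: suminf_add[symmetric] ennreal_suminf_cmult)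
  finally show ?thesis .
qed

lemma hs2_diff: "hs2 K lam e (\<lambda>v. D v - E v) \<le> 2 * hs2 K lam e D + 2 * hs2 K lam e E"
proof -
  have "hs2 K lam e (\<lambda>v. - E v) = hs2 K lam e E" unfolding hs2_def by (intro suminf_cong) simp
  then show ?thesis using hs2_add[of K lam e D "\<lambda>v. - E v"] by simp
qed

lemma hs2_blinfun: "hs2 K lam e (\<lambda>v. blinfun_apply L (D v)) \<le> nsq L * hs2 K lam e D"
proof -
  have "hs2 K lam e (\<lambda>v. blinfun_apply L (D v))
      \<le> (\<Sum>k. nsq L * (if k \<in> K then nsq (sqrt (lam k) *\<^sub>R D (e k)) else 0))"
    unfolding hs2_def
    by (intro suminf_le)
       (auto simp: blinfun.scaleR_right[symmetric] simp del: norm_scaleR intro: ennreal_norm_blinfun_sq_le)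
  also have "\<dots> = nsq L * hs2 K lam e D"
    unfolding hs2_def by (rule ennreal_suminf_cmult)
  finally show ?thesis .
qed

lemma hs2_measurable [measurable (raw)]:
  fixes D :: "'x \<Rightarrow> 'v \<Rightarrow> 'h::{real_normed_vector, second_countable_topology}"
  assumes "\<And>k. k \<in> K \<Longrightarrow> (\<lambda>x. sqrt (lam k) *\<^sub>R D x (e k)) \<in> borel_measurable N"
  shows "(\<lambda>x. hs2 K lam e (D x)) \<in> borel_measurable N"
  unfolding hs2_def
proof (intro borel_measurable_suminf_order)
  fix k
  show "(\<lambda>x. if k \<in> K then nsq (sqrt (lam k) *\<^sub>R D x (e k)) else 0) \<in> borel_measurable N"
  proof (cases "k \<in> K")
    case True
    note [measurable] = assms[OF True]
    show ?thesis using True by (simp del: norm_scaleR)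
  qed simp
qed

section \<open>Elementary stochastic integrals\<close>

lemma elementary_process_append:
  "elementary_process (xs @ ys) s \<omega> v = elementary_process xs s \<omega> v + elementary_process ys s \<omega> v"
  by (simp add: elementary_process_def)

lemma elementary_integral_append:
  "elementary_integral W (xs @ ys) t \<omega> = elementary_integral W xs t \<omega> + elementary_integral W ys t \<omega>"
  by (simp add: elementary_integral_def)

text \<open>A bounded operator applied to an elementary process gives an elementary process again.  So an
  estimate for integrals of elementary processes contains the one for their images under a bounded
  operator.\<close>

lemma elementary_process_compose:
  "elementary_process (map (\<lambda>(a, b, G, D). (a, b, G, L o\<^sub>L D)) xs) s \<omega> v = blinfun_apply L (elementary_process xs s \<omega> v)"
  by (induction xs) (auto simp: elementary_process_def blinfun.add_right blinfun.scaleR_right)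

lemma elementary_integral_compose:
  "elementary_integral W (map (\<lambda>(a, b, G, D). (a, b, G, L o\<^sub>L D)) xs) t \<omega> = blinfun_apply L (elementary_integral W xs t \<omega>)"
  by (induction xs) (auto simp: elementary_integral_def blinfun.add_right blinfun.scaleR_right)

lemma elementary_adapted_compose:
  "elementary_adapted F xs \<Longrightarrow> elementary_adapted F (map (\<lambda>(a, b, G, D). (a, b, G, L o\<^sub>L D)) xs)"
  by (auto simp: elementary_adapted_def)

lemma elementary_adapted_append:
  "elementary_adapted F (xs @ ys) \<longleftrightarrow> elementary_adapted F xs \<and> elementary_adapted F ys"
  by (simp add: elementary_adapted_def ball_Un)

lemma elementary_process_bounded:
  "\<exists>c. \<forall>v. norm (elementary_process xs s \<omega> v) \<le> c * norm v"
proof (induction xs)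
  case Nil
  then show ?case by (auto simp: elementary_process_def intro!: exI[of _ 0])
next
  case (Cons x xs)
  obtain a b G D where x: "x = (a, b, G, D)" by (cases x) auto
  obtain c where c: "\<And>v. norm (elementary_process xs s \<omega> v) \<le> c * norm v" using Cons by blast
  define r :: real where "r = indicator {a<..b} s * indicator G \<omega>"
  have r: "\<bar>r\<bar> \<le> 1" by (simp add: r_def indicator_def)
  have "norm (elementary_process (x # xs) s \<omega> v) \<le> (norm D + c) * norm v" for v
  proof -
    have "elementary_process (x # xs) s \<omega> v = r *\<^sub>R blinfun_apply D v + elementary_process xs s \<omega> v"
      by (simp add: elementary_process_def x r_def)
    also have "norm \<dots> \<le> norm (r *\<^sub>R blinfun_apply D v) + norm (elementary_process xs s \<omega> v)"
      by (rule norm_triangle_ineq)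
    also have "\<dots> \<le> norm D * norm v + c * norm v"
    proof (intro add_mono c)
      have "norm (r *\<^sub>R blinfun_apply D v) \<le> 1 * (norm D * norm v)"
        unfolding norm_scaleR by (intro mult_mono r norm_blinfun) auto
      then show "norm (r *\<^sub>R blinfun_apply D v) \<le> norm D * norm v" by simp
    qed
    finally show ?thesis by (simp add: distrib_right)
  qed
  then show ?case by blast
qed

lemma sum_list_nth: "(\<Sum>x\<leftarrow>xs. f x) = (\<Sum>i<length xs. f (xs ! i))"
  by (simp add: sum_list_sum_nth atLeast0LessThan)

lemma norm_sum_sq:
  "(norm (\<Sum>p\<in>J. \<alpha> p *\<^sub>R v p :: 'a::real_inner))\<^sup>2 = (\<Sum>p\<in>J. \<Sum>q\<in>J. \<alpha> p * \<alpha> q * (v p \<bullet> v q))"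
  unfolding power2_norm_eq_inner
  by (simp add: inner_sum_left inner_sum_right sum_distrib_left mult_ac inner_commute)

lemma (in complete_measure) borel_measurable_AE_eq:
  fixes f g :: "'a \<Rightarrow> 'b::topological_space"
  assumes f: "f \<in> borel_measurable M" and eq: "AE x in M. f x = g x"
  shows "g \<in> borel_measurable M"
proof (rule measurableI)
  fix B :: "'b set" assume B: "B \<in> sets borel"
  show "g -` B \<inter> space M \<in> sets M"
  proof (rule in_sets_AE)
    show "AE x in M. (x \<in> f -` B \<inter> space M) = (x \<in> g -` B \<inter> space M)"
      using eq by eventually_elim auto
    show "f -` B \<inter> space M \<in> sets M" using f B by (rule measurable_sets)
  qed auto
qed simp

locale wiener = brownian_family M F K \<beta> for M :: "'w measure" and F K \<beta> +
  fixes lam :: "nat \<Rightarrow> real" and e :: "nat \<Rightarrow> 'v::{real_inner, banach, second_countable_topology}"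
    and W :: "real \<Rightarrow> 'w \<Rightarrow> 'v"
  assumes complete: "complete_measure M"
    and lam_nonneg: "\<And>k. k \<in> K \<Longrightarrow> 0 \<le> lam k"
    and lam_summable: "lam summable_on K"
    and norm_e: "\<And>k. k \<in> K \<Longrightarrow> norm (e k) = 1"
    and W_has_sum: "\<And>t. t \<ge> 0 \<Longrightarrow> AE \<omega> in M. ((\<lambda>k. (sqrt (lam k) * \<beta> k t \<omega>) *\<^sub>R e k) has_sum W t \<omega>) K"
begin

definition W_trunc :: "nat \<Rightarrow> real \<Rightarrow> 'w \<Rightarrow> 'v" where
  "W_trunc n t \<omega> = (\<Sum>k\<in>K \<inter> {..<n}. (sqrt (lam k) * \<beta> k t \<omega>) *\<^sub>R e k)"

lemma W_trunc_measurable [measurable]: "t \<ge> 0 \<Longrightarrow> W_trunc n t \<in> borel_measurable M"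
  unfolding W_trunc_def[abs_def]
  by (intro borel_measurable_sum borel_measurable_scaleR borel_measurable_times \<beta>_measurable) auto

lemma W_trunc_tendsto:
  assumes "t \<ge> 0"
  shows "AE \<omega> in M. (\<lambda>n. W_trunc n t \<omega>) \<longlonglongrightarrow> W t \<omega>"
proof -
  have lim: "filterlim (\<lambda>n. K \<inter> {..<n}) (finite_subsets_at_top K) sequentially"
    unfolding filterlim_finite_subsets_at_top
  proof (intro allI impI)
    fix X assume X: "finite X \<and> X \<subseteq> K"
    then obtain m where m: "X \<subseteq> {..<m}" using finite_nat_set_iff_bounded[of X] by auto
    show "\<forall>\<^sub>F n in sequentially. finite (K \<inter> {..<n}) \<and> X \<subseteq> K \<inter> {..<n} \<and> K \<inter> {..<n} \<subseteq> K"
      using eventually_ge_at_top[of m] by eventually_elim (use X m in auto)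
  qed
  show ?thesis
    using W_has_sum[OF assms]
    by eventually_elim (auto simp: has_sum_def W_trunc_def intro: filterlim_compose[OF _ lim])
qed

text \<open>The Wiener process is an almost sure limit of measurable functions; completeness of the
  probability space makes it measurable.\<close>

lemma W_measurable: "t \<ge> 0 \<Longrightarrow> W t \<in> borel_measurable M"
proof -
  assume t: "t \<ge> 0"
  interpret complete_measure M by (rule complete)
  have "(\<lambda>\<omega>. lim (\<lambda>n. W_trunc n t \<omega>)) \<in> borel_measurable M"
    using t by (intro borel_measurable_lim_metric W_trunc_measurable)
  moreover have "AE \<omega> in M. lim (\<lambda>n. W_trunc n t \<omega>) = W t \<omega>"
    using W_trunc_tendsto[OF t] by eventually_elim (rule limI)
  ultimately show ?thesis by (rule borel_measurable_AE_eq)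
qed

lemma elementary_integral_measurable:
  fixes xs :: "('w, 'v, 'h::{real_normed_vector, second_countable_topology}) elementary"
  assumes "elementary_adapted F xs" "t \<ge> 0" "\<And>s. s \<ge> 0 \<Longrightarrow> V s \<in> borel_measurable M"
  shows "elementary_integral V xs t \<in> borel_measurable M"
  using assms(1)
proof (induction xs)
  case Nil
  then show ?case by (simp add: elementary_integral_def[abs_def])
next
  case (Cons x xs)
  obtain a b G D where x: "x = (a, b, G, D)" by (cases x) auto
  have ab: "0 \<le> a" "a \<le> b" "G \<in> sets (F a)" using Cons.prems by (auto simp: elementary_adapted_def x)
  have [measurable]: "elementary_integral V xs t \<in> borel_measurable M"
    using Cons by (auto simp: elementary_adapted_def)
  have [measurable]: "G \<in> sets M" using ab sets_F by blast
  have [measurable]: "V (min b t) \<in> borel_measurable M" "V (min a t) \<in> borel_measurable M"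
    using ab assms by auto
  have [measurable]: "blinfun_apply D \<in> borel_measurable borel"
    by (intro borel_measurable_continuous_onI continuous_intros)
  have "elementary_integral V (x # xs) t = (\<lambda>\<omega>. indicator G \<omega> *\<^sub>R blinfun_apply D (V (min b t) \<omega> - V (min a t) \<omega>)
      + elementary_integral V xs t \<omega>)"
    by (simp add: elementary_integral_def fun_eq_iff x)
  then show ?case by simp
qed

abbreviation time_prob :: "real \<Rightarrow> (real \<times> 'w) measure" where
  "time_prob t \<equiv> restrict_space lborel {0..t} \<Otimes>\<^sub>M M"

lemma emeasure_time_prob:
  assumes [measurable]: "S \<in> sets borel" "G \<in> sets M" and "S \<subseteq> {0..t}"
  shows "S \<times> G \<in> sets (time_prob t)" "emeasure (time_prob t) (S \<times> G) = emeasure lborel S * emeasure M G"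
proof -
  have S: "S \<in> sets (restrict_space lborel {0..t})"
    using assms by (auto simp: sets_restrict_space_iff)
  then show "S \<times> G \<in> sets (time_prob t)" by simp
  show "emeasure (time_prob t) (S \<times> G) = emeasure lborel S * emeasure M G"
    using S assms by (simp add: emeasure_pair_measure_Times emeasure_restrict_space)
qed

lemma elementary_process_measurable:
  fixes xs :: "('w, 'v, 'h::{real_normed_vector, second_countable_topology}) elementary"
  assumes "elementary_adapted F xs"
  shows "(\<lambda>(s, \<omega>). elementary_process xs s \<omega> v) \<in> borel_measurable (time_prob t)"
  using assms
proof (induction xs)
  case Nil
  then show ?case by (simp add: elementary_process_def)
next
  case (Cons x xs)
  obtain a b G D where x: "x = (a, b, G, D)" by (cases x) auto
  have ab: "0 \<le> a" "a \<le> b" "G \<in> sets (F a)" using Cons.prems by (auto simp: elementary_adapted_def x)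
  have [measurable]: "(\<lambda>p. elementary_process xs (fst p) (snd p) v) \<in> borel_measurable (time_prob t)"
    using Cons by (auto simp: elementary_adapted_def split_beta')
  have [measurable]: "G \<in> sets M" using ab sets_F by blast
  have [measurable]: "{a<..b} \<inter> {0..t} \<in> sets (restrict_space lborel {0..t})"
    by (auto simp: sets_restrict_space_iff)
  have "(\<lambda>s. indicator {a<..b} s :: real) \<in> borel_measurable (restrict_space lborel {0..t})"
    by (intro measurable_restrict_space1) measurable
  then have [measurable]: "(\<lambda>p. indicator {a<..b} (fst p) :: real) \<in> borel_measurable (time_prob t)"
    by measurable
  have "(\<lambda>(s, \<omega>). elementary_process (x # xs) s \<omega> v) = (\<lambda>p. (indicator {a<..b} (fst p) * indicator G (snd p)) *\<^sub>R blinfun_apply D v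
      + elementary_process xs (fst p) (snd p) v)"
    by (simp add: elementary_process_def fun_eq_iff x)
  then show ?case by simp
qed

text \<open>Both sides are expanded into double sums over the entries of the list.  An entry \<open>i\<close> and a
  Brownian motion \<open>k\<close> contribute the vector \<open>D i (e k)\<close>; on the left its coefficient is a Brownian
  increment restricted to \<open>G i\<close>, on the right the indicator of \<open>S i \<times> G i\<close>.  The covariances of the
  former are the integrals of products of the latter.\<close>

lemma elementary_isometry_trunc:
  fixes xs :: "('w, 'v, 'h::{real_inner, second_countable_topology}) elementary"
  assumes ad: "elementary_adapted F xs" and t: "0 \<le> t"
  shows "(\<integral>\<^sup>+\<omega>. nsq (elementary_integral (W_trunc n) xs t \<omega>) \<partial>M)
    = (\<integral>\<^sup>+(s, \<omega>). ennreal (\<Sum>k\<in>K \<inter> {..<n}. (norm (sqrt (lam k) *\<^sub>R elementary_process xs s \<omega> (e k)))\<^sup>2) \<partial>time_prob t)"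
proof -
  define I where "I = {..<length xs}"
  define Kn where "Kn = K \<inter> {..<n}"
  define a b G D where "a i = fst (xs ! i)" and "b i = fst (snd (xs ! i))" and "G i = fst (snd (snd (xs ! i)))"
    and "D i = snd (snd (snd (xs ! i)))" for i
  have xs_nth: "xs ! i = (a i, b i, G i, D i)" for i
    by (simp add: a_def b_def G_def D_def)
  \<comment> \<open>Stopping at \<open>t\<close> shortens \<open>(a i, b i]\<close> to \<open>(a i, b' i]\<close>. The left end stays at \<open>a i\<close> even if
    \<open>a i > t\<close>, as \<open>G i\<close> is known at time \<open>a i\<close> but not earlier; the interval is then empty.\<close>
  define b' where "b' i = max (a i) (min (b i) t)" for i
  define S where "S i = {a i<..b' i}" for i
  have ab: "0 \<le> a i" "a i \<le> b i" "G i \<in> sets (F (a i))" if "i \<in> I" for i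
  proof -
    have "xs ! i \<in> set xs" using that by (simp add: I_def)
    then show "0 \<le> a i" "a i \<le> b i" "G i \<in> sets (F (a i))"
      using ad by (auto simp: elementary_adapted_def xs_nth dest!: bspec)
  qed
  have G [measurable]: "G i \<in> sets M" if "i \<in> I" for i using ab[OF that] sets_F by blast
  have b': "a i \<le> b' i" for i by (simp add: b'_def)
  have fin: "finite I" "finite Kn" by (auto simp: I_def Kn_def)
  have KnK: "k \<in> K" if "k \<in> Kn" for k using that by (simp add: Kn_def)
  define v where "v = (\<lambda>(i, k). blinfun_apply (D i) (e k))"
  define \<alpha> where "\<alpha> \<omega> = (\<lambda>(i, k). sqrt (lam k) * (indicator (G i) \<omega> * incr k (a i) (b' i) \<omega>))" for \<omega>
  define c where "c i j = prob (G i \<inter> G j) * measure lborel (S i \<inter> S j)" for i j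

  have integral_eq: "elementary_integral (W_trunc n) xs t \<omega> = (\<Sum>p\<in>I \<times> Kn. \<alpha> \<omega> p *\<^sub>R v p)" for \<omega>
  proof -
    have "elementary_integral (W_trunc n) xs t \<omega>
        = (\<Sum>i\<in>I. indicator (G i) \<omega> *\<^sub>R blinfun_apply (D i) (W_trunc n (min (b i) t) \<omega> - W_trunc n (min (a i) t) \<omega>))"
      unfolding elementary_integral_def sum_list_nth I_def by (simp add: xs_nth)
    also have "\<dots> = (\<Sum>i\<in>I. \<Sum>k\<in>Kn. \<alpha> \<omega> (i, k) *\<^sub>R v (i, k))"
    proof (intro sum.cong refl)
      fix i assume i: "i \<in> I"
      have "W_trunc n (min (b i) t) \<omega> - W_trunc n (min (a i) t) \<omega> = (\<Sum>k\<in>Kn. (sqrt (lam k) * incr k (a i) (b' i) \<omega>) *\<^sub>R e k)"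
        unfolding W_trunc_def Kn_def[symmetric] sum_subtractf[symmetric]
        using ab[OF i] by (intro sum.cong refl) (auto simp: incr_def b'_def min_def max_def algebra_simps)
      then show "indicator (G i) \<omega> *\<^sub>R blinfun_apply (D i) (W_trunc n (min (b i) t) \<omega> - W_trunc n (min (a i) t) \<omega>)
          = (\<Sum>k\<in>Kn. \<alpha> \<omega> (i, k) *\<^sub>R v (i, k))"
        by (simp add: blinfun.sum_right blinfun.scaleR_right scaleR_sum_right \<alpha>_def v_def mult_ac)
    qed
    finally show ?thesis by (simp add: sum.cartesian_product case_prod_unfold)
  qed

  have \<alpha>_int: "integrable M (\<lambda>\<omega>. \<alpha> \<omega> p * \<alpha> \<omega> q)"
    and \<alpha>_exp: "expectation (\<lambda>\<omega>. \<alpha> \<omega> p * \<alpha> \<omega> q) = (if snd p = snd q then lam (snd p) * c (fst p) (fst q) else 0)"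
    if "p \<in> I \<times> Kn" "q \<in> I \<times> Kn" for p q
  proof -
    obtain i k j l where pq: "p = (i, k)" "q = (j, l)" by (metis surj_pair)
    then have mem: "i \<in> I" "j \<in> I" "k \<in> K" "l \<in> K" using that KnK by auto
    have eq: "\<alpha> \<omega> p * \<alpha> \<omega> q = (sqrt (lam k) * sqrt (lam l)) *
        ((indicator (G i) \<omega> * incr k (a i) (b' i) \<omega>) * (indicator (G j) \<omega> * incr l (a j) (b' j) \<omega>))" for \<omega>
      by (simp add: \<alpha>_def pq mult_ac)
    have "integrable M (\<lambda>\<omega>. indicator (G i \<inter> G j) \<omega> * (incr k (a i) (b' i) \<omega> * incr l (a j) (b' j) \<omega>))"
      using mem ab b' G by (intro integrable_indicator_incr_incr) auto
    then have "integrable M (\<lambda>\<omega>. (indicator (G i) \<omega> * incr k (a i) (b' i) \<omega>) * (indicator (G j) \<omega> * incr l (a j) (b' j) \<omega>))"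
      by (simp add: indicator_inter_arith mult_ac)
    then show "integrable M (\<lambda>\<omega>. \<alpha> \<omega> p * \<alpha> \<omega> q)"
      unfolding eq by (rule integrable_mult_right)
    have "expectation (\<lambda>\<omega>. \<alpha> \<omega> p * \<alpha> \<omega> q) = (sqrt (lam k) * sqrt (lam l)) * (if k = l then c i j else 0)"
      unfolding eq integral_mult_right_zero c_def S_def
      using mem ab b' by (subst incr_covariance) auto
    then show "expectation (\<lambda>\<omega>. \<alpha> \<omega> p * \<alpha> \<omega> q) = (if snd p = snd q then lam (snd p) * c (fst p) (fst q) else 0)"
      using lam_nonneg mem by (simp add: pq)
  qed
  have lhs: "(\<integral>\<^sup>+\<omega>. nsq (elementary_integral (W_trunc n) xs t \<omega>) \<partial>M)
      = ennreal (\<Sum>p\<in>I \<times> Kn. \<Sum>q\<in>I \<times> Kn. (if snd p = snd q then lam (snd p) * c (fst p) (fst q) else 0) * (v p \<bullet> v q))"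
  proof -
    have "integrable M (\<lambda>\<omega>. (norm (elementary_integral (W_trunc n) xs t \<omega>))\<^sup>2)"
      unfolding integral_eq norm_sum_sq using \<alpha>_int
      by (intro Bochner_Integration.integrable_sum integrable_mult_left) auto
    moreover have "expectation (\<lambda>\<omega>. (norm (elementary_integral (W_trunc n) xs t \<omega>))\<^sup>2)
      = (\<Sum>p\<in>I \<times> Kn. \<Sum>q\<in>I \<times> Kn. (if snd p = snd q then lam (snd p) * c (fst p) (fst q) else 0) * (v p \<bullet> v q))"
      unfolding integral_eq norm_sum_sq
      using \<alpha>_int by (simp add: \<alpha>_exp Bochner_Integration.integral_sum cong: sum.cong)
    ultimately show ?thesis by (subst nn_integral_eq_integral) auto
  qed

  define \<gamma> where "\<gamma> z i = (indicator (S i) (fst z) * indicator (G i) (snd z) :: real)" for z i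
  have S_sub: "S i \<subseteq> {0..t}" if "i \<in> I" for i
    using ab[OF that] by (auto simp: S_def b'_def)
  have \<gamma>_int: "integrable (time_prob t) (\<lambda>z. \<gamma> z i * \<gamma> z j)"
    and \<gamma>_exp: "(\<integral>z. \<gamma> z i * \<gamma> z j \<partial>time_prob t) = c i j" if "i \<in> I" "j \<in> I" for i j
  proof -
    let ?R = "(S i \<inter> S j) \<times> (G i \<inter> G j)"
    have eq: "(\<lambda>z. \<gamma> z i * \<gamma> z j) = indicator ?R"
      by (auto simp: \<gamma>_def indicator_def fun_eq_iff)
    have [measurable]: "S i \<in> sets borel" for i by (simp add: S_def)
    have [measurable]: "G i \<in> sets M" "G j \<in> sets M" using that G by auto
    have R: "?R \<in> sets (time_prob t)" "emeasure (time_prob t) ?R = emeasure lborel (S i \<inter> S j) * emeasure M (G i \<inter> G j)"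
      using S_sub[OF that(1)] by (intro emeasure_time_prob; auto)+
    have fin: "emeasure lborel (S i \<inter> S j) < \<infinity>"
      by (rule order_le_less_trans[OF emeasure_mono[of _ "S i"]]) (auto simp: S_def b')
    then have "emeasure (time_prob t) ?R < \<infinity>"
      unfolding R by (simp add: ennreal_mult_less_top emeasure_eq_measure)
    then show "integrable (time_prob t) (\<lambda>z. \<gamma> z i * \<gamma> z j)"
      unfolding eq using R(1) by (intro integrable_real_indicator) auto
    have "measure (time_prob t) ?R = c i j"
      unfolding measure_def R c_def by (simp add: enn2real_mult mult.commute)
    then show "(\<integral>z. \<gamma> z i * \<gamma> z j \<partial>time_prob t) = c i j"
      unfolding eq using R(1) by (simp add: sets.Int_space_eq2)
  qed
  have process_eq: "sqrt (lam k) *\<^sub>R elementary_process xs (fst z) (snd z) (e k)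
      = (\<Sum>i\<in>I. \<gamma> z i *\<^sub>R (sqrt (lam k) *\<^sub>R v (i, k)))" if "z \<in> space (time_prob t)" for z k
  proof -
    have z: "fst z \<in> {0..t}" using that by (auto simp: space_pair_measure)
    have "elementary_process xs (fst z) (snd z) (e k) = (\<Sum>i\<in>I. \<gamma> z i *\<^sub>R v (i, k))"
      unfolding elementary_process_def sum_list_nth I_def[symmetric]
    proof (intro sum.cong refl)
      fix i assume "i \<in> I"
      have "indicator {a i<..b i} (fst z) = (indicator (S i) (fst z) :: real)"
        using z by (auto simp: S_def b'_def indicator_def)
      then show "(case xs ! i of (a, b, G, D) \<Rightarrow> (indicator {a<..b} (fst z) * indicator G (snd z)) *\<^sub>R blinfun_apply D (e k)) = \<gamma> z i *\<^sub>R v (i, k)"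
        by (simp add: xs_nth \<gamma>_def v_def)
    qed
    then show ?thesis by (simp add: scaleR_sum_right mult.commute)
  qed
  have rhs: "(\<integral>\<^sup>+(s, \<omega>). ennreal (\<Sum>k\<in>Kn. (norm (sqrt (lam k) *\<^sub>R elementary_process xs s \<omega> (e k)))\<^sup>2) \<partial>time_prob t)
      = ennreal (\<Sum>k\<in>Kn. \<Sum>i\<in>I. \<Sum>j\<in>I. c i j * (lam k * (v (i, k) \<bullet> v (j, k))))"
  proof -
    let ?g = "\<lambda>z. \<Sum>k\<in>Kn. \<Sum>i\<in>I. \<Sum>j\<in>I. \<gamma> z i * \<gamma> z j * (lam k * (v (i, k) \<bullet> v (j, k)))"
    have sq: "(\<Sum>k\<in>Kn. (norm (\<Sum>i\<in>I. \<gamma> z i *\<^sub>R (sqrt (lam k) *\<^sub>R v (i, k))))\<^sup>2) = ?g z" for z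
      unfolding norm_sum_sq using lam_nonneg KnK
      by (intro sum.cong refl) (simp flip: mult.assoc)
    have int: "integrable (time_prob t) ?g"
      using \<gamma>_int by (intro Bochner_Integration.integrable_sum integrable_mult_left) auto
    have "(\<integral>\<^sup>+(s, \<omega>). ennreal (\<Sum>k\<in>Kn. (norm (sqrt (lam k) *\<^sub>R elementary_process xs s \<omega> (e k)))\<^sup>2) \<partial>time_prob t)
        = (\<integral>\<^sup>+z. ennreal (?g z) \<partial>time_prob t)"
      unfolding sq[symmetric] by (intro nn_integral_cong) (simp only: split_beta process_eq)
    also have "\<dots> = ennreal (\<integral>z. ?g z \<partial>time_prob t)"
      using int by (rule nn_integral_eq_integral) (auto simp: sq[symmetric] intro!: sum_nonneg AE_I2)
    also have "(\<integral>z. ?g z \<partial>time_prob t) = (\<Sum>k\<in>Kn. \<Sum>i\<in>I. \<Sum>j\<in>I. c i j * (lam k * (v (i, k) \<bullet> v (j, k))))"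
      using \<gamma>_int by (simp add: \<gamma>_exp Bochner_Integration.integral_sum cong: sum.cong)
    finally show ?thesis .
  qed
  have "(\<Sum>p\<in>I \<times> Kn. \<Sum>q\<in>I \<times> Kn. (if snd p = snd q then lam (snd p) * c (fst p) (fst q) else 0) * (v p \<bullet> v q))
      = (\<Sum>i\<in>I. \<Sum>k\<in>Kn. \<Sum>j\<in>I. \<Sum>l\<in>Kn. (if k = l then lam k * c i j else 0) * (v (i, k) \<bullet> v (j, l)))"
    by (simp add: sum.cartesian_product' cong del: if_weak_cong)
  also have "\<dots> = (\<Sum>i\<in>I. \<Sum>k\<in>Kn. \<Sum>j\<in>I. c i j * (lam k * (v (i, k) \<bullet> v (j, k))))"
  proof (intro sum.cong refl)
    fix i k j assume "k \<in> Kn"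
    have "(\<Sum>l\<in>Kn. (if k = l then lam k * c i j else 0) * (v (i, k) \<bullet> v (j, l)))
        = (\<Sum>l\<in>Kn. if k = l then c i j * (lam k * (v (i, k) \<bullet> v (j, l))) else 0)"
      by (intro sum.cong refl) simp
    then show "(\<Sum>l\<in>Kn. (if k = l then lam k * c i j else 0) * (v (i, k) \<bullet> v (j, l))) = c i j * (lam k * (v (i, k) \<bullet> v (j, k)))"
      using fin \<open>k \<in> Kn\<close> by simp
  qed
  also have "\<dots> = (\<Sum>k\<in>Kn. \<Sum>i\<in>I. \<Sum>j\<in>I. c i j * (lam k * (v (i, k) \<bullet> v (j, k))))"
    by (rule sum.swap)
  finally show ?thesis
    unfolding lhs rhs[unfolded Kn_def] Kn_def by simp
qed

text \<open>The full Wiener process is reached from its truncations by Fatou's lemma.  This turns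
  the equality into an upper bound.\<close>

lemma elementary_integral_second_moment:
  fixes xs :: "('w, 'v, 'h::{real_inner, second_countable_topology}) elementary"
  assumes ad: "elementary_adapted F xs" and t: "0 \<le> t"
  shows "(\<integral>\<^sup>+\<omega>. nsq (elementary_integral W xs t \<omega>) \<partial>M)
    \<le> (\<integral>\<^sup>+(s, \<omega>). hs2 K lam e (elementary_process xs s \<omega>) \<partial>time_prob t)"
proof -
  have conv: "AE \<omega> in M. (\<lambda>n. elementary_integral (W_trunc n) xs t \<omega>) \<longlonglongrightarrow> elementary_integral W xs t \<omega>"
    using ad
  proof (induction xs)
    case Nil
    then show ?case by (simp add: elementary_integral_def)
  next
    case (Cons x xs)
    obtain a b G D where x: "x = (a, b, G, D)" by (cases x) auto
    have ab: "0 \<le> a" "a \<le> b" using Cons.prems by (auto simp: elementary_adapted_def x)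
    have "AE \<omega> in M. (\<lambda>n. elementary_integral (W_trunc n) xs t \<omega>) \<longlonglongrightarrow> elementary_integral W xs t \<omega>"
      using Cons by (auto simp: elementary_adapted_def)
    moreover have "AE \<omega> in M. (\<lambda>n. W_trunc n (min b t) \<omega>) \<longlonglongrightarrow> W (min b t) \<omega>"
      "AE \<omega> in M. (\<lambda>n. W_trunc n (min a t) \<omega>) \<longlonglongrightarrow> W (min a t) \<omega>"
      using ab t by (auto intro!: W_trunc_tendsto)
    ultimately show ?case
    proof eventually_elim
      case (elim \<omega>)
      have "(\<lambda>n. (indicator G \<omega> :: real) *\<^sub>R blinfun_apply D (W_trunc n (min b t) \<omega> - W_trunc n (min a t) \<omega>)
          + elementary_integral (W_trunc n) xs t \<omega>)
        \<longlonglongrightarrow> (indicator G \<omega> :: real) *\<^sub>R blinfun_apply D (W (min b t) \<omega> - W (min a t) \<omega>) + elementary_integral W xs t \<omega>"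
        by (intro tendsto_intros elim)
      then show ?case by (simp add: elementary_integral_def x)
    qed
  qed
  have "(\<integral>\<^sup>+\<omega>. nsq (elementary_integral W xs t \<omega>) \<partial>M)
      = (\<integral>\<^sup>+\<omega>. liminf (\<lambda>n. nsq (elementary_integral (W_trunc n) xs t \<omega>)) \<partial>M)"
  proof (intro nn_integral_cong_AE)
    show "AE \<omega> in M. nsq (elementary_integral W xs t \<omega>)
        = liminf (\<lambda>n. nsq (elementary_integral (W_trunc n) xs t \<omega>))"
      using conv
    proof eventually_elim
      case (elim \<omega>)
      then have "(\<lambda>n. nsq (elementary_integral (W_trunc n) xs t \<omega>)) \<longlonglongrightarrow> nsq (elementary_integral W xs t \<omega>)"
        by (intro tendsto_ennrealI tendsto_intros)
      then show ?case by (intro lim_imp_Liminf[symmetric]) auto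
    qed
  qed
  also have "\<dots> \<le> liminf (\<lambda>n. \<integral>\<^sup>+\<omega>. nsq (elementary_integral (W_trunc n) xs t \<omega>) \<partial>M)"
  proof (rule nn_integral_liminf)
    fix n
    have [measurable]: "elementary_integral (W_trunc n) xs t \<in> borel_measurable M"
      by (intro elementary_integral_measurable ad t W_trunc_measurable)
    show "(\<lambda>\<omega>. nsq (elementary_integral (W_trunc n) xs t \<omega>)) \<in> borel_measurable M"
      by measurable
  qed
  also have "\<dots> \<le> (\<integral>\<^sup>+(s, \<omega>). hs2 K lam e (elementary_process xs s \<omega>) \<partial>time_prob t)"
  proof (rule Liminf_le)
    show "\<forall>\<^sub>F n in sequentially. (\<integral>\<^sup>+\<omega>. nsq (elementary_integral (W_trunc n) xs t \<omega>) \<partial>M)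
        \<le> (\<integral>\<^sup>+(s, \<omega>). hs2 K lam e (elementary_process xs s \<omega>) \<partial>time_prob t)"
    proof (intro always_eventually allI)
      fix n
      have "ennreal (\<Sum>k\<in>K \<inter> {..<n}. (norm (sqrt (lam k) *\<^sub>R elementary_process xs s \<omega> (e k)))\<^sup>2)
          \<le> hs2 K lam e (elementary_process xs s \<omega>)" for s \<omega>
      proof -
        have "ennreal (\<Sum>k\<in>K \<inter> {..<n}. (norm (sqrt (lam k) *\<^sub>R elementary_process xs s \<omega> (e k)))\<^sup>2)
            = (\<Sum>k<n. if k \<in> K then nsq (sqrt (lam k) *\<^sub>R elementary_process xs s \<omega> (e k)) else 0)"
          by (simp add: sum.If_cases Int_commute sum_ennreal del: norm_scaleR)
        also have "\<dots> \<le> hs2 K lam e (elementary_process xs s \<omega>)"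
          unfolding hs2_def by (intro sum_le_suminf) auto
        finally show ?thesis .
      qed
      then show "(\<integral>\<^sup>+\<omega>. nsq (elementary_integral (W_trunc n) xs t \<omega>) \<partial>M)
        \<le> (\<integral>\<^sup>+(s, \<omega>). hs2 K lam e (elementary_process xs s \<omega>) \<partial>time_prob t)"
        unfolding elementary_isometry_trunc[OF ad t]
        by (intro nn_integral_mono) auto
    qed
  qed simp
  finally show ?thesis .
qed

section \<open>Stochastic integrals\<close>

lemma summable_elementary_process:
  "(\<lambda>k. (norm (sqrt (lam k) *\<^sub>R elementary_process xs s \<omega> (e k)))\<^sup>2) summable_on K"
proof -
  obtain c where c: "\<And>v. norm (elementary_process xs s \<omega> v) \<le> c * norm v"
    using elementary_process_bounded[of xs s \<omega>] by blast
  show ?thesis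
  proof (rule summable_on_comparison_test)
    show "(\<lambda>k. lam k * c\<^sup>2) summable_on K" using lam_summable by (rule summable_on_cmult_left)
    fix k assume k: "k \<in> K"
    have "(norm (elementary_process xs s \<omega> (e k)))\<^sup>2 \<le> c\<^sup>2"
      using c[of "e k"] norm_e[OF k] by (intro power_mono) auto
    then show "(norm (sqrt (lam k) *\<^sub>R elementary_process xs s \<omega> (e k)))\<^sup>2 \<le> lam k * c\<^sup>2"
      using lam_nonneg[OF k] by (simp add: power_mult_distrib mult_left_mono)
  qed simp
qed

lemma summable_norm_sq_diff:
  assumes "(\<lambda>k. (norm (sqrt (lam k) *\<^sub>R D (e k)))\<^sup>2) summable_on K"
    and "(\<lambda>k. (norm (sqrt (lam k) *\<^sub>R E (e k) :: 'h::real_normed_vector))\<^sup>2) summable_on K"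
  shows "(\<lambda>k. (norm (sqrt (lam k) *\<^sub>R (D (e k) - E (e k))))\<^sup>2) summable_on K"
proof (rule summable_on_comparison_test)
  show "(\<lambda>k. 2 * (norm (sqrt (lam k) *\<^sub>R D (e k)))\<^sup>2 + 2 * (norm (sqrt (lam k) *\<^sub>R E (e k)))\<^sup>2) summable_on K"
    by (intro summable_on_add summable_on_cmult_right assms)
  show "(norm (sqrt (lam k) *\<^sub>R (D (e k) - E (e k))))\<^sup>2
      \<le> 2 * (norm (sqrt (lam k) *\<^sub>R D (e k)))\<^sup>2 + 2 * (norm (sqrt (lam k) *\<^sub>R E (e k)))\<^sup>2" for k
    using norm_add_sq_le[of "sqrt (lam k) *\<^sub>R D (e k)" "- (sqrt (lam k) *\<^sub>R E (e k))"]
    unfolding scaleR_diff_right by simp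
qed simp

lemma stochastic_integral_approximation:
  assumes "has_stochastic_integral M F K lam e W \<Phi> t I"
  obtains xs where "\<And>n. elementary_adapted F (xs n)"
    and "(\<lambda>n. \<integral>\<^sup>+(s, \<omega>). hs2 K lam e (\<lambda>v. elementary_process (xs n) s \<omega> v - \<Phi> s \<omega> v) \<partial>time_prob t) \<longlonglongrightarrow> 0"
    and "(\<lambda>n. \<integral>\<^sup>+\<omega>. nsq (elementary_integral W (xs n) t \<omega> - I \<omega>) \<partial>M) \<longlonglongrightarrow> 0"
proof -
  have \<Phi>: "\<Phi> s \<omega> \<in> hs_operators K lam e" if "s \<in> {0..t}" "\<omega> \<in> space M" for s \<omega>
    using assms that by (auto simp: has_stochastic_integral_def)
  obtain xs where xs: "\<And>n. elementary_adapted F (xs n)"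
    "(\<lambda>n. \<integral>\<^sup>+(s, \<omega>). ennreal ((hs_norm K lam e (\<lambda>v. elementary_process (xs n) s \<omega> v - \<Phi> s \<omega> v))\<^sup>2) \<partial>time_prob t) \<longlonglongrightarrow> 0"
    "(\<lambda>n. \<integral>\<^sup>+\<omega>. nsq (elementary_integral W (xs n) t \<omega> - I \<omega>) \<partial>M) \<longlonglongrightarrow> 0"
    using assms unfolding has_stochastic_integral_def by blast
  have "(\<integral>\<^sup>+(s, \<omega>). ennreal ((hs_norm K lam e (\<lambda>v. elementary_process (xs n) s \<omega> v - \<Phi> s \<omega> v))\<^sup>2) \<partial>time_prob t)
      = (\<integral>\<^sup>+(s, \<omega>). hs2 K lam e (\<lambda>v. elementary_process (xs n) s \<omega> v - \<Phi> s \<omega> v) \<partial>time_prob t)" for n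
  proof (intro nn_integral_cong)
    fix z assume z: "z \<in> space (time_prob t)"
    obtain s \<omega> where s: "z = (s, \<omega>)" by force
    have "(\<lambda>k. (norm (sqrt (lam k) *\<^sub>R \<Phi> s \<omega> (e k)))\<^sup>2) summable_on K"
      using \<Phi>[of s \<omega>] z by (auto simp: s space_pair_measure hs_operators_def)
    then show "(case z of (s, \<omega>) \<Rightarrow> ennreal ((hs_norm K lam e (\<lambda>v. elementary_process (xs n) s \<omega> v - \<Phi> s \<omega> v))\<^sup>2))
        = (case z of (s, \<omega>) \<Rightarrow> hs2 K lam e (\<lambda>v. elementary_process (xs n) s \<omega> v - \<Phi> s \<omega> v))"
      unfolding s by (simp add: hs2_eq_hs_norm summable_norm_sq_diff summable_elementary_process del: norm_scaleR)
  qed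
  then have "(\<lambda>n. \<integral>\<^sup>+(s, \<omega>). hs2 K lam e (\<lambda>v. elementary_process (xs n) s \<omega> v - \<Phi> s \<omega> v) \<partial>time_prob t) \<longlonglongrightarrow> 0"
    using xs(2) by simp
  with xs(1) show thesis using xs(3) by (rule that)
qed

text \<open>The bound for elementary processes is applied to \<open>L\<close> composed with the difference of
  approximations of \<open>\<Phi>\<close> and \<open>\<Psi>\<close>.  The inequality \<open>|a + b|\<^sup>2 \<le> 2|a|\<^sup>2 + 2|b|\<^sup>2\<close> is used once to pass from the
  integrals to their approximations and once to return from the approximating processes; the
  errors tend to 0 and the factor 4 remains.\<close>

lemma stochastic_integral_diff_bound:
  fixes \<Phi> \<Psi> :: "real \<Rightarrow> 'w \<Rightarrow> 'v \<Rightarrow> 'h::{real_inner, banach, second_countable_topology}"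
    and L :: "'h \<Rightarrow>\<^sub>L 'g::{real_inner, banach, second_countable_topology}"
  assumes \<Phi>: "has_stochastic_integral M F K lam e W \<Phi> t I"
    and \<Psi>: "has_stochastic_integral M F K lam e W \<Psi> t J" and t: "0 \<le> t"
  shows "(\<integral>\<^sup>+\<omega>. nsq (L (I \<omega> - J \<omega>)) \<partial>M)
    \<le> 4 * (\<integral>\<^sup>+(s, \<omega>). hs2 K lam e (\<lambda>v. L (\<Phi> s \<omega> v - \<Psi> s \<omega> v)) \<partial>time_prob t)"
proof -
  obtain xs where xs: "\<And>n. elementary_adapted F (xs n)"
    "(\<lambda>n. \<integral>\<^sup>+(s, \<omega>). hs2 K lam e (\<lambda>v. elementary_process (xs n) s \<omega> v - \<Phi> s \<omega> v) \<partial>time_prob t) \<longlonglongrightarrow> 0"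
    "(\<lambda>n. \<integral>\<^sup>+\<omega>. nsq (elementary_integral W (xs n) t \<omega> - I \<omega>) \<partial>M) \<longlonglongrightarrow> 0"
    using stochastic_integral_approximation[OF \<Phi>] by blast
  obtain ys where ys: "\<And>n. elementary_adapted F (ys n)"
    "(\<lambda>n. \<integral>\<^sup>+(s, \<omega>). hs2 K lam e (\<lambda>v. elementary_process (ys n) s \<omega> v - \<Psi> s \<omega> v) \<partial>time_prob t) \<longlonglongrightarrow> 0"
    "(\<lambda>n. \<integral>\<^sup>+\<omega>. nsq (elementary_integral W (ys n) t \<omega> - J \<omega>) \<partial>M) \<longlonglongrightarrow> 0"
    using stochastic_integral_approximation[OF \<Psi>] by blast
  have [measurable]: "I \<in> borel_measurable M" "J \<in> borel_measurable M"
    using \<Phi> \<Psi> by (auto simp: has_stochastic_integral_def)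
  have [measurable]: "(\<lambda>z. sqrt (lam k) *\<^sub>R \<Phi> (fst z) (snd z) (e k)) \<in> borel_measurable (time_prob t)"
    "(\<lambda>z. sqrt (lam k) *\<^sub>R \<Psi> (fst z) (snd z) (e k)) \<in> borel_measurable (time_prob t)" if "k \<in> K" for k
    using \<Phi> \<Psi> that by (auto simp: has_stochastic_integral_def split_beta')
  have L_meas [measurable]: "blinfun_apply L \<in> borel_measurable borel"
    by (intro borel_measurable_continuous_onI continuous_intros)
  let ?l = "nsq L"
  let ?R = "\<integral>\<^sup>+z. hs2 K lam e (\<lambda>v. L (\<Phi> (fst z) (snd z) v - \<Psi> (fst z) (snd z) v)) \<partial>time_prob t"
  define p q where "p n = (\<integral>\<^sup>+z. hs2 K lam e (\<lambda>v. elementary_process (xs n) (fst z) (snd z) v - \<Phi> (fst z) (snd z) v) \<partial>time_prob t)"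
    and "q n = (\<integral>\<^sup>+z. hs2 K lam e (\<lambda>v. elementary_process (ys n) (fst z) (snd z) v - \<Psi> (fst z) (snd z) v) \<partial>time_prob t)" for n
  define p' q' where "p' n = (\<integral>\<^sup>+\<omega>. nsq (elementary_integral W (xs n) t \<omega> - I \<omega>) \<partial>M)"
    and "q' n = (\<integral>\<^sup>+\<omega>. nsq (elementary_integral W (ys n) t \<omega> - J \<omega>) \<partial>M)" for n
  have lim: "p \<longlonglongrightarrow> 0" "q \<longlonglongrightarrow> 0" "p' \<longlonglongrightarrow> 0" "q' \<longlonglongrightarrow> 0"
    using xs ys by (simp_all add: p_def[abs_def] q_def[abs_def] p'_def[abs_def] q'_def[abs_def] split_beta')
  have bound: "(\<integral>\<^sup>+\<omega>. nsq (L (I \<omega> - J \<omega>)) \<partial>M)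
      \<le> 4 * ?R + 8 * ?l * (p n + q n) + 4 * ?l * (p' n + q' n)" for n
  proof -
    define zs where "zs = map (\<lambda>(a, b, G, D). (a, b, G, L o\<^sub>L D)) (xs n) @ map (\<lambda>(a, b, G, D). (a, b, G, (- L) o\<^sub>L D)) (ys n)"
    have zs: "elementary_adapted F zs"
      unfolding zs_def elementary_adapted_append using xs(1) ys(1) by (simp add: elementary_adapted_compose)
    have zs_process: "elementary_process zs s \<omega> v = L (elementary_process (xs n) s \<omega> v - elementary_process (ys n) s \<omega> v)" for s \<omega> v
      unfolding zs_def elementary_process_append elementary_process_compose
      by (simp add: blinfun.diff_right blinfun.minus_left)
    have zs_integral: "elementary_integral W zs t \<omega> = L (elementary_integral W (xs n) t \<omega> - elementary_integral W (ys n) t \<omega>)" for \<omega>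
      unfolding zs_def elementary_integral_append elementary_integral_compose
      by (simp add: blinfun.diff_right blinfun.minus_left)
    let ?X = "elementary_process (xs n)" and ?Y = "elementary_process (ys n)"
    let ?U = "elementary_integral W (xs n) t" and ?V = "elementary_integral W (ys n) t"
    have [measurable]: "(\<lambda>z. ?X (fst z) (snd z) v) \<in> borel_measurable (time_prob t)"
      "(\<lambda>z. ?Y (fst z) (snd z) v) \<in> borel_measurable (time_prob t)" for v
      using elementary_process_measurable[OF xs(1)] elementary_process_measurable[OF ys(1)] by (simp_all add: split_beta')
    have [measurable]: "?U \<in> borel_measurable M" "?V \<in> borel_measurable M"
      by (intro elementary_integral_measurable xs ys t W_measurable; assumption)+
    have m1 [measurable]: "(\<lambda>z. hs2 K lam e (\<lambda>v. L (\<Phi> (fst z) (snd z) v - \<Psi> (fst z) (snd z) v))) \<in> borel_measurable (time_prob t)"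
      by (rule hs2_measurable) (simp add: scaleR_diff_right flip: blinfun.scaleR_right)
    have m2 [measurable]: "(\<lambda>z. hs2 K lam e (\<lambda>v. ?X (fst z) (snd z) v - \<Phi> (fst z) (snd z) v)) \<in> borel_measurable (time_prob t)"
      by (rule hs2_measurable) (simp add: scaleR_diff_right)
    have m3 [measurable]: "(\<lambda>z. hs2 K lam e (\<lambda>v. ?Y (fst z) (snd z) v - \<Psi> (fst z) (snd z) v)) \<in> borel_measurable (time_prob t)"
      by (rule hs2_measurable) (simp add: scaleR_diff_right)
    have "(\<integral>\<^sup>+\<omega>. nsq (elementary_integral W zs t \<omega>) \<partial>M)
        \<le> (\<integral>\<^sup>+z. hs2 K lam e (elementary_process zs (fst z) (snd z)) \<partial>time_prob t)"
      using elementary_integral_second_moment[OF zs t] by (simp add: split_beta')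
    also have "\<dots> \<le> (\<integral>\<^sup>+z. 2 * hs2 K lam e (\<lambda>v. L (\<Phi> (fst z) (snd z) v - \<Psi> (fst z) (snd z) v))
        + 4 * ?l * (hs2 K lam e (\<lambda>v. ?X (fst z) (snd z) v - \<Phi> (fst z) (snd z) v)
          + hs2 K lam e (\<lambda>v. ?Y (fst z) (snd z) v - \<Psi> (fst z) (snd z) v)) \<partial>time_prob t)"
    proof (intro nn_integral_mono)
      fix z :: "real \<times> 'w"
      obtain s \<omega> where z: "z = (s, \<omega>)" by force
      have "hs2 K lam e (elementary_process zs s \<omega>)
          = hs2 K lam e (\<lambda>v. L (\<Phi> s \<omega> v - \<Psi> s \<omega> v) + L ((?X s \<omega> v - \<Phi> s \<omega> v) - (?Y s \<omega> v - \<Psi> s \<omega> v)))"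
        by (intro arg_cong[where f = "hs2 K lam e"] ext)
           (simp add: zs_process blinfun.diff_right)
      also have "\<dots> \<le> 2 * hs2 K lam e (\<lambda>v. L (\<Phi> s \<omega> v - \<Psi> s \<omega> v))
          + 2 * hs2 K lam e (\<lambda>v. L ((?X s \<omega> v - \<Phi> s \<omega> v) - (?Y s \<omega> v - \<Psi> s \<omega> v)))"
        by (rule hs2_add)
      also have "\<dots> \<le> 2 * hs2 K lam e (\<lambda>v. L (\<Phi> s \<omega> v - \<Psi> s \<omega> v))
          + 2 * (?l * (2 * hs2 K lam e (\<lambda>v. ?X s \<omega> v - \<Phi> s \<omega> v) + 2 * hs2 K lam e (\<lambda>v. ?Y s \<omega> v - \<Psi> s \<omega> v)))"
        by (intro add_left_mono mult_left_mono order_trans[OF hs2_blinfun] hs2_diff) simp_all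
      finally show "hs2 K lam e (elementary_process zs (fst z) (snd z))
          \<le> 2 * hs2 K lam e (\<lambda>v. L (\<Phi> (fst z) (snd z) v - \<Psi> (fst z) (snd z) v))
        + 4 * ?l * (hs2 K lam e (\<lambda>v. ?X (fst z) (snd z) v - \<Phi> (fst z) (snd z) v)
          + hs2 K lam e (\<lambda>v. ?Y (fst z) (snd z) v - \<Psi> (fst z) (snd z) v))"
        by (simp add: z distrib_left mult_ac)
    qed
    also have "\<dots> = 2 * ?R + 4 * ?l * (p n + q n)"
      unfolding p_def q_def by (simp add: nn_integral_add nn_integral_cmult)
    finally have main: "(\<integral>\<^sup>+\<omega>. nsq (elementary_integral W zs t \<omega>) \<partial>M) \<le> 2 * ?R + 4 * ?l * (p n + q n)" .
    have "(\<integral>\<^sup>+\<omega>. nsq (L (I \<omega> - J \<omega>)) \<partial>M)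
        \<le> (\<integral>\<^sup>+\<omega>. 2 * nsq (elementary_integral W zs t \<omega>)
          + 4 * ?l * (nsq (?U \<omega> - I \<omega>) + nsq (?V \<omega> - J \<omega>)) \<partial>M)"
    proof (intro nn_integral_mono)
      fix \<omega>
      have "L (I \<omega> - J \<omega>) = elementary_integral W zs t \<omega> - L ((?U \<omega> - I \<omega>) - (?V \<omega> - J \<omega>))"
        by (simp add: zs_integral blinfun.diff_right)
      then have "nsq (L (I \<omega> - J \<omega>))
          \<le> 2 * nsq (elementary_integral W zs t \<omega>) + 2 * nsq (L ((?U \<omega> - I \<omega>) - (?V \<omega> - J \<omega>)))"
        by (simp only: ennreal_norm_diff_sq_le)
      also have "\<dots> \<le> 2 * nsq (elementary_integral W zs t \<omega>)
          + 2 * (?l * (2 * nsq (?U \<omega> - I \<omega>) + 2 * nsq (?V \<omega> - J \<omega>)))"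
        by (intro add_left_mono mult_left_mono order_trans[OF ennreal_norm_blinfun_sq_le] ennreal_norm_diff_sq_le) simp_all
      finally show "nsq (L (I \<omega> - J \<omega>))
          \<le> 2 * nsq (elementary_integral W zs t \<omega>)
          + 4 * ?l * (nsq (?U \<omega> - I \<omega>) + nsq (?V \<omega> - J \<omega>))"
        by (simp add: distrib_left mult_ac)
    qed
    also have "\<dots> = 2 * (\<integral>\<^sup>+\<omega>. nsq (elementary_integral W zs t \<omega>) \<partial>M) + 4 * ?l * (p' n + q' n)"
      unfolding p'_def q'_def zs_integral by (simp add: nn_integral_add nn_integral_cmult)
    also have "\<dots> \<le> 2 * (2 * ?R + 4 * ?l * (p n + q n)) + 4 * ?l * (p' n + q' n)"
      by (intro add_mono mult_left_mono main) auto
    finally show ?thesis by (simp add: distrib_left mult_ac)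
  qed
  have "(\<lambda>n. 4 * ?R + 8 * ?l * (p n + q n) + 4 * ?l * (p' n + q' n)) \<longlonglongrightarrow> 4 * ?R + 8 * ?l * (0 + 0) + 4 * ?l * (0 + 0)"
    by (intro tendsto_add tendsto_const ennreal_tendsto_cmult lim) (auto simp: ennreal_mult_less_top)
  then have "(\<integral>\<^sup>+\<omega>. nsq (L (I \<omega> - J \<omega>)) \<partial>M) \<le> 4 * ?R + 8 * ?l * (0 + 0) + 4 * ?l * (0 + 0)"
    by (rule LIMSEQ_le_const) (use bound in auto)
  then show ?thesis by (simp add: split_beta')
qed

end

section \<open>A Gronwall inequality\<close>

lemma ennreal_absorb_half:
  fixes x a :: ennreal
  assumes "x \<le> a + ennreal (1 / 2) * x" "x < \<infinity>"
  shows "x \<le> 2 * a"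
proof (cases a)
  case (real r)
  obtain y where y: "x = ennreal y" "y \<ge> 0" using assms(2) by (cases x) auto
  have "ennreal (r + 1 / 2 * y) = a + ennreal (1 / 2) * x"
    using real y by (simp only: ennreal_plus ennreal_mult)
  then have "ennreal y \<le> ennreal (r + 1 / 2 * y)"
    using assms(1) y by simp
  moreover have "0 \<le> r + 1 / 2 * y" using real y by simp
  ultimately have "y \<le> r + 1 / 2 * y"
    by (simp only: ennreal_le_iff)
  then have "ennreal y \<le> ennreal (2 * r)" by (intro ennreal_leI) simp
  then show ?thesis using real y by (simp add: ennreal_mult')
qed (simp add: ennreal_mult_top)

lemma nn_integral_exp_le:
  assumes "r > 0" "t \<ge> 0"
  shows "(\<integral>\<^sup>+s\<in>{0..t}. ennreal (exp (r * s)) \<partial>lborel) \<le> ennreal (exp (r * t) / r)"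
proof -
  have "(\<integral>\<^sup>+s\<in>{0..t}. ennreal (exp (r * s)) \<partial>lborel) = ennreal (exp (r * t) / r - exp (r * 0) / r)"
    using assms by (intro nn_integral_FTC_Icc) (auto intro!: derivative_eq_intros)
  also have "\<dots> \<le> ennreal (exp (r * t) / r)"
    using assms by (intro ennreal_leI) simp
  finally show ?thesis .
qed

text \<open>The supremum \<open>S\<close> of \<open>exp(-2ct) \<phi>(t)\<close> over the interval is finite.  Inserting \<open>\<phi>(s) \<le> exp(2cs) S\<close> into
  the integral inequality gives \<open>S \<le> a + S/2\<close>, as the weight integrates to at most
  \<open>exp(2ct) / (2c)\<close>.\<close>

lemma gronwall_nn_integral:
  fixes \<phi> :: "real \<Rightarrow> ennreal"
  assumes [measurable]: "\<phi> \<in> borel_measurable borel" and c: "c > 0"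
    and bounded: "\<And>t. t \<in> {0..\<tau>} \<Longrightarrow> \<phi> t \<le> ennreal B"
    and ineq: "\<And>t. t \<in> {0..\<tau>} \<Longrightarrow> \<phi> t \<le> a + ennreal c * (\<integral>\<^sup>+s\<in>{0..t}. \<phi> s \<partial>lborel)"
    and t: "t \<in> {0..\<tau>}"
  shows "\<phi> t \<le> ennreal (2 * exp (2 * c * \<tau>)) * a"
proof -
  define S where "S = (SUP t\<in>{0..\<tau>}. ennreal (exp (- 2 * c * t)) * \<phi> t)"
  have "S \<le> ennreal B"
    unfolding S_def
  proof (rule SUP_least)
    fix t assume t: "t \<in> {0..\<tau>}"
    have "ennreal (exp (- 2 * c * t)) * \<phi> t \<le> 1 * ennreal B"
      using t c by (intro mult_mono bounded) (auto simp: ennreal_le_1)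
    then show "ennreal (exp (- 2 * c * t)) * \<phi> t \<le> ennreal B" by simp
  qed
  then have S_fin: "S < \<infinity>" by (rule order_le_less_trans) simp
  have \<phi>_le: "\<phi> s \<le> ennreal (exp (2 * c * s)) * S" if "s \<in> {0..\<tau>}" for s
  proof -
    have "\<phi> s = ennreal (exp (2 * c * s)) * (ennreal (exp (- 2 * c * s)) * \<phi> s)"
      by (simp flip: mult.assoc ennreal_mult' exp_add)
    also have "\<dots> \<le> ennreal (exp (2 * c * s)) * S"
      unfolding S_def using that by (intro mult_left_mono SUP_upper) auto
    finally show ?thesis .
  qed
  have "S \<le> a + ennreal (1 / 2) * S"
    unfolding S_def
  proof (rule SUP_least, fold S_def)
    fix t assume t: "t \<in> {0..\<tau>}"
    have "(\<integral>\<^sup>+s\<in>{0..t}. \<phi> s \<partial>lborel) \<le> (\<integral>\<^sup>+s. ennreal (exp (2 * c * s)) * indicator {0..t} s * S \<partial>lborel)"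
      using \<phi>_le t by (intro nn_integral_mono) (auto simp: indicator_def)
    also have "\<dots> = (\<integral>\<^sup>+s\<in>{0..t}. ennreal (exp (2 * c * s)) \<partial>lborel) * S"
      by (rule nn_integral_multc) simp
    also have "\<dots> \<le> ennreal (exp (2 * c * t) / (2 * c)) * S"
      using nn_integral_exp_le[of "2 * c" t] c t by (intro mult_right_mono) auto
    finally have int: "(\<integral>\<^sup>+s\<in>{0..t}. \<phi> s \<partial>lborel) \<le> ennreal (exp (2 * c * t) / (2 * c)) * S" .
    have "ennreal (exp (- 2 * c * t)) * \<phi> t \<le> ennreal (exp (- 2 * c * t)) * (a + ennreal c * (ennreal (exp (2 * c * t) / (2 * c)) * S))"
      by (intro mult_left_mono order_trans[OF ineq[OF t]] add_left_mono int) auto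
    also have "\<dots> = ennreal (exp (- 2 * c * t)) * a + ennreal (exp (- 2 * c * t) * (c * (exp (2 * c * t) / (2 * c)))) * S"
      using c by (simp add: distrib_left flip: mult.assoc ennreal_mult')
    also have "exp (- 2 * c * t) * (c * (exp (2 * c * t) / (2 * c))) = 1 / 2"
      using c by (simp add: field_simps flip: exp_add)
    also have "ennreal (exp (- 2 * c * t)) * a + ennreal (1 / 2) * S \<le> 1 * a + ennreal (1 / 2) * S"
      using c t by (intro add_right_mono mult_right_mono) (auto simp: ennreal_le_1)
    finally show "ennreal (exp (- 2 * c * t)) * \<phi> t \<le> a + ennreal (1 / 2) * S" by simp
  qed
  then have S: "S \<le> 2 * a" using S_fin by (rule ennreal_absorb_half)
  have "\<phi> t \<le> ennreal (exp (2 * c * \<tau>)) * (2 * a)"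
    using t c by (intro order_trans[OF \<phi>_le[OF t]] mult_mono S ennreal_leI) auto
  then show ?thesis by (simp add: ennreal_mult' mult_ac)
qed

section \<open>Convolutions with the semigroup\<close>

text \<open>If \<open>f\<close> is not integrable, the Bochner integral is 0 by convention.\<close>

lemma ennreal_norm_integral_le:
  fixes f :: "'a \<Rightarrow> 'b::{banach, second_countable_topology}"
  shows "ennreal (norm (integral\<^sup>L M f)) \<le> (\<integral>\<^sup>+x. ennreal (norm (f x)) \<partial>M)"
  by (cases "integrable M f") (auto intro: integral_norm_bound_ennreal simp: not_integrable_integral_eq)

lemma ennreal_norm_add3_sq_le:
  "nsq (a + b + c :: 'a::real_normed_vector)
    \<le> 3 * (nsq a + nsq b + nsq c)"
proof -
  have "norm (a + b + c) \<le> norm a + norm b + norm c"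
    using norm_triangle_ineq[of "a + b" c] norm_triangle_ineq[of a b] by linarith
  then have "(norm (a + b + c))\<^sup>2 \<le> (norm a + norm b + norm c)\<^sup>2"
    by (intro power_mono) auto
  also have "\<dots> \<le> 3 * ((norm a)\<^sup>2 + (norm b)\<^sup>2 + (norm c)\<^sup>2)"
    using sum_squares_bound[of "norm a" "norm b"] sum_squares_bound[of "norm a" "norm c"]
      sum_squares_bound[of "norm b" "norm c"]
    by (simp add: power2_eq_square algebra_simps)
  finally have "nsq (a + b + c) \<le> ennreal (3 * ((norm a)\<^sup>2 + (norm b)\<^sup>2 + (norm c)\<^sup>2))"
    by (rule ennreal_leI)
  then show ?thesis by (simp add: ennreal_mult')
qed

context c0_semigroup
begin

definition conv :: "(real \<Rightarrow> 'h) \<Rightarrow> real \<Rightarrow> 'h" where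
  "conv g t = (\<integral>s. indicator {0..t} s *\<^sub>R T (max 0 (t - s)) (g s) \<partial>lborel)"

lemma conv_measurable [measurable (raw)]:
  assumes [measurable]: "(\<lambda>(s, y). g s y) \<in> borel_measurable (lborel \<Otimes>\<^sub>M N)"
  shows "(\<lambda>(t, y). conv (\<lambda>s. g s y) t) \<in> borel_measurable (lborel \<Otimes>\<^sub>M N)"
proof -
  have ind: "(\<lambda>z. indicator {0..fst (fst z)} (snd z :: real) :: real) \<in> borel_measurable ((lborel \<Otimes>\<^sub>M N) \<Otimes>\<^sub>M lborel)"
    unfolding indicator_def atLeastAtMost_iff of_bool_def by measurable
  note [measurable] = ind
  have "(\<lambda>z. g (snd z) (snd (fst z))) \<in> borel_measurable ((lborel \<Otimes>\<^sub>M N) \<Otimes>\<^sub>M lborel)"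
    using measurable_compose[OF _ assms, of "\<lambda>z. (snd z, snd (fst z))"] by simp
  note [measurable] = this
  have "(\<lambda>z. indicator {0..fst (fst z)} (snd z) *\<^sub>R T (max 0 (fst (fst z) - snd z)) (g (snd z) (snd (fst z))))
      \<in> borel_measurable ((lborel \<Otimes>\<^sub>M N) \<Otimes>\<^sub>M lborel)"
    by measurable
  then have "(\<lambda>z. \<integral>s. indicator {0..fst z} s *\<^sub>R T (max 0 (fst z - s)) (g s (snd z)) \<partial>lborel) \<in> borel_measurable (lborel \<Otimes>\<^sub>M N)"
    by (intro lborel.borel_measurable_lebesgue_integral) (simp add: split_beta')
  then show ?thesis by (simp add: conv_def split_beta')
qed

text \<open>The Cauchy-Schwarz inequality with the weight \<open>w\<close> as one of the two factors.\<close>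

lemma blinfun_conv_sq_le:
  fixes L :: "'h \<Rightarrow>\<^sub>L 'g::{banach, second_countable_topology}"
  assumes [measurable]: "g \<in> borel_measurable borel" "w \<in> borel_measurable borel"
    and w: "\<And>s. w s \<ge> 0"
  shows "nsq (L (conv (\<lambda>s. w s *\<^sub>R g s) t))
    \<le> (\<integral>\<^sup>+s\<in>{0..t}. ennreal ((w s)\<^sup>2) \<partial>lborel) * (\<integral>\<^sup>+s\<in>{0..t}. nsq (L (T (max 0 (t - s)) (g s))) \<partial>lborel)"
proof -
  have [measurable]: "blinfun_apply L \<in> borel_measurable borel"
    by (intro borel_measurable_continuous_onI continuous_intros)
  let ?u = "\<lambda>s. indicator {0..t} s *\<^sub>R T (max 0 (t - s)) (w s *\<^sub>R g s)"
  have "ennreal (norm (L (conv (\<lambda>s. w s *\<^sub>R g s) t))) \<le> (\<integral>\<^sup>+s. ennreal (norm (L (?u s))) \<partial>lborel)"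
  proof (cases "integrable lborel ?u")
    case True
    have "L (conv (\<lambda>s. w s *\<^sub>R g s) t) = (\<integral>s. L (?u s) \<partial>lborel)"
      unfolding conv_def by (rule integral_bounded_linear[OF blinfun.bounded_linear_right True, symmetric])
    then show ?thesis using ennreal_norm_integral_le[of lborel "\<lambda>s. L (?u s)"] by simp
  next
    case False
    then show ?thesis by (simp add: conv_def not_integrable_integral_eq blinfun.zero_right)
  qed
  also have "\<dots> = (\<integral>\<^sup>+s. ennreal (w s * indicator {0..t} s) * ennreal (norm (L (T (max 0 (t - s)) (g s))) * indicator {0..t} s) \<partial>lborel)"
    using w by (intro nn_integral_cong) (auto simp: indicator_def blinfun.scaleR_right ennreal_mult')
  finally have "(ennreal (norm (L (conv (\<lambda>s. w s *\<^sub>R g s) t))))\<^sup>2 \<le> \<dots>\<^sup>2"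
    by (intro power_mono) auto
  also have "\<dots> \<le> (\<integral>\<^sup>+s. (ennreal (w s * indicator {0..t} s))\<^sup>2 \<partial>lborel)
      * (\<integral>\<^sup>+s. (ennreal (norm (L (T (max 0 (t - s)) (g s))) * indicator {0..t} s))\<^sup>2 \<partial>lborel)"
    by (intro Cauchy_Schwarz_nn_integral) measurable
  also have "(\<integral>\<^sup>+s. (ennreal (w s * indicator {0..t} s))\<^sup>2 \<partial>lborel) = (\<integral>\<^sup>+s\<in>{0..t}. ennreal ((w s)\<^sup>2) \<partial>lborel)"
    using w by (intro nn_integral_cong) (auto simp: indicator_def ennreal_power)
  also have "(\<integral>\<^sup>+s. (ennreal (norm (L (T (max 0 (t - s)) (g s))) * indicator {0..t} s))\<^sup>2 \<partial>lborel)
      = (\<integral>\<^sup>+s\<in>{0..t}. nsq (L (T (max 0 (t - s)) (g s))) \<partial>lborel)"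
    by (intro nn_integral_cong) (auto simp: indicator_def ennreal_power)
  finally show ?thesis by (simp add: ennreal_power)
qed

text \<open>Integrate over \<open>t\<close> first: for fixed \<open>s\<close> the inner integral is the energy of the observed orbit of
  \<open>g s\<close> over an interval of length at most \<open>\<tau>\<close>.\<close>

lemma observed_convolution_energy:
  fixes L :: "'h \<Rightarrow>\<^sub>L 'g::{banach, second_countable_topology}"
  assumes adm: "\<And>x. (\<integral>\<^sup>+t\<in>{0..\<tau>}. nsq (L (T t x)) \<partial>lborel) \<le> ennreal (\<gamma> * (norm x)\<^sup>2)"
    and \<gamma>: "\<gamma> \<ge> 0" and [measurable]: "g \<in> borel_measurable borel" and \<theta>: "\<theta> \<le> \<tau>"
  shows "(\<integral>\<^sup>+t\<in>{0..\<theta>}. (\<integral>\<^sup>+s\<in>{0..t}. nsq (L (T (max 0 (t - s)) (g s))) \<partial>lborel) \<partial>lborel)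
    \<le> ennreal \<gamma> * (\<integral>\<^sup>+s\<in>{0..\<theta>}. nsq (g s) \<partial>lborel)"
proof -
  have [measurable]: "blinfun_apply L \<in> borel_measurable borel"
    by (intro borel_measurable_continuous_onI continuous_intros)
  define h where "h t s = (if 0 \<le> s \<and> s \<le> t \<and> t \<le> \<theta> then nsq (L (T (max 0 (t - s)) (g s))) else 0)" for t s
  have [measurable]: "(\<lambda>(t, s). h t s) \<in> borel_measurable (lborel \<Otimes>\<^sub>M lborel)"
    unfolding h_def by measurable
  have "(\<integral>\<^sup>+t\<in>{0..\<theta>}. (\<integral>\<^sup>+s\<in>{0..t}. nsq (L (T (max 0 (t - s)) (g s))) \<partial>lborel) \<partial>lborel)
      = (\<integral>\<^sup>+t. \<integral>\<^sup>+s. h t s \<partial>lborel \<partial>lborel)"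
  proof (intro nn_integral_cong)
    fix t :: real
    have "(\<integral>\<^sup>+s\<in>{0..t}. nsq (L (T (max 0 (t - s)) (g s))) \<partial>lborel) * indicator {0..\<theta>} t
        = (\<integral>\<^sup>+s. nsq (L (T (max 0 (t - s)) (g s))) * indicator {0..t} s * indicator {0..\<theta>} t \<partial>lborel)"
      by (rule nn_integral_multc[symmetric]) measurable
    also have "\<dots> = (\<integral>\<^sup>+s. h t s \<partial>lborel)"
      by (intro nn_integral_cong) (auto simp: h_def indicator_def)
    finally show "(\<integral>\<^sup>+s\<in>{0..t}. nsq (L (T (max 0 (t - s)) (g s))) \<partial>lborel) * indicator {0..\<theta>} t
        = (\<integral>\<^sup>+s. h t s \<partial>lborel)" .
  qed
  also have "\<dots> = (\<integral>\<^sup>+s. \<integral>\<^sup>+t. h t s \<partial>lborel \<partial>lborel)"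
    by (rule lborel_pair.Fubini'[symmetric]) measurable
  also have "\<dots> \<le> (\<integral>\<^sup>+s. ennreal \<gamma> * (nsq (g s) * indicator {0..\<theta>} s) \<partial>lborel)"
  proof (intro nn_integral_mono)
    fix s :: real
    show "(\<integral>\<^sup>+t. h t s \<partial>lborel) \<le> ennreal \<gamma> * (nsq (g s) * indicator {0..\<theta>} s)"
    proof (cases "0 \<le> s \<and> s \<le> \<theta>")
      case True
      have "(\<integral>\<^sup>+t. h t s \<partial>lborel) = (\<integral>\<^sup>+t. h (s + t) s \<partial>lborel)"
        by (subst nn_integral_real_affine[of "\<lambda>t. h t s" 1 s]) simp_all
      also have "\<dots> \<le> (\<integral>\<^sup>+t\<in>{0..\<tau>}. nsq (L (T t (g s))) \<partial>lborel)"
        using True \<theta> by (intro nn_integral_mono) (auto simp: h_def indicator_def max_def)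
      also have "\<dots> \<le> ennreal \<gamma> * nsq (g s)"
        using adm[of "g s"] \<gamma> by (simp add: ennreal_mult')
      finally show ?thesis using True by simp
    next
      case False
      then have "h t s = 0" for t by (auto simp: h_def)
      then show ?thesis by simp
    qed
  qed
  also have "\<dots> = ennreal \<gamma> * (\<integral>\<^sup>+s\<in>{0..\<theta>}. nsq (g s) \<partial>lborel)"
    by (rule nn_integral_cmult) measurable
  finally show ?thesis .
qed

lemma observed_hs_convolution_energy:
  fixes L :: "'h \<Rightarrow>\<^sub>L 'g::{banach, second_countable_topology}" and D :: "real \<Rightarrow> 'v \<Rightarrow> 'h"
  assumes adm: "\<And>x. (\<integral>\<^sup>+t\<in>{0..\<tau>}. nsq (L (T t x)) \<partial>lborel) \<le> ennreal (\<gamma> * (norm x)\<^sup>2)"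
    and \<gamma>: "\<gamma> \<ge> 0" and \<theta>: "\<theta> \<le> \<tau>"
    and D: "\<And>k. k \<in> K \<Longrightarrow> (\<lambda>s. sqrt (lam k) *\<^sub>R D s (e k)) \<in> borel_measurable borel"
  shows "(\<integral>\<^sup>+t\<in>{0..\<theta>}. (\<integral>\<^sup>+s\<in>{0..t}. hs2 K lam e (\<lambda>v. L (T (max 0 (t - s)) (D s v))) \<partial>lborel) \<partial>lborel)
    \<le> ennreal \<gamma> * (\<integral>\<^sup>+s\<in>{0..\<theta>}. hs2 K lam e (D s) \<partial>lborel)"
proof -
  have [measurable]: "blinfun_apply L \<in> borel_measurable borel"
    by (intro borel_measurable_continuous_onI continuous_intros)
  define g where "g k s = (if k \<in> K then sqrt (lam k) *\<^sub>R D s (e k) else 0)" for k s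
  have [measurable]: "g k \<in> borel_measurable borel" for k
    using D[of k] by (cases "k \<in> K") (simp_all add: g_def[abs_def])
  have hs_D: "hs2 K lam e (D s) = (\<Sum>k. nsq (g k s))" for s
    unfolding hs2_def g_def by (intro suminf_cong) simp
  have hs_LTD: "hs2 K lam e (\<lambda>v. L (T (max 0 (t - s)) (D s v))) = (\<Sum>k. nsq (L (T (max 0 (t - s)) (g k s))))" for t s
    unfolding hs2_def g_def by (intro suminf_cong) (auto simp: blinfun.scaleR_right blinfun.zero_right)
  have pair [measurable]: "(\<lambda>t. \<integral>\<^sup>+s\<in>{0..t}. nsq (L (T (max 0 (t - s)) (g k s))) \<partial>lborel) \<in> borel_measurable borel" for k
  proof -
    have "(\<lambda>(t, s). nsq (L (T (max 0 (t - s)) (g k s))) * indicator {0..t} s) \<in> borel_measurable (borel \<Otimes>\<^sub>M lborel)"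
      unfolding indicator_def atLeastAtMost_iff of_bool_def by measurable
    then show ?thesis by measurable
  qed
  have "(\<integral>\<^sup>+t\<in>{0..\<theta>}. (\<integral>\<^sup>+s\<in>{0..t}. hs2 K lam e (\<lambda>v. L (T (max 0 (t - s)) (D s v))) \<partial>lborel) \<partial>lborel)
      = (\<integral>\<^sup>+t. (\<Sum>k. (\<integral>\<^sup>+s\<in>{0..t}. nsq (L (T (max 0 (t - s)) (g k s))) \<partial>lborel) * indicator {0..\<theta>} t) \<partial>lborel)"
    unfolding hs_LTD by (simp add: nn_integral_suminf[symmetric])
  also have "\<dots> = (\<Sum>k. \<integral>\<^sup>+t\<in>{0..\<theta>}. (\<integral>\<^sup>+s\<in>{0..t}. nsq (L (T (max 0 (t - s)) (g k s))) \<partial>lborel) \<partial>lborel)"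
    by (rule nn_integral_suminf) measurable
  also have "\<dots> \<le> (\<Sum>k. ennreal \<gamma> * (\<integral>\<^sup>+s\<in>{0..\<theta>}. nsq (g k s) \<partial>lborel))"
    by (intro suminf_le observed_convolution_energy[OF adm \<gamma> _ \<theta>]) auto
  also have "\<dots> = ennreal \<gamma> * (\<Sum>k. \<integral>\<^sup>+s\<in>{0..\<theta>}. nsq (g k s) \<partial>lborel)"
    by simp
  also have "(\<Sum>k. \<integral>\<^sup>+s\<in>{0..\<theta>}. nsq (g k s) \<partial>lborel) = (\<integral>\<^sup>+s. (\<Sum>k. nsq (g k s) * indicator {0..\<theta>} s) \<partial>lborel)"
    by (rule nn_integral_suminf[symmetric]) measurable
  also have "\<dots> = (\<integral>\<^sup>+s\<in>{0..\<theta>}. hs2 K lam e (D s) \<partial>lborel)"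
    unfolding hs_D by simp
  finally show ?thesis .
qed

text \<open>The estimate of the output energy along one path.  Here \<open>z\<close> is the difference of the two
  solutions, \<open>c\<close> the difference of their outputs, \<open>g\<close> the difference of their drifts and \<open>N\<close> the
  remaining stochastic part.  With the weight \<open>E t = exp(-\<mu>t)\<close> and the weighted energy \<open>U\<close> of \<open>c\<close>, the
  observations \<open>L n\<close> of the three parts of \<open>z\<close> contribute at most \<open>\<gamma>|\<zeta>|\<^sup>2\<close>, \<open>\<gamma>k\<^sup>2/(2\<mu>) U\<close> and the
  energy of \<open>L n (N t)\<close>.  Fatou's lemma replaces \<open>L n (z t)\<close> by \<open>c t\<close>; the choice of \<open>\<mu>\<close> makes the
  factor of \<open>U\<close>, including the 3 from the square of a sum of three terms, at most 1/2, and
  finiteness of \<open>U\<close> allows to absorb it.\<close>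

lemma observed_output_bound:
  fixes L :: "nat \<Rightarrow> 'h \<Rightarrow>\<^sub>L 'g::{banach, second_countable_topology}"
  assumes adm: "\<And>n x. (\<integral>\<^sup>+t\<in>{0..\<tau>}. nsq (L n (T t x)) \<partial>lborel) \<le> ennreal (\<gamma> * (norm x)\<^sup>2)"
    and \<gamma>: "\<gamma> \<ge> 0" and \<theta>: "\<theta> \<le> \<tau>" and k: "k > 0"
    and meas [measurable]: "g \<in> borel_measurable borel" "c \<in> borel_measurable borel" "N \<in> borel_measurable borel"
    and z: "AE t in lborel. t \<in> {0..\<theta>} \<longrightarrow> z t = T t \<zeta> + conv g t + N t"
    and lim: "AE t in lborel. t \<in> {0..\<theta>} \<longrightarrow> (\<lambda>n. L n (z t)) \<longlonglongrightarrow> c t"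
    and g: "\<And>t. norm (g t) \<le> k * norm (c t)"
    and fin: "(\<integral>\<^sup>+t\<in>{0..\<theta>}. nsq (c t) \<partial>lborel) < \<infinity>"
    and \<mu>: "\<mu> = 3 * \<gamma> * k\<^sup>2 + 1"
  shows "(\<integral>\<^sup>+t\<in>{0..\<theta>}. nsq (c t) \<partial>lborel)
    \<le> ennreal (6 * exp (2 * \<mu> * \<theta>)) * (ennreal \<gamma> * nsq \<zeta>
        + liminf (\<lambda>n. \<integral>\<^sup>+t\<in>{0..\<theta>}. nsq (L n (N t)) \<partial>lborel))"
proof -
  have \<mu>_pos: "\<mu> > 0" using \<gamma> by (simp add: \<mu> add_nonneg_pos)
  have [measurable]: "blinfun_apply (L n) \<in> borel_measurable borel" for n
    by (intro borel_measurable_continuous_onI continuous_intros)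
  define E where "E t = exp (- \<mu> * t)" for t
  have [measurable]: "E \<in> borel_measurable borel" unfolding E_def by measurable
  have E: "E t > 0" "0 \<le> t \<Longrightarrow> E t \<le> 1" for t using \<mu>_pos by (auto simp: E_def)
  define y where "y t = T (max 0 t) \<zeta> + conv g t + N t" for t
  have conv_pair: "(\<lambda>(t, u :: unit). conv g t) \<in> borel_measurable (lborel \<Otimes>\<^sub>M count_space UNIV)"
    by (rule conv_measurable) measurable
  have "(\<lambda>t. (t, ())) \<in> lborel \<rightarrow>\<^sub>M lborel \<Otimes>\<^sub>M count_space UNIV" by simp
  from measurable_compose[OF this conv_pair]
  have [measurable]: "conv g \<in> borel_measurable borel" by simp
  have [measurable]: "y \<in> borel_measurable borel" unfolding y_def by measurable
  define U where "U = (\<integral>\<^sup>+t\<in>{0..\<theta>}. ennreal ((E t * norm (c t))\<^sup>2) \<partial>lborel)"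
  let ?G = "ennreal \<gamma> * nsq \<zeta>"
  define R where "R n = (\<integral>\<^sup>+t\<in>{0..\<theta>}. nsq (L n (N t)) \<partial>lborel)" for n

  have U_fin: "U < \<infinity>"
  proof -
    have "U \<le> (\<integral>\<^sup>+t\<in>{0..\<theta>}. nsq (c t) \<partial>lborel)"
      unfolding U_def
    proof (intro nn_integral_mono)
      fix t
      have "(E t * norm (c t))\<^sup>2 \<le> (norm (c t))\<^sup>2" if "0 \<le> t"
        using E[of t] that by (intro power_mono) (auto simp: mult_left_le_one_le)
      then show "ennreal ((E t * norm (c t))\<^sup>2) * indicator {0..\<theta>} t \<le> nsq (c t) * indicator {0..\<theta>} t"
        by (auto simp: indicator_def ennreal_leI)
    qed
    then show ?thesis using fin by (rule order_le_less_trans)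
  qed
  have Ln: "(\<integral>\<^sup>+t\<in>{0..\<theta>}. ennreal ((E t * norm (L n (y t)))\<^sup>2) \<partial>lborel) \<le> 3 * (?G + ennreal (\<gamma> * k\<^sup>2 / (2 * \<mu>)) * U + R n)" for n
  proof -
    define a where "a t = nsq (L n (T (max 0 t) \<zeta>)) * indicator {0..\<theta>} t" for t
    define H where "H t = (\<integral>\<^sup>+s\<in>{0..t}. nsq (L n (T (max 0 (t - s)) (E s *\<^sub>R g s))) \<partial>lborel)" for t
    define b where "b t = ennreal (1 / (2 * \<mu>)) * (H t * indicator {0..\<theta>} t)" for t
    define d where "d t = nsq (L n (N t)) * indicator {0..\<theta>} t" for t
    have [measurable]: "a \<in> borel_measurable borel" "d \<in> borel_measurable borel"
      unfolding a_def d_def by measurable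
    have [measurable]: "H \<in> borel_measurable borel"
    proof -
      have "(\<lambda>(t, s). nsq (L n (T (max 0 (t - s)) (E s *\<^sub>R g s))) * indicator {0..t} s) \<in> borel_measurable (borel \<Otimes>\<^sub>M lborel)"
        unfolding indicator_def atLeastAtMost_iff of_bool_def by measurable
      then show ?thesis unfolding H_def by measurable
    qed
    have [measurable]: "b \<in> borel_measurable borel" unfolding b_def by measurable
    have pointwise: "ennreal ((E t * norm (L n (y t)))\<^sup>2) * indicator {0..\<theta>} t \<le> 3 * (a t + b t + d t)" for t
    proof (cases "t \<in> {0..\<theta>}")
      case True
      then have t: "0 \<le> t" "t \<le> \<theta>" by auto
      have E_sq: "(norm (E t *\<^sub>R x))\<^sup>2 \<le> (norm x)\<^sup>2" for x :: 'g
        using E[of t] t by (intro power_mono) (auto simp: mult_left_le_one_le)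
      \<comment> \<open>The weight is split as \<open>E t = E (t - s) * E s\<close>: the first factor is small in square integral,
        the second turns \<open>g\<close> into its weighted version.\<close>
      have conv_E: "E t *\<^sub>R L n (conv g t) = L n (conv (\<lambda>s. E (t - s) *\<^sub>R (E s *\<^sub>R g s)) t)"
      proof -
        have "E t *\<^sub>R conv g t = conv (\<lambda>s. E (t - s) *\<^sub>R (E s *\<^sub>R g s)) t"
          unfolding conv_def integral_scaleR_right[symmetric]
        proof (intro Bochner_Integration.integral_cong refl)
          fix s
          have "E (t - s) * E s = E t" by (simp add: E_def algebra_simps flip: exp_add)
          then show "E t *\<^sub>R indicator {0..t} s *\<^sub>R T (max 0 (t - s)) (g s)
              = indicator {0..t} s *\<^sub>R T (max 0 (t - s)) (E (t - s) *\<^sub>R E s *\<^sub>R g s)"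
            by (simp add: blinfun.scaleR_right mult.commute)
        qed
        then show ?thesis by (simp flip: blinfun.scaleR_right)
      qed
      have weight: "(\<integral>\<^sup>+s\<in>{0..t}. ennreal ((E (t - s))\<^sup>2) \<partial>lborel) \<le> ennreal (1 / (2 * \<mu>))"
      proof -
        have "(\<integral>\<^sup>+s\<in>{0..t}. ennreal ((E (t - s))\<^sup>2) \<partial>lborel)
            = (\<integral>\<^sup>+s. ennreal (exp (- 2 * \<mu> * t)) * (ennreal (exp (2 * \<mu> * s)) * indicator {0..t} s) \<partial>lborel)"
          by (intro nn_integral_cong)
             (auto simp: indicator_def E_def power2_eq_square algebra_simps simp flip: ennreal_mult' exp_add)
        also have "\<dots> = ennreal (exp (- 2 * \<mu> * t)) * (\<integral>\<^sup>+s\<in>{0..t}. ennreal (exp (2 * \<mu> * s)) \<partial>lborel)"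
          by (rule nn_integral_cmult) simp
        also have "\<dots> \<le> ennreal (exp (- 2 * \<mu> * t)) * ennreal (exp (2 * \<mu> * t) / (2 * \<mu>))"
          using nn_integral_exp_le[of "2 * \<mu>" t] \<mu>_pos t by (intro mult_left_mono) auto
        also have "\<dots> = ennreal (1 / (2 * \<mu>))"
          by (simp add: flip: ennreal_mult' exp_add)
        finally show ?thesis .
      qed
      have "(E t * norm (L n (y t)))\<^sup>2 = (norm (E t *\<^sub>R L n (T (max 0 t) \<zeta>) + E t *\<^sub>R L n (conv g t) + E t *\<^sub>R L n (N t)))\<^sup>2"
        using E(1)[of t] by (simp add: y_def blinfun.add_right flip: scaleR_add_right)
      also have "ennreal \<dots> \<le> 3 * (nsq (E t *\<^sub>R L n (T (max 0 t) \<zeta>)) + nsq (E t *\<^sub>R L n (conv g t)) + nsq (E t *\<^sub>R L n (N t)))"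
        by (rule ennreal_norm_add3_sq_le)
      also have "\<dots> \<le> 3 * (a t + b t + d t)"
      proof (intro mult_left_mono add_mono)
        show "nsq (E t *\<^sub>R L n (T (max 0 t) \<zeta>)) \<le> a t"
          using True E_sq by (simp add: a_def ennreal_leI del: norm_scaleR)
        show "nsq (E t *\<^sub>R L n (N t)) \<le> d t"
          using True E_sq by (simp add: d_def ennreal_leI del: norm_scaleR)
        have "nsq (E t *\<^sub>R L n (conv g t))
            \<le> (\<integral>\<^sup>+s\<in>{0..t}. ennreal ((E (t - s))\<^sup>2) \<partial>lborel) * (\<integral>\<^sup>+s\<in>{0..t}. nsq (L n (T (max 0 (t - s)) (E s *\<^sub>R g s))) \<partial>lborel)"
          unfolding conv_E using less_imp_le[OF E(1)] by (intro blinfun_conv_sq_le) auto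
        also have "\<dots> \<le> b t"
          using True by (simp add: b_def H_def mult_right_mono weight)
        finally show "nsq (E t *\<^sub>R L n (conv g t)) \<le> b t" .
      qed simp
      finally show ?thesis using True by simp
    qed simp
    have int_a: "(\<integral>\<^sup>+t. a t \<partial>lborel) \<le> ?G"
    proof -
      have "(\<integral>\<^sup>+t. a t \<partial>lborel) \<le> (\<integral>\<^sup>+t\<in>{0..\<tau>}. nsq (L n (T t \<zeta>)) \<partial>lborel)"
        using \<theta> by (intro nn_integral_mono) (auto simp: a_def indicator_def max_def)
      also have "\<dots> \<le> ?G" using adm[of n \<zeta>] \<gamma> by (simp add: ennreal_mult')
      finally show ?thesis .
    qed
    have int_b: "(\<integral>\<^sup>+t. b t \<partial>lborel) \<le> ennreal (\<gamma> * k\<^sup>2 / (2 * \<mu>)) * U"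
    proof -
      have "(\<integral>\<^sup>+t. b t \<partial>lborel) = ennreal (1 / (2 * \<mu>)) * (\<integral>\<^sup>+t\<in>{0..\<theta>}. (\<integral>\<^sup>+s\<in>{0..t}. nsq (L n (T (max 0 (t - s)) (E s *\<^sub>R g s))) \<partial>lborel) \<partial>lborel)"
        unfolding b_def H_def[symmetric] by (rule nn_integral_cmult) measurable
      also have "\<dots> \<le> ennreal (1 / (2 * \<mu>)) * (ennreal \<gamma> * (\<integral>\<^sup>+s\<in>{0..\<theta>}. nsq (E s *\<^sub>R g s) \<partial>lborel))"
        by (intro mult_left_mono observed_convolution_energy[OF adm \<gamma> _ \<theta>]) auto
      also have "(\<integral>\<^sup>+s\<in>{0..\<theta>}. nsq (E s *\<^sub>R g s) \<partial>lborel)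
          \<le> (\<integral>\<^sup>+s. ennreal (k\<^sup>2) * (ennreal ((E s * norm (c s))\<^sup>2) * indicator {0..\<theta>} s) \<partial>lborel)"
      proof (intro nn_integral_mono)
        fix s
        have "norm (E s *\<^sub>R g s) \<le> k * (E s * norm (c s))"
          using mult_left_mono[OF g[of s] less_imp_le[OF E(1)[of s]]] E(1)[of s] by (simp add: mult_ac)
        then have "(norm (E s *\<^sub>R g s))\<^sup>2 \<le> (k * (E s * norm (c s)))\<^sup>2"
          by (intro power_mono) auto
        then have "(norm (E s *\<^sub>R g s))\<^sup>2 \<le> k\<^sup>2 * (E s * norm (c s))\<^sup>2"
          by (simp only: power_mult_distrib)
        then show "nsq (E s *\<^sub>R g s) * indicator {0..\<theta>} s \<le> ennreal (k\<^sup>2) * (ennreal ((E s * norm (c s))\<^sup>2) * indicator {0..\<theta>} s)"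
          by (auto simp: indicator_def ennreal_leI simp flip: ennreal_mult')
      qed
      also have "\<dots> = ennreal (k\<^sup>2) * U"
        unfolding U_def by (rule nn_integral_cmult) measurable
      finally show ?thesis
        using \<gamma> \<mu>_pos by (simp add: mult_left_mono flip: ennreal_mult' mult.assoc)
    qed
    have "(\<integral>\<^sup>+t\<in>{0..\<theta>}. ennreal ((E t * norm (L n (y t)))\<^sup>2) \<partial>lborel) \<le> (\<integral>\<^sup>+t. 3 * (a t + b t + d t) \<partial>lborel)"
      by (intro nn_integral_mono pointwise)
    also have "\<dots> = 3 * ((\<integral>\<^sup>+t. a t \<partial>lborel) + (\<integral>\<^sup>+t. b t \<partial>lborel) + (\<integral>\<^sup>+t. d t \<partial>lborel))"
      by (simp add: nn_integral_cmult nn_integral_add)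
    also have "\<dots> \<le> 3 * (?G + ennreal (\<gamma> * k\<^sup>2 / (2 * \<mu>)) * U + R n)"
      by (intro mult_left_mono add_mono int_a int_b) (auto simp: R_def d_def)
    finally show ?thesis .
  qed
  have "U = (\<integral>\<^sup>+t. liminf (\<lambda>n. ennreal ((E t * norm (L n (y t)))\<^sup>2) * indicator {0..\<theta>} t) \<partial>lborel)"
    unfolding U_def
  proof (intro nn_integral_cong_AE)
    show "AE t in lborel. ennreal ((E t * norm (c t))\<^sup>2) * indicator {0..\<theta>} t
        = liminf (\<lambda>n. ennreal ((E t * norm (L n (y t)))\<^sup>2) * indicator {0..\<theta>} t)"
      using z lim
    proof eventually_elim
      case (elim t)
      show ?case
      proof (cases "t \<in> {0..\<theta>}")
        case True
        then have "z t = y t" using elim by (simp add: y_def)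
        then have "(\<lambda>n. L n (y t)) \<longlonglongrightarrow> c t" using elim True by simp
        then have "(\<lambda>n. ennreal ((E t * norm (L n (y t)))\<^sup>2)) \<longlonglongrightarrow> ennreal ((E t * norm (c t))\<^sup>2)"
          by (intro tendsto_ennrealI tendsto_intros)
        from lim_imp_Liminf[OF trivial_limit_sequentially this] True show ?thesis by simp
      qed (simp add: Liminf_const)
    qed
  qed
  also have "\<dots> \<le> liminf (\<lambda>n. \<integral>\<^sup>+t\<in>{0..\<theta>}. ennreal ((E t * norm (L n (y t)))\<^sup>2) \<partial>lborel)"
    by (rule nn_integral_liminf) measurable
  also have "\<dots> \<le> liminf (\<lambda>n. 3 * (?G + ennreal (\<gamma> * k\<^sup>2 / (2 * \<mu>)) * U + R n))"
    by (intro Liminf_mono always_eventually allI Ln)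
  also have "\<dots> = 3 * (?G + ennreal (\<gamma> * k\<^sup>2 / (2 * \<mu>)) * U + liminf R)"
  proof -
    have "continuous_on UNIV (\<lambda>x. 3 * (?G + ennreal (\<gamma> * k\<^sup>2 / (2 * \<mu>)) * U + x) :: ennreal)"
      by (intro ennreal_continuous_on_cmult continuous_on_add_ennreal continuous_on_const continuous_on_id) auto
    moreover have "mono (\<lambda>x. 3 * (?G + ennreal (\<gamma> * k\<^sup>2 / (2 * \<mu>)) * U + x) :: ennreal)"
      by (intro monoI mult_left_mono add_left_mono) auto
    ultimately show ?thesis
      by (rule Liminf_compose_continuous_mono) simp
  qed
  also have "\<dots> = 3 * (?G + liminf R) + ennreal (3 * \<gamma> * k\<^sup>2 / (2 * \<mu>)) * U"
    using \<gamma> \<mu>_pos by (simp add: distrib_left ennreal_mult' mult_ac add_ac flip: times_divide_eq_right)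
  also have "\<dots> \<le> 3 * (?G + liminf R) + ennreal (1 / 2) * U"
    using \<mu>_pos by (intro add_left_mono mult_right_mono ennreal_leI) (auto simp: \<mu> field_simps)
  finally have "U \<le> 2 * (3 * (?G + liminf R))"
    using U_fin by (rule ennreal_absorb_half)
  then have U_le: "U \<le> 6 * (?G + liminf R)" by (simp add: mult.assoc[symmetric])
  have "(\<integral>\<^sup>+t\<in>{0..\<theta>}. nsq (c t) \<partial>lborel)
      \<le> (\<integral>\<^sup>+t. ennreal (exp (2 * \<mu> * \<theta>)) * (ennreal ((E t * norm (c t))\<^sup>2) * indicator {0..\<theta>} t) \<partial>lborel)"
  proof (intro nn_integral_mono)
    fix t
    have "(norm (c t))\<^sup>2 \<le> exp (2 * \<mu> * \<theta>) * (E t * norm (c t))\<^sup>2" if "t \<le> \<theta>"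
    proof -
      have "1 \<le> exp (2 * \<mu> * (\<theta> - t))" using that \<mu>_pos by simp
      also have "\<dots> = exp (2 * \<mu> * \<theta>) * (E t)\<^sup>2"
        by (simp add: E_def power2_eq_square algebra_simps flip: exp_add)
      finally show ?thesis
        using mult_right_mono[of 1 "exp (2 * \<mu> * \<theta>) * (E t)\<^sup>2" "(norm (c t))\<^sup>2"] by (simp add: power_mult_distrib mult.assoc)
    qed
    then show "nsq (c t) * indicator {0..\<theta>} t \<le> ennreal (exp (2 * \<mu> * \<theta>)) * (ennreal ((E t * norm (c t))\<^sup>2) * indicator {0..\<theta>} t)"
      by (auto simp: indicator_def ennreal_leI simp flip: ennreal_mult')
  qed
  also have "\<dots> = ennreal (exp (2 * \<mu> * \<theta>)) * U"
    unfolding U_def by (rule nn_integral_cmult) measurable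
  also have "\<dots> \<le> ennreal (exp (2 * \<mu> * \<theta>)) * (6 * (?G + liminf R))"
    by (intro mult_left_mono U_le) auto
  also have "\<dots> = ennreal (6 * exp (2 * \<mu> * \<theta>)) * (?G + liminf R)"
  proof -
    have "ennreal (6 * exp (2 * \<mu> * \<theta>)) = ennreal (exp (2 * \<mu> * \<theta>)) * 6"
      by (simp add: ennreal_mult' mult.commute)
    then show ?thesis by (simp only: mult.assoc)
  qed
  finally show ?thesis unfolding R_def[abs_def] .
qed

end

section \<open>The difference of two mild solutions\<close>

text \<open>Two mild solutions of the same equation.  The constants of the estimates below do not depend on
  the solutions; they come from the bounded approximations \<open>L n\<close> of the observation operator and
  from the semigroup.\<close>

locale mild_pair =
  wiener M F K \<beta> lam e W + observed_semigroup T DA A C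
  for M :: "'w measure" and F K \<beta> lam and e :: "nat \<Rightarrow> 'v::{real_inner, banach, second_countable_topology}" and W
    and T :: "real \<Rightarrow> 'h::{real_inner, banach, second_countable_topology} \<Rightarrow>\<^sub>L 'h" and DA A C +
  fixes f :: "'h \<Rightarrow> 'h" and m :: "'h \<Rightarrow> 'v \<Rightarrow> 'h" and k \<tau> :: real
    and \<xi> \<eta> :: "'w \<Rightarrow> 'h" and X Y :: "real \<Rightarrow> 'w \<Rightarrow> 'h"
  assumes m_hs: "\<And>x. m x \<in> hs_operators K lam e" and k_pos: "k > 0"
    and lipschitz: "\<And>x y. norm (f x - f y) + hs_norm K lam e (\<lambda>v. m x v - m y v) \<le> k * norm (x - y)"
    and \<tau>_pos: "\<tau> > 0"
    and \<xi>: "L2_random_variable M (F 0) \<xi>" and \<eta>: "L2_random_variable M (F 0) \<eta>"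
    and X: "mild_solution M F K lam e W T DA A C f m \<tau> \<xi> X"
    and Y: "mild_solution M F K lam e W T DA A C f m \<tau> \<eta> Y"
begin

lemma f_lipschitz: "norm (f x - f y) \<le> k * norm (x - y)"
proof -
  have "hs_norm K lam e (\<lambda>v. m x v - m y v) \<ge> 0"
    unfolding hs_norm_def by (intro real_sqrt_ge_zero infsum_nonneg) simp
  then show ?thesis using lipschitz[of x y] by simp
qed

lemma m_summable: "(\<lambda>k. (norm (sqrt (lam k) *\<^sub>R m x (e k)))\<^sup>2) summable_on K"
  using m_hs[of x] by (simp add: hs_operators_def)

lemma hs2_m_le: "hs2 K lam e (\<lambda>v. m x v - m y v) \<le> ennreal (k\<^sup>2) * nsq (x - y)"
proof -
  have "hs2 K lam e (\<lambda>v. m x v - m y v) = ennreal ((hs_norm K lam e (\<lambda>v. m x v - m y v))\<^sup>2)"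
    by (intro hs2_eq_hs_norm summable_norm_sq_diff m_summable)
  also have "\<dots> \<le> ennreal ((k * norm (x - y))\<^sup>2)"
  proof (intro ennreal_leI power_mono)
    show "hs_norm K lam e (\<lambda>v. m x v - m y v) \<le> k * norm (x - y)"
      using lipschitz[of x y] norm_ge_zero[of "f x - f y"] by linarith
    show "0 \<le> hs_norm K lam e (\<lambda>v. m x v - m y v)"
      unfolding hs_norm_def by (intro real_sqrt_ge_zero infsum_nonneg) simp
  qed
  finally show ?thesis by (simp add: power_mult_distrib ennreal_mult')
qed

lemma f_measurable [measurable]: "f \<in> borel_measurable borel"
proof (rule borel_measurable_continuous_onI)
  have "k-lipschitz_on UNIV f"
    using f_lipschitz k_pos by (intro lipschitz_onI) (auto simp: dist_norm)
  then show "continuous_on UNIV f" by (rule lipschitz_on_continuous_on)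
qed

text \<open>A single term of the Hilbert-Schmidt series is dominated by the whole series, so the coordinates
  of \<open>m\<close> inherit its Lipschitz condition.\<close>

lemma m_measurable:
  assumes i: "i \<in> K"
  shows "(\<lambda>x. sqrt (lam i) *\<^sub>R m x (e i)) \<in> borel_measurable borel"
proof (rule borel_measurable_continuous_onI)
  have "norm (sqrt (lam i) *\<^sub>R m x (e i) - sqrt (lam i) *\<^sub>R m y (e i)) \<le> k * norm (x - y)" for x y
  proof -
    let ?d = "norm (sqrt (lam i) *\<^sub>R m x (e i) - sqrt (lam i) *\<^sub>R m y (e i))"
    have "ennreal (?d\<^sup>2) = (\<Sum>j\<in>{i}. if j \<in> K then nsq (sqrt (lam j) *\<^sub>R (m x (e j) - m y (e j))) else 0)"
      using i by (simp add: scaleR_diff_right)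
    also have "\<dots> \<le> hs2 K lam e (\<lambda>v. m x v - m y v)"
      unfolding hs2_def by (intro sum_le_suminf) auto
    also have "\<dots> \<le> ennreal ((k * norm (x - y))\<^sup>2)"
      using hs2_m_le[of x y] by (simp add: power_mult_distrib ennreal_mult')
    finally have "?d\<^sup>2 \<le> (k * norm (x - y))\<^sup>2"
      by (subst (asm) ennreal_le_iff) auto
    then show ?thesis by (rule power2_le_imp_le) (use k_pos in simp)
  qed
  then have "k-lipschitz_on UNIV (\<lambda>x. sqrt (lam i) *\<^sub>R m x (e i))"
    using k_pos by (intro lipschitz_onI) (auto simp: dist_norm)
  then show "continuous_on UNIV (\<lambda>x. sqrt (lam i) *\<^sub>R m x (e i))" by (rule lipschitz_on_continuous_on)
qed

text \<open>The processes are measurable as functions on \<open>[0, \<tau>] \<times> \<Omega>\<close>; freezing them outside that interval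
  makes them measurable on the whole line.\<close>

definition clamp_time :: "real \<Rightarrow> real" where
  "clamp_time t = max 0 (min \<tau> t)"

lemma clamp_time_eq: "t \<in> {0..\<tau>} \<Longrightarrow> clamp_time t = t"
  and clamp_time_mem: "clamp_time t \<in> {0..\<tau>}"
  using \<tau>_pos by (auto simp: clamp_time_def)

lemma clamped_measurable:
  fixes V :: "real \<Rightarrow> 'w \<Rightarrow> 'h"
  assumes "(\<lambda>(t, \<omega>). V t \<omega>) \<in> borel_measurable (restrict_space lborel {0..\<tau>} \<Otimes>\<^sub>M M)"
  shows "(\<lambda>(t, \<omega>). V (clamp_time t) \<omega>) \<in> borel_measurable (lborel \<Otimes>\<^sub>M M)"
proof -
  have "clamp_time \<in> borel_measurable lborel" unfolding clamp_time_def[abs_def] by measurable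
  then have "clamp_time \<in> lborel \<rightarrow>\<^sub>M restrict_space lborel {0..\<tau>}"
    using clamp_time_mem by (intro measurable_restrict_space2) auto
  then have "(\<lambda>z. (clamp_time (fst z), snd z)) \<in> lborel \<Otimes>\<^sub>M M \<rightarrow>\<^sub>M restrict_space lborel {0..\<tau>} \<Otimes>\<^sub>M M"
    by measurable
  from measurable_compose[OF this assms] show ?thesis by (simp add: split_beta')
qed

definition observe :: "(real \<Rightarrow> 'w \<Rightarrow> 'h) \<Rightarrow> real \<Rightarrow> 'w \<Rightarrow> 'h" where
  "observe V t \<omega> = yosida_extension DA A C (V (clamp_time t) \<omega>)"

abbreviation solves :: "('w \<Rightarrow> 'h) \<Rightarrow> (real \<Rightarrow> 'w \<Rightarrow> 'h) \<Rightarrow> bool" where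
  "solves \<equiv> mild_solution M F K lam e W T DA A C f m \<tau>"

definition gap :: "real \<Rightarrow> 'w \<Rightarrow> 'h" where "gap t \<omega> = X (clamp_time t) \<omega> - Y (clamp_time t) \<omega>"
definition init_gap :: "'w \<Rightarrow> 'h" where "init_gap \<omega> = \<xi> \<omega> - \<eta> \<omega>"
definition output_gap :: "real \<Rightarrow> 'w \<Rightarrow> 'h" where "output_gap t \<omega> = observe X t \<omega> - observe Y t \<omega>"
definition drift_gap :: "real \<Rightarrow> 'w \<Rightarrow> 'h" where "drift_gap t \<omega> = f (observe X t \<omega>) - f (observe Y t \<omega>)"
definition diffusion_gap :: "real \<Rightarrow> 'w \<Rightarrow> 'v \<Rightarrow> 'h" where "diffusion_gap t \<omega> v = m (X (clamp_time t) \<omega>) v - m (Y (clamp_time t) \<omega>) v"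

text \<open>The part of the difference of the solutions that neither the initial values nor the drift
  explain.  At each time it is almost surely the difference of the two stochastic convolutions.
  Those are given separately for each time, whereas this expression is jointly measurable in time
  and chance.\<close>

definition noise :: "real \<Rightarrow> 'w \<Rightarrow> 'h" where "noise t \<omega> = gap t \<omega> - T (max 0 t) (init_gap \<omega>) - conv (\<lambda>s. drift_gap s \<omega>) t"

lemma solution_measurable:
  "solves x V \<Longrightarrow> (\<lambda>(t, \<omega>). V (clamp_time t) \<omega>) \<in> borel_measurable (lborel \<Otimes>\<^sub>M M)"
  by (intro clamped_measurable) (auto simp: mild_solution_def process_space_def)

lemma observe_measurable:
  "solves x V \<Longrightarrow> (\<lambda>(t, \<omega>). observe V t \<omega>) \<in> borel_measurable (lborel \<Otimes>\<^sub>M M)"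
  unfolding observe_def
  by (intro clamped_measurable[of "\<lambda>t \<omega>. yosida_extension DA A C (V t \<omega>)"]) (auto simp: mild_solution_def)

lemmas [measurable] = solution_measurable[OF X] solution_measurable[OF Y]
  observe_measurable[OF X] observe_measurable[OF Y]

lemma gap_meas [measurable]: "(\<lambda>(t, \<omega>). gap t \<omega>) \<in> borel_measurable (lborel \<Otimes>\<^sub>M M)"
  unfolding gap_def by measurable

lemma init_gap_meas [measurable]: "init_gap \<in> borel_measurable M"
proof -
  have "\<xi> \<in> borel_measurable M" "\<eta> \<in> borel_measurable M"
    using measurable_F[OF order_refl] \<xi> \<eta> unfolding L2_random_variable_def by blast+
  then show ?thesis unfolding init_gap_def[abs_def] by (rule borel_measurable_diff)
qed

lemma output_gap_meas [measurable]: "(\<lambda>(t, \<omega>). output_gap t \<omega>) \<in> borel_measurable (lborel \<Otimes>\<^sub>M M)"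
  unfolding output_gap_def by measurable

lemma drift_gap_meas [measurable]: "(\<lambda>(t, \<omega>). drift_gap t \<omega>) \<in> borel_measurable (lborel \<Otimes>\<^sub>M M)"
  unfolding drift_gap_def by measurable

lemma diffusion_gap_meas: "i \<in> K \<Longrightarrow> (\<lambda>(t, \<omega>). sqrt (lam i) *\<^sub>R diffusion_gap t \<omega> (e i)) \<in> borel_measurable (lborel \<Otimes>\<^sub>M M)"
proof -
  assume i: "i \<in> K"
  have "(\<lambda>(t, \<omega>). sqrt (lam i) *\<^sub>R m (X (clamp_time t) \<omega>) (e i)) \<in> borel_measurable (lborel \<Otimes>\<^sub>M M)"
    "(\<lambda>(t, \<omega>). sqrt (lam i) *\<^sub>R m (Y (clamp_time t) \<omega>) (e i)) \<in> borel_measurable (lborel \<Otimes>\<^sub>M M)"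
    using measurable_compose[OF solution_measurable[OF X] m_measurable[OF i]] measurable_compose[OF solution_measurable[OF Y] m_measurable[OF i]]
    by (simp_all add: split_beta')
  then show ?thesis
    using borel_measurable_diff unfolding diffusion_gap_def scaleR_diff_right split_beta' by blast
qed

lemma noise_meas [measurable]: "(\<lambda>(t, \<omega>). noise t \<omega>) \<in> borel_measurable (lborel \<Otimes>\<^sub>M M)"
proof -
  have "(\<lambda>z. conv (\<lambda>s. drift_gap s (snd z)) (fst z)) \<in> borel_measurable (lborel \<Otimes>\<^sub>M M)"
    using conv_measurable[OF drift_gap_meas] by (simp add: split_beta')
  moreover have "(\<lambda>z. gap (fst z) (snd z) - T (max 0 (fst z)) (init_gap (snd z))) \<in> borel_measurable (lborel \<Otimes>\<^sub>M M)"
    by measurable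
  ultimately show ?thesis
    unfolding noise_def split_beta' by (rule borel_measurable_diff[rotated])
qed

lemma path_measurable:
  assumes "(\<lambda>(t, \<omega>). (V t \<omega> :: 'b::topological_space)) \<in> borel_measurable (lborel \<Otimes>\<^sub>M M)" "\<omega> \<in> space M"
  shows "(\<lambda>t. V t \<omega>) \<in> borel_measurable borel"
  using measurable_compose[OF measurable_Pair2'[OF assms(2)] assms(1)] by simp

lemma drift_gap_le: "norm (drift_gap t \<omega>) \<le> k * norm (output_gap t \<omega>)"
  unfolding drift_gap_def output_gap_def by (rule f_lipschitz)

lemma hs2_diffusion_gap_le: "hs2 K lam e (diffusion_gap s \<omega>) \<le> ennreal (k\<^sup>2) * nsq (gap s \<omega>)"
  using hs2_m_le unfolding diffusion_gap_def[abs_def] gap_def by simp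

lemma time_prob_embed: "(\<lambda>z. z) \<in> time_prob t \<rightarrow>\<^sub>M lborel \<Otimes>\<^sub>M M"
proof -
  have "(\<lambda>z. fst z) \<in> time_prob t \<rightarrow>\<^sub>M lborel"
    by (rule measurable_compose[OF measurable_fst]) (intro measurable_restrict_space1, simp)
  then have "(\<lambda>z. (fst z, snd z)) \<in> time_prob t \<rightarrow>\<^sub>M lborel \<Otimes>\<^sub>M M"
    by (intro measurable_Pair) auto
  then show ?thesis by simp
qed

lemma nn_integral_time_prob:
  assumes [measurable]: "h \<in> borel_measurable (lborel \<Otimes>\<^sub>M M)"
  shows "(\<integral>\<^sup>+z. h z \<partial>time_prob t) = (\<integral>\<^sup>+\<omega>. (\<integral>\<^sup>+s\<in>{0..t}. h (s, \<omega>) \<partial>lborel) \<partial>M)"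
proof -
  interpret S: sigma_finite_measure "restrict_space lborel {0..t}"
    by (rule sigma_finite_measure_restrict_space) (auto intro: lborel.sigma_finite_measure_axioms)
  interpret P: pair_sigma_finite "restrict_space lborel {0..t}" M ..
  have "h \<in> borel_measurable (time_prob t)"
    using measurable_compose[OF time_prob_embed assms] by simp
  then have "(\<integral>\<^sup>+z. h z \<partial>time_prob t) = (\<integral>\<^sup>+\<omega>. (\<integral>\<^sup>+s. h (s, \<omega>) \<partial>restrict_space lborel {0..t}) \<partial>M)"
    by (rule P.nn_integral_snd[symmetric])
  then show ?thesis by (simp add: nn_integral_restrict_space)
qed

text \<open>A square integrable output has, by the Lipschitz condition, an integrable drift.  Hence the two
  drift integrals in the mild equations are genuine integrals and can be subtracted.\<close>

lemma nonlinearity_integrable: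
  assumes \<omega>: "\<omega> \<in> space M" and t: "t \<in> {0..\<tau>}"
    and V: "(\<lambda>(t, \<omega>). V t \<omega>) \<in> borel_measurable (lborel \<Otimes>\<^sub>M M)"
    and fin: "(\<integral>\<^sup>+s\<in>{0..\<tau>}. nsq (V s \<omega> :: 'h) \<partial>lborel) < \<infinity>"
  shows "integrable lborel (\<lambda>s. indicator {0..t} s *\<^sub>R T (max 0 (t - s)) (f (V s \<omega>)))"
proof (rule integrableI_bounded)
  have [measurable]: "(\<lambda>s. V s \<omega>) \<in> borel_measurable borel" using V \<omega> by (rule path_measurable)
  show "(\<lambda>s. indicator {0..t} s *\<^sub>R T (max 0 (t - s)) (f (V s \<omega>))) \<in> borel_measurable lborel" by measurable
  obtain B where B: "B \<ge> 1" "\<And>s. s \<in> {0..\<tau>} \<Longrightarrow> norm (T s) \<le> B"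
    using bounded_on_interval by blast
  let ?a = "B * (norm (f 0) + k)"
  have "(\<integral>\<^sup>+s. ennreal (norm (indicator {0..t} s *\<^sub>R T (max 0 (t - s)) (f (V s \<omega>)))) \<partial>lborel)
      \<le> (\<integral>\<^sup>+s. ennreal ?a * indicator {0..\<tau>} s + ennreal (B * k) * (nsq (V s \<omega>) * indicator {0..\<tau>} s) \<partial>lborel)"
  proof (intro nn_integral_mono)
    fix s
    show "ennreal (norm (indicator {0..t} s *\<^sub>R T (max 0 (t - s)) (f (V s \<omega>))))
        \<le> ennreal ?a * indicator {0..\<tau>} s + ennreal (B * k) * (nsq (V s \<omega>) * indicator {0..\<tau>} s)"
    proof (cases "s \<in> {0..t}")
      case True
      have "norm (f (V s \<omega>)) \<le> norm (f 0) + k * norm (V s \<omega>)"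
        using f_lipschitz[of "V s \<omega>" 0] norm_triangle_ineq2[of "f (V s \<omega>)" "f 0"] by simp
      also have "\<dots> \<le> norm (f 0) + k * (1 + (norm (V s \<omega>))\<^sup>2)"
      proof -
        have "norm (V s \<omega>) \<le> 1 + (norm (V s \<omega>))\<^sup>2"
          using sum_squares_bound[of "norm (V s \<omega>)" 1] by (simp add: power2_eq_square)
             (smt (verit) norm_ge_zero)
        then show ?thesis using k_pos by (intro add_left_mono mult_left_mono) auto
      qed
      finally have fV: "norm (f (V s \<omega>)) \<le> norm (f 0) + k * (1 + (norm (V s \<omega>))\<^sup>2)" .
      have "norm (T (max 0 (t - s)) (f (V s \<omega>))) \<le> norm (T (max 0 (t - s))) * norm (f (V s \<omega>))"
        by (rule norm_blinfun)
      also have "\<dots> \<le> B * (norm (f 0) + k * (1 + (norm (V s \<omega>))\<^sup>2))"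
        using True t B(1) by (intro mult_mono B(2) fV) auto
      also have "\<dots> = ?a + B * k * (norm (V s \<omega>))\<^sup>2" by (simp add: algebra_simps)
      finally have "ennreal (norm (T (max 0 (t - s)) (f (V s \<omega>)))) \<le> ennreal (?a + B * k * (norm (V s \<omega>))\<^sup>2)"
        by (rule ennreal_leI)
      also have "\<dots> = ennreal ?a + ennreal (B * k) * nsq (V s \<omega>)"
        using B(1) k_pos by (simp add: ennreal_plus ennreal_mult)
      finally show ?thesis using True t by simp
    qed simp
  qed
  also have "\<dots> = ennreal ?a * ennreal \<tau> + ennreal (B * k) * (\<integral>\<^sup>+s\<in>{0..\<tau>}. nsq (V s \<omega>) \<partial>lborel)"
    using \<tau>_pos by (simp add: nn_integral_add nn_integral_cmult)
  also have "\<dots> < \<infinity>" using fin by (simp add: ennreal_mult_less_top)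
  finally show "(\<integral>\<^sup>+s. ennreal (norm (indicator {0..t} s *\<^sub>R T (max 0 (t - s)) (f (V s \<omega>)))) \<partial>lborel) < \<infinity>" .
qed

lemma observe_finite:
  assumes "solves x V"
  shows "AE \<omega> in M. (\<integral>\<^sup>+s\<in>{0..\<tau>}. nsq (observe V s \<omega>) \<partial>lborel) < \<infinity>"
proof -
  have "AE \<omega> in M. (\<integral>\<^sup>+s\<in>{0..\<tau>}. nsq (yosida_extension DA A C (V s \<omega>)) \<partial>lborel) < \<infinity>"
    using assms by (auto simp: mild_solution_def)
  moreover have "(\<integral>\<^sup>+s\<in>{0..\<tau>}. nsq (yosida_extension DA A C (V s \<omega>)) \<partial>lborel)
      = (\<integral>\<^sup>+s\<in>{0..\<tau>}. nsq (observe V s \<omega>) \<partial>lborel)" for \<omega>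
    by (intro nn_integral_cong) (auto simp: observe_def clamp_time_eq indicator_def)
  ultimately show ?thesis by simp
qed

text \<open>For fixed \<open>t\<close> the noise is the difference of two stochastic integrals, to which the second moment
  bound applies.\<close>

lemma noise_bound:
  fixes L :: "'h \<Rightarrow>\<^sub>L 'h"
  assumes t: "t \<in> {0..\<tau>}"
  shows "(\<integral>\<^sup>+\<omega>. nsq (L (noise t \<omega>)) \<partial>M)
    \<le> 4 * (\<integral>\<^sup>+\<omega>. (\<integral>\<^sup>+s\<in>{0..t}. hs2 K lam e (\<lambda>v. L (T (max 0 (t - s)) (diffusion_gap s \<omega> v))) \<partial>lborel) \<partial>M)"
proof -
  have t0: "0 \<le> t" using t by simp
  obtain I where I: "has_stochastic_integral M F K lam e W (\<lambda>s \<omega> v. T (t - s) (m (X s \<omega>) v)) t I"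
    "AE \<omega> in M. X t \<omega> = T t (\<xi> \<omega>) + (LINT s:{0..t}|lborel. T (t - s) (f (yosida_extension DA A C (X s \<omega>)))) + I \<omega>"
    using X t unfolding mild_solution_def by blast
  obtain J where J: "has_stochastic_integral M F K lam e W (\<lambda>s \<omega> v. T (t - s) (m (Y s \<omega>) v)) t J"
    "AE \<omega> in M. Y t \<omega> = T t (\<eta> \<omega>) + (LINT s:{0..t}|lborel. T (t - s) (f (yosida_extension DA A C (Y s \<omega>)))) + J \<omega>"
    using Y t unfolding mild_solution_def by blast
  have drift: "(LINT s:{0..t}|lborel. T (t - s) (f (yosida_extension DA A C (X s \<omega>)))) = (\<integral>s. indicator {0..t} s *\<^sub>R T (max 0 (t - s)) (f (observe X s \<omega>)) \<partial>lborel)"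
    "(LINT s:{0..t}|lborel. T (t - s) (f (yosida_extension DA A C (Y s \<omega>)))) = (\<integral>s. indicator {0..t} s *\<^sub>R T (max 0 (t - s)) (f (observe Y s \<omega>)) \<partial>lborel)" for \<omega>
    unfolding set_lebesgue_integral_def observe_def using t
    by (auto intro!: Bochner_Integration.integral_cong simp: indicator_def clamp_time_eq)
  have "AE \<omega> in M. noise t \<omega> = I \<omega> - J \<omega>"
    using AE_space I(2) J(2) observe_finite[OF X] observe_finite[OF Y]
  proof eventually_elim
    case (elim \<omega>)
    have "conv (\<lambda>s. drift_gap s \<omega>) t = (\<integral>s. indicator {0..t} s *\<^sub>R T (max 0 (t - s)) (f (observe X s \<omega>)) - indicator {0..t} s *\<^sub>R T (max 0 (t - s)) (f (observe Y s \<omega>)) \<partial>lborel)"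
      unfolding conv_def drift_gap_def by (intro Bochner_Integration.integral_cong) (auto simp: blinfun.diff_right scaleR_diff_right)
    also have "\<dots> = (\<integral>s. indicator {0..t} s *\<^sub>R T (max 0 (t - s)) (f (observe X s \<omega>)) \<partial>lborel) - (\<integral>s. indicator {0..t} s *\<^sub>R T (max 0 (t - s)) (f (observe Y s \<omega>)) \<partial>lborel)"
      using elim t by (intro Bochner_Integration.integral_diff nonlinearity_integrable observe_measurable[OF X] observe_measurable[OF Y]) auto
    finally show ?case
      using elim t t0 by (simp add: noise_def gap_def init_gap_def drift clamp_time_eq blinfun.diff_right)
  qed
  then have "(\<integral>\<^sup>+\<omega>. nsq (L (noise t \<omega>)) \<partial>M) = (\<integral>\<^sup>+\<omega>. nsq (L (I \<omega> - J \<omega>)) \<partial>M)"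
    by (intro nn_integral_cong_AE) auto
  also have "\<dots> \<le> 4 * (\<integral>\<^sup>+(s, \<omega>). hs2 K lam e (\<lambda>v. L (T (t - s) (m (X s \<omega>) v) - T (t - s) (m (Y s \<omega>) v))) \<partial>time_prob t)"
    by (rule stochastic_integral_diff_bound[OF I(1) J(1) t0])
  also have "(\<integral>\<^sup>+(s, \<omega>). hs2 K lam e (\<lambda>v. L (T (t - s) (m (X s \<omega>) v) - T (t - s) (m (Y s \<omega>) v))) \<partial>time_prob t)
      = (\<integral>\<^sup>+z. hs2 K lam e (\<lambda>v. L (T (max 0 (t - fst z)) (diffusion_gap (fst z) (snd z) v))) \<partial>time_prob t)"
    using t by (intro nn_integral_cong)
      (auto simp: space_pair_measure diffusion_gap_def clamp_time_eq blinfun.diff_right)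
  also have "\<dots> = (\<integral>\<^sup>+\<omega>. (\<integral>\<^sup>+s\<in>{0..t}. hs2 K lam e (\<lambda>v. L (T (max 0 (t - s)) (diffusion_gap s \<omega> v))) \<partial>lborel) \<partial>M)"
  proof (subst nn_integral_time_prob)
    have [measurable]: "blinfun_apply L \<in> borel_measurable borel"
      by (intro borel_measurable_continuous_onI continuous_intros)
    show "(\<lambda>z. hs2 K lam e (\<lambda>v. L (T (max 0 (t - fst z)) (diffusion_gap (fst z) (snd z) v)))) \<in> borel_measurable (lborel \<Otimes>\<^sub>M M)"
    proof (rule hs2_measurable)
      fix i assume "i \<in> K"
      note [measurable] = diffusion_gap_meas[OF this, unfolded split_beta']
      show "(\<lambda>z. sqrt (lam i) *\<^sub>R L (T (max 0 (t - fst z)) (diffusion_gap (fst z) (snd z) (e i)))) \<in> borel_measurable (lborel \<Otimes>\<^sub>M M)"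
        unfolding blinfun.scaleR_right[symmetric] by measurable
    qed
  qed simp
  finally show ?thesis .
qed

definition gap_energy :: "real \<Rightarrow> ennreal" where "gap_energy t = (\<integral>\<^sup>+\<omega>. nsq (gap t \<omega>) \<partial>M)"
definition init_energy :: ennreal where "init_energy = (\<integral>\<^sup>+\<omega>. nsq (init_gap \<omega>) \<partial>M)"

lemma pair_sigma_finite_time: "pair_sigma_finite lborel M"
  by (intro pair_sigma_finite.intro lborel.sigma_finite_measure_axioms sigma_finite_measure_axioms)

lemma fubini_interval:
  fixes h :: "real \<Rightarrow> 'w \<Rightarrow> ennreal"
  assumes [measurable]: "(\<lambda>(t, \<omega>). h t \<omega>) \<in> borel_measurable (lborel \<Otimes>\<^sub>M M)"
  shows "(\<integral>\<^sup>+\<omega>. (\<integral>\<^sup>+t\<in>{0..\<theta>}. h t \<omega> \<partial>lborel) \<partial>M) = (\<integral>\<^sup>+t\<in>{0..\<theta>}. (\<integral>\<^sup>+\<omega>. h t \<omega> \<partial>M) \<partial>lborel)"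
proof -
  have ind [measurable]: "(\<lambda>(t, \<omega>). h t \<omega> * indicator {0..\<theta>} t) \<in> borel_measurable (lborel \<Otimes>\<^sub>M M)"
    by measurable
  have "(\<integral>\<^sup>+\<omega>. (\<integral>\<^sup>+t\<in>{0..\<theta>}. h t \<omega> \<partial>lborel) \<partial>M) = (\<integral>\<^sup>+t. (\<integral>\<^sup>+\<omega>. h t \<omega> * indicator {0..\<theta>} t \<partial>M) \<partial>lborel)"
    using pair_sigma_finite.Fubini'[OF pair_sigma_finite_time ind] by simp
  also have "\<dots> = (\<integral>\<^sup>+t\<in>{0..\<theta>}. (\<integral>\<^sup>+\<omega>. h t \<omega> \<partial>M) \<partial>lborel)"
  proof (intro nn_integral_cong nn_integral_multc)
    fix t :: real
    show "(\<lambda>\<omega>. h t \<omega>) \<in> borel_measurable M"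
      using measurable_compose[OF measurable_Pair1'[of t lborel M] assms] by simp
  qed
  finally show ?thesis .
qed

lemma gap_energy_measurable [measurable]: "gap_energy \<in> borel_measurable borel"
proof -
  have "(\<lambda>(t, \<omega>). nsq (gap t \<omega>)) \<in> borel_measurable (lborel \<Otimes>\<^sub>M M)" by measurable
  then have "(\<lambda>t. \<integral>\<^sup>+\<omega>. nsq (gap t \<omega>) \<partial>M) \<in> borel_measurable lborel"
    by (rule borel_measurable_nn_integral)
  then show ?thesis by (simp add: gap_energy_def[abs_def])
qed

lemma output_gap_finite: "AE \<omega> in M. (\<integral>\<^sup>+s\<in>{0..\<tau>}. nsq (output_gap s \<omega>) \<partial>lborel) < \<infinity>"
  using AE_space observe_finite[OF X] observe_finite[OF Y]
proof eventually_elim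
  case (elim \<omega>)
  have [measurable]: "(\<lambda>s. observe X s \<omega>) \<in> borel_measurable borel" "(\<lambda>s. observe Y s \<omega>) \<in> borel_measurable borel"
    using elim observe_measurable[OF X] observe_measurable[OF Y] by (auto intro: path_measurable)
  have "(\<integral>\<^sup>+s\<in>{0..\<tau>}. nsq (output_gap s \<omega>) \<partial>lborel)
      \<le> (\<integral>\<^sup>+s. 2 * (nsq (observe X s \<omega>) * indicator {0..\<tau>} s) + 2 * (nsq (observe Y s \<omega>) * indicator {0..\<tau>} s) \<partial>lborel)"
    by (intro nn_integral_mono) (use ennreal_norm_diff_sq_le in \<open>auto simp: indicator_def output_gap_def\<close>)
  also have "\<dots> = 2 * (\<integral>\<^sup>+s\<in>{0..\<tau>}. nsq (observe X s \<omega>) \<partial>lborel) + 2 * (\<integral>\<^sup>+s\<in>{0..\<tau>}. nsq (observe Y s \<omega>) \<partial>lborel)"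
    by (simp add: nn_integral_add nn_integral_cmult)
  also have "\<dots> < \<infinity>" using elim by (simp add: ennreal_mult_less_top)
  finally show ?case .
qed

lemma output_path_bound:
  fixes L :: "nat \<Rightarrow> 'h \<Rightarrow>\<^sub>L 'h"
  assumes adm: "\<And>n x. (\<integral>\<^sup>+t\<in>{0..\<tau>}. nsq (L n (T t x)) \<partial>lborel) \<le> ennreal (\<gamma> * (norm x)\<^sup>2)"
    and \<gamma>: "\<gamma> \<ge> 0"
    and L_lim: "\<And>x. x \<in> yosida_domain DA A C \<Longrightarrow> (\<lambda>n. L n x) \<longlonglongrightarrow> yosida_extension DA A C x"
    and \<theta>: "\<theta> \<in> {0..\<tau>}" and \<mu>: "\<mu> = 3 * \<gamma> * k\<^sup>2 + 1"
  shows "AE \<omega> in M. (\<integral>\<^sup>+t\<in>{0..\<theta>}. nsq (output_gap t \<omega>) \<partial>lborel)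
    \<le> ennreal (6 * exp (2 * \<mu> * \<tau>)) * (ennreal \<gamma> * nsq (init_gap \<omega>)
        + liminf (\<lambda>n. \<integral>\<^sup>+t\<in>{0..\<theta>}. nsq (L n (noise t \<omega>)) \<partial>lborel))"
proof -
  have dom: "AE \<omega> in M. AE t in lborel. t \<in> {0..\<tau>} \<longrightarrow> X t \<omega> \<in> yosida_domain DA A C"
    "AE \<omega> in M. AE t in lborel. t \<in> {0..\<tau>} \<longrightarrow> Y t \<omega> \<in> yosida_domain DA A C"
    using X Y unfolding mild_solution_def by blast+
  from AE_space output_gap_finite dom show ?thesis
  proof eventually_elim
    case (elim \<omega>)
    have "(\<integral>\<^sup>+t\<in>{0..\<theta>}. nsq (output_gap t \<omega>) \<partial>lborel)
      \<le> ennreal (6 * exp (2 * \<mu> * \<theta>)) * (ennreal \<gamma> * nsq (init_gap \<omega>)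
        + liminf (\<lambda>n. \<integral>\<^sup>+t\<in>{0..\<theta>}. nsq (L n (noise t \<omega>)) \<partial>lborel))"
    proof (rule observed_output_bound[OF adm \<gamma> _ k_pos _ _ _ _ _ drift_gap_le _ \<mu>])
      show "\<theta> \<le> \<tau>" using \<theta> by simp
      show "(\<lambda>t. drift_gap t \<omega>) \<in> borel_measurable borel" "(\<lambda>t. output_gap t \<omega>) \<in> borel_measurable borel" "(\<lambda>t. noise t \<omega>) \<in> borel_measurable borel"
        using elim(1) by (intro path_measurable drift_gap_meas output_gap_meas noise_meas; assumption)+
      show "AE t in lborel. t \<in> {0..\<theta>} \<longrightarrow> gap t \<omega> = T t (init_gap \<omega>) + conv (\<lambda>t. drift_gap t \<omega>) t + noise t \<omega>"
        by (intro always_eventually allI) (simp add: noise_def)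
      show "AE t in lborel. t \<in> {0..\<theta>} \<longrightarrow> (\<lambda>n. L n (gap t \<omega>)) \<longlonglongrightarrow> output_gap t \<omega>"
        using elim(3,4)
      proof eventually_elim
        case (elim t)
        show ?case
        proof
          assume "t \<in> {0..\<theta>}"
          then have t: "t \<in> {0..\<tau>}" using \<theta> by auto
          have "(\<lambda>n. L n (X t \<omega>) - L n (Y t \<omega>)) \<longlonglongrightarrow> yosida_extension DA A C (X t \<omega>) - yosida_extension DA A C (Y t \<omega>)"
            using elim t by (intro tendsto_diff L_lim) auto
          then show "(\<lambda>n. L n (gap t \<omega>)) \<longlonglongrightarrow> output_gap t \<omega>"
            using t by (simp add: gap_def output_gap_def observe_def clamp_time_eq blinfun.diff_right)
        qed
      qed
      have "(\<integral>\<^sup>+t\<in>{0..\<theta>}. nsq (output_gap t \<omega>) \<partial>lborel) \<le> (\<integral>\<^sup>+t\<in>{0..\<tau>}. nsq (output_gap t \<omega>) \<partial>lborel)"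
        using \<theta> by (intro nn_integral_mono) (auto simp: indicator_def)
      then show "(\<integral>\<^sup>+t\<in>{0..\<theta>}. nsq (output_gap t \<omega>) \<partial>lborel) < \<infinity>"
        using elim(2) by (rule order_le_less_trans)
    qed
    also have "\<dots> \<le> ennreal (6 * exp (2 * \<mu> * \<tau>)) * (ennreal \<gamma> * nsq (init_gap \<omega>)
        + liminf (\<lambda>n. \<integral>\<^sup>+t\<in>{0..\<theta>}. nsq (L n (noise t \<omega>)) \<partial>lborel))"
      using \<theta> \<gamma> by (intro mult_right_mono ennreal_leI) (auto simp: \<mu> intro!: mult_left_mono)
    finally show ?case .
  qed
qed

lemma diffusion_gap_path_measurable:
  assumes "i \<in> K" "\<omega> \<in> space M"
  shows "(\<lambda>s. sqrt (lam i) *\<^sub>R diffusion_gap s \<omega> (e i)) \<in> borel_measurable borel"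
  using diffusion_gap_meas[OF assms(1)] assms(2) by (rule path_measurable)

lemma hs2_diffusion_gap_integral_measurable:
  "(\<lambda>\<omega>. \<integral>\<^sup>+s\<in>{0..\<theta>}. hs2 K lam e (diffusion_gap s \<omega>) \<partial>lborel) \<in> borel_measurable M"
proof -
  have "(\<lambda>z. hs2 K lam e (diffusion_gap (snd z) (fst z))) \<in> borel_measurable (M \<Otimes>\<^sub>M lborel)"
  proof (rule hs2_measurable)
    fix i assume "i \<in> K"
    have "(\<lambda>z. (snd z, fst z)) \<in> M \<Otimes>\<^sub>M lborel \<rightarrow>\<^sub>M lborel \<Otimes>\<^sub>M M" by measurable
    from measurable_compose[OF this diffusion_gap_meas[OF \<open>i \<in> K\<close>]]
    show "(\<lambda>z. sqrt (lam i) *\<^sub>R diffusion_gap (snd z) (fst z) (e i)) \<in> borel_measurable (M \<Otimes>\<^sub>M lborel)" by simp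
  qed
  then show ?thesis
    by (intro lborel.borel_measurable_nn_integral) (simp add: split_beta')
qed

lemma hs2_diffusion_gap_energy:
  "(\<integral>\<^sup>+\<omega>. (\<integral>\<^sup>+s\<in>{0..\<theta>}. hs2 K lam e (diffusion_gap s \<omega>) \<partial>lborel) \<partial>M) \<le> ennreal (k\<^sup>2) * (\<integral>\<^sup>+s\<in>{0..\<theta>}. gap_energy s \<partial>lborel)"
proof -
  have "(\<integral>\<^sup>+\<omega>. (\<integral>\<^sup>+s\<in>{0..\<theta>}. hs2 K lam e (diffusion_gap s \<omega>) \<partial>lborel) \<partial>M)
      \<le> (\<integral>\<^sup>+\<omega>. (\<integral>\<^sup>+s\<in>{0..\<theta>}. ennreal (k\<^sup>2) * nsq (gap s \<omega>) \<partial>lborel) \<partial>M)"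
    by (intro nn_integral_mono mult_right_mono hs2_diffusion_gap_le) simp
  also have "\<dots> = (\<integral>\<^sup>+s\<in>{0..\<theta>}. (\<integral>\<^sup>+\<omega>. ennreal (k\<^sup>2) * nsq (gap s \<omega>) \<partial>M) \<partial>lborel)"
    by (rule fubini_interval) measurable
  also have "\<dots> = (\<integral>\<^sup>+s. ennreal (k\<^sup>2) * (gap_energy s * indicator {0..\<theta>} s) \<partial>lborel)"
  proof (intro nn_integral_cong)
    fix s :: real
    have "(\<lambda>\<omega>. nsq (gap s \<omega>)) \<in> borel_measurable M"
      using measurable_compose[OF measurable_Pair1'[of s lborel M] gap_meas] by simp
    then show "(\<integral>\<^sup>+\<omega>. ennreal (k\<^sup>2) * nsq (gap s \<omega>) \<partial>M) * indicator {0..\<theta>} s = ennreal (k\<^sup>2) * (gap_energy s * indicator {0..\<theta>} s)"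
      by (simp add: nn_integral_cmult gap_energy_def mult.assoc)
  qed
  also have "\<dots> = ennreal (k\<^sup>2) * (\<integral>\<^sup>+s\<in>{0..\<theta>}. gap_energy s \<partial>lborel)"
    by (rule nn_integral_cmult) measurable
  finally show ?thesis .
qed

text \<open>The bound for each fixed \<open>t\<close> is integrated over \<open>t\<close>; after an exchange of integrals the observed
  convolution energy is estimated path by path.\<close>

lemma output_noise_energy:
  fixes L :: "'h \<Rightarrow>\<^sub>L 'h"
  assumes adm: "\<And>x. (\<integral>\<^sup>+t\<in>{0..\<tau>}. nsq (L (T t x)) \<partial>lborel) \<le> ennreal (\<gamma> * (norm x)\<^sup>2)"
    and \<gamma>: "\<gamma> \<ge> 0" and \<theta>: "\<theta> \<in> {0..\<tau>}"
  shows "(\<integral>\<^sup>+\<omega>. (\<integral>\<^sup>+t\<in>{0..\<theta>}. nsq (L (noise t \<omega>)) \<partial>lborel) \<partial>M)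
    \<le> ennreal (4 * \<gamma> * k\<^sup>2) * (\<integral>\<^sup>+s\<in>{0..\<theta>}. gap_energy s \<partial>lborel)"
proof -
  have [measurable]: "blinfun_apply L \<in> borel_measurable borel"
    by (intro borel_measurable_continuous_onI continuous_intros)
  define H where "H t \<omega> = (\<integral>\<^sup>+s\<in>{0..t}. hs2 K lam e (\<lambda>v. L (T (max 0 (t - s)) (diffusion_gap s \<omega> v))) \<partial>lborel)" for t \<omega>
  have H_meas: "(\<lambda>(t, \<omega>). H t \<omega>) \<in> borel_measurable (lborel \<Otimes>\<^sub>M M)"
  proof -
    have hs: "(\<lambda>z. hs2 K lam e (\<lambda>v. L (T (max 0 (fst (fst z) - snd z)) (diffusion_gap (snd z) (snd (fst z)) v)))) \<in> borel_measurable ((lborel \<Otimes>\<^sub>M M) \<Otimes>\<^sub>M lborel)"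
    proof (rule hs2_measurable)
      fix i assume "i \<in> K"
      have "(\<lambda>z. (snd z, snd (fst z))) \<in> (lborel \<Otimes>\<^sub>M M) \<Otimes>\<^sub>M lborel \<rightarrow>\<^sub>M lborel \<Otimes>\<^sub>M M" by measurable
      from measurable_compose[OF this diffusion_gap_meas[OF \<open>i \<in> K\<close>]]
      have [measurable]: "(\<lambda>z. sqrt (lam i) *\<^sub>R diffusion_gap (snd z) (snd (fst z)) (e i)) \<in> borel_measurable ((lborel \<Otimes>\<^sub>M M) \<Otimes>\<^sub>M lborel)"
        by simp
      show "(\<lambda>z. sqrt (lam i) *\<^sub>R L (T (max 0 (fst (fst z) - snd z)) (diffusion_gap (snd z) (snd (fst z)) (e i)))) \<in> borel_measurable ((lborel \<Otimes>\<^sub>M M) \<Otimes>\<^sub>M lborel)"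
        unfolding blinfun.scaleR_right[symmetric] by measurable
    qed
    have "(\<lambda>z. indicator {0..fst (fst z)} (snd z :: real) :: ennreal) \<in> borel_measurable ((lborel \<Otimes>\<^sub>M M) \<Otimes>\<^sub>M lborel)"
      unfolding indicator_def atLeastAtMost_iff of_bool_def by measurable
    from borel_measurable_times_ennreal[OF hs this] show ?thesis
      unfolding H_def split_beta' by (intro lborel.borel_measurable_nn_integral) (simp add: split_beta')
  qed
  have "(\<integral>\<^sup>+\<omega>. (\<integral>\<^sup>+t\<in>{0..\<theta>}. nsq (L (noise t \<omega>)) \<partial>lborel) \<partial>M)
      = (\<integral>\<^sup>+t\<in>{0..\<theta>}. (\<integral>\<^sup>+\<omega>. nsq (L (noise t \<omega>)) \<partial>M) \<partial>lborel)"
    by (rule fubini_interval) measurable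
  also have "\<dots> \<le> (\<integral>\<^sup>+t. 4 * ((\<integral>\<^sup>+\<omega>. H t \<omega> \<partial>M) * indicator {0..\<theta>} t) \<partial>lborel)"
    unfolding H_def by (intro nn_integral_mono) (use noise_bound \<theta> in \<open>auto simp: indicator_def\<close>)
  also have "\<dots> = 4 * (\<integral>\<^sup>+t\<in>{0..\<theta>}. (\<integral>\<^sup>+\<omega>. H t \<omega> \<partial>M) \<partial>lborel)"
    using borel_measurable_nn_integral[OF H_meas] by (intro nn_integral_cmult) simp
  also have "(\<integral>\<^sup>+t\<in>{0..\<theta>}. (\<integral>\<^sup>+\<omega>. H t \<omega> \<partial>M) \<partial>lborel) = (\<integral>\<^sup>+\<omega>. (\<integral>\<^sup>+t\<in>{0..\<theta>}. H t \<omega> \<partial>lborel) \<partial>M)"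
    by (rule fubini_interval[OF H_meas, symmetric])
  also have "4 * \<dots> \<le> 4 * (\<integral>\<^sup>+\<omega>. ennreal \<gamma> * (\<integral>\<^sup>+s\<in>{0..\<theta>}. hs2 K lam e (diffusion_gap s \<omega>) \<partial>lborel) \<partial>M)"
    unfolding H_def using \<theta>
    by (intro mult_left_mono nn_integral_mono observed_hs_convolution_energy[OF adm \<gamma>] diffusion_gap_path_measurable) auto
  also have "(\<integral>\<^sup>+\<omega>. ennreal \<gamma> * (\<integral>\<^sup>+s\<in>{0..\<theta>}. hs2 K lam e (diffusion_gap s \<omega>) \<partial>lborel) \<partial>M)
      = ennreal \<gamma> * (\<integral>\<^sup>+\<omega>. (\<integral>\<^sup>+s\<in>{0..\<theta>}. hs2 K lam e (diffusion_gap s \<omega>) \<partial>lborel) \<partial>M)"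
    by (rule nn_integral_cmult[OF hs2_diffusion_gap_integral_measurable])
  also have "4 * (ennreal \<gamma> * (\<integral>\<^sup>+\<omega>. (\<integral>\<^sup>+s\<in>{0..\<theta>}. hs2 K lam e (diffusion_gap s \<omega>) \<partial>lborel) \<partial>M))
      \<le> 4 * (ennreal \<gamma> * (ennreal (k\<^sup>2) * (\<integral>\<^sup>+s\<in>{0..\<theta>}. gap_energy s \<partial>lborel)))"
    by (intro mult_left_mono hs2_diffusion_gap_energy) auto
  finally show ?thesis using \<gamma> by (simp add: ennreal_mult mult.assoc)
qed

text \<open>Expectation of the pathwise bound, with Fatou's lemma for the lower limit.\<close>

lemma output_energy:
  fixes L :: "nat \<Rightarrow> 'h \<Rightarrow>\<^sub>L 'h"
  assumes adm: "\<And>n x. (\<integral>\<^sup>+t\<in>{0..\<tau>}. nsq (L n (T t x)) \<partial>lborel) \<le> ennreal (\<gamma> * (norm x)\<^sup>2)"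
    and \<gamma>: "\<gamma> \<ge> 0"
    and L_lim: "\<And>x. x \<in> yosida_domain DA A C \<Longrightarrow> (\<lambda>n. L n x) \<longlonglongrightarrow> yosida_extension DA A C x"
    and \<theta>: "\<theta> \<in> {0..\<tau>}" and \<mu>: "\<mu> = 3 * \<gamma> * k\<^sup>2 + 1"
  shows "(\<integral>\<^sup>+\<omega>. (\<integral>\<^sup>+t\<in>{0..\<theta>}. nsq (output_gap t \<omega>) \<partial>lborel) \<partial>M)
    \<le> ennreal (6 * exp (2 * \<mu> * \<tau>)) * (ennreal \<gamma> * init_energy + ennreal (4 * \<gamma> * k\<^sup>2) * (\<integral>\<^sup>+s\<in>{0..\<theta>}. gap_energy s \<partial>lborel))"
proof -
  have [measurable]: "blinfun_apply (L n) \<in> borel_measurable borel" for n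
    by (intro borel_measurable_continuous_onI continuous_intros)
  define R where "R n \<omega> = (\<integral>\<^sup>+t\<in>{0..\<theta>}. nsq (L n (noise t \<omega>)) \<partial>lborel)" for n \<omega>
  have [measurable]: "R n \<in> borel_measurable M" for n
  proof -
    have "(\<lambda>z. (snd z, fst z)) \<in> M \<Otimes>\<^sub>M lborel \<rightarrow>\<^sub>M lborel \<Otimes>\<^sub>M M" by measurable
    from measurable_compose[OF this noise_meas]
    have [measurable]: "(\<lambda>z. noise (snd z) (fst z)) \<in> borel_measurable (M \<Otimes>\<^sub>M lborel)" by simp
    have "(\<lambda>z. nsq (L n (noise (snd z) (fst z))) * indicator {0..\<theta>} (snd z)) \<in> borel_measurable (M \<Otimes>\<^sub>M lborel)"
      by measurable
    then show ?thesis
      unfolding R_def[abs_def] by (intro lborel.borel_measurable_nn_integral) (simp add: split_beta')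
  qed
  let ?k = "ennreal (6 * exp (2 * \<mu> * \<tau>))"
  have "(\<integral>\<^sup>+\<omega>. (\<integral>\<^sup>+t\<in>{0..\<theta>}. nsq (output_gap t \<omega>) \<partial>lborel) \<partial>M)
      \<le> (\<integral>\<^sup>+\<omega>. ?k * (ennreal \<gamma> * nsq (init_gap \<omega>) + liminf (\<lambda>n. R n \<omega>)) \<partial>M)"
    unfolding R_def by (intro nn_integral_mono_AE output_path_bound[OF adm \<gamma> L_lim \<theta> \<mu>])
  also have "\<dots> = ?k * (ennreal \<gamma> * init_energy + (\<integral>\<^sup>+\<omega>. liminf (\<lambda>n. R n \<omega>) \<partial>M))"
    by (simp add: nn_integral_cmult nn_integral_add init_energy_def)
  also have "\<dots> \<le> ?k * (ennreal \<gamma> * init_energy + ennreal (4 * \<gamma> * k\<^sup>2) * (\<integral>\<^sup>+s\<in>{0..\<theta>}. gap_energy s \<partial>lborel))"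
  proof (intro mult_left_mono add_left_mono)
    have "(\<integral>\<^sup>+\<omega>. liminf (\<lambda>n. R n \<omega>) \<partial>M) \<le> liminf (\<lambda>n. \<integral>\<^sup>+\<omega>. R n \<omega> \<partial>M)"
      by (rule nn_integral_liminf) measurable
    also have "\<dots> \<le> ennreal (4 * \<gamma> * k\<^sup>2) * (\<integral>\<^sup>+s\<in>{0..\<theta>}. gap_energy s \<partial>lborel)"
      unfolding R_def by (intro Liminf_le always_eventually allI output_noise_energy[OF adm \<gamma> \<theta>]) simp
    finally show "(\<integral>\<^sup>+\<omega>. liminf (\<lambda>n. R n \<omega>) \<partial>M) \<le> ennreal (4 * \<gamma> * k\<^sup>2) * (\<integral>\<^sup>+s\<in>{0..\<theta>}. gap_energy s \<partial>lborel)" .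
  qed simp_all
  finally show ?thesis .
qed

end

context mild_pair
begin

text \<open>Of the three parts of the difference the initial and the noise part are estimated directly,
  the drift part through the output energy.  The constant \<open>\<kappa>\<close> is the factor
  in \<open>output_energy\<close>.\<close>

lemma gap_energy_integral_inequality:
  fixes L :: "nat \<Rightarrow> 'h \<Rightarrow>\<^sub>L 'h"
  assumes adm: "\<And>n x. (\<integral>\<^sup>+t\<in>{0..\<tau>}. nsq (L n (T t x)) \<partial>lborel) \<le> ennreal (\<gamma> * (norm x)\<^sup>2)"
    and \<gamma>: "\<gamma> \<ge> 0"
    and L_lim: "\<And>x. x \<in> yosida_domain DA A C \<Longrightarrow> (\<lambda>n. L n x) \<longlonglongrightarrow> yosida_extension DA A C x"
    and B: "B \<ge> 1" "\<And>s. s \<in> {0..\<tau>} \<Longrightarrow> norm (T s) \<le> B"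
    and t: "t \<in> {0..\<tau>}"
    and \<kappa>: "\<kappa> = 6 * exp (2 * (3 * \<gamma> * k\<^sup>2 + 1) * \<tau>)"
  shows "gap_energy t \<le> ennreal (3 * B\<^sup>2 * (1 + \<tau> * k\<^sup>2 * \<kappa> * \<gamma>)) * init_energy
    + ennreal (3 * B\<^sup>2 * k\<^sup>2 * (4 * \<tau> * \<kappa> * \<gamma> * k\<^sup>2 + 4)) * (\<integral>\<^sup>+s\<in>{0..t}. gap_energy s \<partial>lborel)"
proof -
  have t0: "0 \<le> t" "t \<le> \<tau>" using t by auto
  have \<kappa>_pos: "\<kappa> > 0" by (simp add: \<kappa>)
  let ?I = "\<integral>\<^sup>+s\<in>{0..t}. gap_energy s \<partial>lborel"
  have slice: "(\<lambda>\<omega>. V t \<omega>) \<in> borel_measurable M" if "(\<lambda>(t, \<omega>). (V t \<omega> :: 'h)) \<in> borel_measurable (lborel \<Otimes>\<^sub>M M)" for V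
    using measurable_compose[OF measurable_Pair1'[of t lborel M] that] by simp
  have [measurable]: "(\<lambda>\<omega>. noise t \<omega>) \<in> borel_measurable M" "(\<lambda>\<omega>. conv (\<lambda>s. drift_gap s \<omega>) t) \<in> borel_measurable M"
    by (intro slice[of noise] slice[of "\<lambda>t \<omega>. conv (\<lambda>s. drift_gap s \<omega>) t"] noise_meas conv_measurable drift_gap_meas)+
  have T_le: "nsq (T (max 0 s) x) \<le> ennreal (B\<^sup>2) * nsq x" if "s \<le> \<tau>" for s x
  proof -
    have "norm (T (max 0 s)) \<le> B" using that \<tau>_pos by (intro B(2)) auto
    then have "nsq (T (max 0 s)) \<le> ennreal (B\<^sup>2)" by (intro ennreal_leI power_mono) auto
    then show ?thesis
      by (rule order_trans[OF ennreal_norm_blinfun_sq_le mult_right_mono]) simp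
  qed
  have initial: "(\<integral>\<^sup>+\<omega>. nsq (T t (init_gap \<omega>)) \<partial>M) \<le> ennreal (B\<^sup>2) * init_energy"
  proof -
    have "(\<integral>\<^sup>+\<omega>. nsq (T t (init_gap \<omega>)) \<partial>M) \<le> (\<integral>\<^sup>+\<omega>. ennreal (B\<^sup>2) * nsq (init_gap \<omega>) \<partial>M)"
      using T_le[of t] t0 by (intro nn_integral_mono) simp
    then show ?thesis by (simp add: nn_integral_cmult init_energy_def)
  qed
  have drift: "(\<integral>\<^sup>+\<omega>. nsq (conv (\<lambda>s. drift_gap s \<omega>) t) \<partial>M)
      \<le> ennreal (\<tau> * B\<^sup>2 * k\<^sup>2) * (ennreal \<kappa> * (ennreal \<gamma> * init_energy + ennreal (4 * \<gamma> * k\<^sup>2) * ?I))"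
  proof -
    have "nsq (conv (\<lambda>s. drift_gap s \<omega>) t) \<le> ennreal (\<tau> * B\<^sup>2 * k\<^sup>2) * (\<integral>\<^sup>+s\<in>{0..t}. nsq (output_gap s \<omega>) \<partial>lborel)"
      if \<omega>: "\<omega> \<in> space M" for \<omega>
    proof -
      have [measurable]: "(\<lambda>s. drift_gap s \<omega>) \<in> borel_measurable borel" "(\<lambda>s. output_gap s \<omega>) \<in> borel_measurable borel"
        using \<omega> by (intro path_measurable drift_gap_meas output_gap_meas; assumption)+
      have "nsq (conv (\<lambda>s. drift_gap s \<omega>) t)
          \<le> (\<integral>\<^sup>+s\<in>{0..t}. ennreal (1\<^sup>2) \<partial>lborel) * (\<integral>\<^sup>+s\<in>{0..t}. nsq (T (max 0 (t - s)) (drift_gap s \<omega>)) \<partial>lborel)"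
        using blinfun_conv_sq_le[of "\<lambda>s. drift_gap s \<omega>" "\<lambda>s. 1" id_blinfun t] by simp
      also have "\<dots> \<le> ennreal \<tau> * (\<integral>\<^sup>+s. ennreal (B\<^sup>2 * k\<^sup>2) * (nsq (output_gap s \<omega>) * indicator {0..t} s) \<partial>lborel)"
      proof (rule mult_mono)
        show "(\<integral>\<^sup>+s\<in>{0..t}. ennreal (1\<^sup>2) \<partial>lborel) \<le> ennreal \<tau>" using t0 by (simp add: ennreal_leI)
        show "(\<integral>\<^sup>+s\<in>{0..t}. nsq (T (max 0 (t - s)) (drift_gap s \<omega>)) \<partial>lborel)
            \<le> (\<integral>\<^sup>+s. ennreal (B\<^sup>2 * k\<^sup>2) * (nsq (output_gap s \<omega>) * indicator {0..t} s) \<partial>lborel)"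
        proof (rule nn_integral_mono)
          fix s
          have "nsq (T (max 0 (t - s)) (drift_gap s \<omega>)) \<le> ennreal (B\<^sup>2 * k\<^sup>2) * nsq (output_gap s \<omega>)" if "s \<in> {0..t}"
          proof -
            have "nsq (T (max 0 (t - s)) (drift_gap s \<omega>)) \<le> ennreal (B\<^sup>2) * nsq (drift_gap s \<omega>)"
              using that t0 by (intro T_le) auto
            also have "\<dots> \<le> ennreal (B\<^sup>2) * ennreal ((k * norm (output_gap s \<omega>))\<^sup>2)"
              using drift_gap_le by (intro mult_left_mono ennreal_leI power_mono) auto
            finally show ?thesis by (simp add: power_mult_distrib ennreal_mult' mult.assoc)
          qed
          then show "nsq (T (max 0 (t - s)) (drift_gap s \<omega>)) * indicator {0..t} s
              \<le> ennreal (B\<^sup>2 * k\<^sup>2) * (nsq (output_gap s \<omega>) * indicator {0..t} s)"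
            by (auto simp: indicator_def)
        qed
      qed auto
      also have "(\<integral>\<^sup>+s. ennreal (B\<^sup>2 * k\<^sup>2) * (nsq (output_gap s \<omega>) * indicator {0..t} s) \<partial>lborel)
          = ennreal (B\<^sup>2 * k\<^sup>2) * (\<integral>\<^sup>+s\<in>{0..t}. nsq (output_gap s \<omega>) \<partial>lborel)"
        by (rule nn_integral_cmult) measurable
      finally show ?thesis using \<tau>_pos by (simp add: ennreal_mult' mult.assoc)
    qed
    then have "(\<integral>\<^sup>+\<omega>. nsq (conv (\<lambda>s. drift_gap s \<omega>) t) \<partial>M)
        \<le> (\<integral>\<^sup>+\<omega>. ennreal (\<tau> * B\<^sup>2 * k\<^sup>2) * (\<integral>\<^sup>+s\<in>{0..t}. nsq (output_gap s \<omega>) \<partial>lborel) \<partial>M)"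
      by (intro nn_integral_mono)
    also have "\<dots> = ennreal (\<tau> * B\<^sup>2 * k\<^sup>2) * (\<integral>\<^sup>+\<omega>. (\<integral>\<^sup>+s\<in>{0..t}. nsq (output_gap s \<omega>) \<partial>lborel) \<partial>M)"
    proof (rule nn_integral_cmult)
      have "(\<lambda>z. (snd z, fst z)) \<in> M \<Otimes>\<^sub>M lborel \<rightarrow>\<^sub>M lborel \<Otimes>\<^sub>M M" by measurable
      from measurable_compose[OF this output_gap_meas]
      have [measurable]: "(\<lambda>z. output_gap (snd z) (fst z)) \<in> borel_measurable (M \<Otimes>\<^sub>M lborel)" by simp
      have "(\<lambda>z. nsq (output_gap (snd z) (fst z)) * indicator {0..t} (snd z)) \<in> borel_measurable (M \<Otimes>\<^sub>M lborel)"
        by measurable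
      then show "(\<lambda>\<omega>. \<integral>\<^sup>+s\<in>{0..t}. nsq (output_gap s \<omega>) \<partial>lborel) \<in> borel_measurable M"
        by (intro lborel.borel_measurable_nn_integral) (simp add: split_beta')
    qed
    also have "\<dots> \<le> ennreal (\<tau> * B\<^sup>2 * k\<^sup>2) * (ennreal \<kappa> * (ennreal \<gamma> * init_energy + ennreal (4 * \<gamma> * k\<^sup>2) * ?I))"
      unfolding \<kappa> by (intro mult_left_mono output_energy[OF adm \<gamma> L_lim t refl]) auto
    finally show ?thesis .
  qed
  have noise: "(\<integral>\<^sup>+\<omega>. nsq (noise t \<omega>) \<partial>M) \<le> 4 * (ennreal (B\<^sup>2) * (ennreal (k\<^sup>2) * ?I))"
  proof -
    have "(\<integral>\<^sup>+\<omega>. nsq (noise t \<omega>) \<partial>M)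
        \<le> 4 * (\<integral>\<^sup>+\<omega>. (\<integral>\<^sup>+s\<in>{0..t}. hs2 K lam e (\<lambda>v. T (max 0 (t - s)) (diffusion_gap s \<omega> v)) \<partial>lborel) \<partial>M)"
      using noise_bound[OF t, of id_blinfun] by simp
    also have "\<dots> \<le> 4 * (\<integral>\<^sup>+\<omega>. ennreal (B\<^sup>2) * (\<integral>\<^sup>+s\<in>{0..t}. hs2 K lam e (diffusion_gap s \<omega>) \<partial>lborel) \<partial>M)"
    proof (intro mult_left_mono nn_integral_mono)
      fix \<omega> assume \<omega>: "\<omega> \<in> space M"
      have "(\<integral>\<^sup>+s\<in>{0..t}. hs2 K lam e (\<lambda>v. T (max 0 (t - s)) (diffusion_gap s \<omega> v)) \<partial>lborel)
          \<le> (\<integral>\<^sup>+s. ennreal (B\<^sup>2) * (hs2 K lam e (diffusion_gap s \<omega>) * indicator {0..t} s) \<partial>lborel)"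
      proof (intro nn_integral_mono)
        fix s
        have "hs2 K lam e (\<lambda>v. T (max 0 (t - s)) (diffusion_gap s \<omega> v)) \<le> ennreal (B\<^sup>2) * hs2 K lam e (diffusion_gap s \<omega>)" if "s \<in> {0..t}"
        proof -
          have "norm (T (max 0 (t - s))) \<le> B" using that t0 by (intro B(2)) auto
          then have "nsq (T (max 0 (t - s))) \<le> ennreal (B\<^sup>2)" by (intro ennreal_leI power_mono) auto
          then show ?thesis by (rule order_trans[OF hs2_blinfun mult_right_mono]) simp
        qed
        then show "hs2 K lam e (\<lambda>v. T (max 0 (t - s)) (diffusion_gap s \<omega> v)) * indicator {0..t} s \<le> ennreal (B\<^sup>2) * (hs2 K lam e (diffusion_gap s \<omega>) * indicator {0..t} s)"
          by (auto simp: indicator_def)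
      qed
      also have "\<dots> = ennreal (B\<^sup>2) * (\<integral>\<^sup>+s\<in>{0..t}. hs2 K lam e (diffusion_gap s \<omega>) \<partial>lborel)"
      proof (rule nn_integral_cmult)
        have [measurable]: "(\<lambda>s. hs2 K lam e (diffusion_gap s \<omega>)) \<in> borel_measurable lborel"
          by (rule hs2_measurable) (use diffusion_gap_path_measurable \<omega> in simp)
        show "(\<lambda>s. hs2 K lam e (diffusion_gap s \<omega>) * indicator {0..t} s) \<in> borel_measurable lborel" by measurable
      qed
      finally show "(\<integral>\<^sup>+s\<in>{0..t}. hs2 K lam e (\<lambda>v. T (max 0 (t - s)) (diffusion_gap s \<omega> v)) \<partial>lborel)
          \<le> ennreal (B\<^sup>2) * (\<integral>\<^sup>+s\<in>{0..t}. hs2 K lam e (diffusion_gap s \<omega>) \<partial>lborel)" .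
    qed simp
    also have "\<dots> = 4 * (ennreal (B\<^sup>2) * (\<integral>\<^sup>+\<omega>. (\<integral>\<^sup>+s\<in>{0..t}. hs2 K lam e (diffusion_gap s \<omega>) \<partial>lborel) \<partial>M))"
      by (subst nn_integral_cmult[OF hs2_diffusion_gap_integral_measurable]) simp
    also have "\<dots> \<le> 4 * (ennreal (B\<^sup>2) * (ennreal (k\<^sup>2) * ?I))"
      by (intro mult_left_mono hs2_diffusion_gap_energy) auto
    finally show ?thesis .
  qed
  have "gap_energy t \<le> (\<integral>\<^sup>+\<omega>. 3 * (nsq (T t (init_gap \<omega>)) + nsq (conv (\<lambda>s. drift_gap s \<omega>) t) + nsq (noise t \<omega>)) \<partial>M)"
    unfolding gap_energy_def
  proof (intro nn_integral_mono)
    fix \<omega>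
    have "gap t \<omega> = T t (init_gap \<omega>) + conv (\<lambda>s. drift_gap s \<omega>) t + noise t \<omega>" using t0 by (simp add: noise_def)
    then show "nsq (gap t \<omega>) \<le> 3 * (nsq (T t (init_gap \<omega>)) + nsq (conv (\<lambda>s. drift_gap s \<omega>) t) + nsq (noise t \<omega>))"
      by (simp only: ennreal_norm_add3_sq_le)
  qed
  also have "\<dots> = 3 * ((\<integral>\<^sup>+\<omega>. nsq (T t (init_gap \<omega>)) \<partial>M) + (\<integral>\<^sup>+\<omega>. nsq (conv (\<lambda>s. drift_gap s \<omega>) t) \<partial>M)
      + (\<integral>\<^sup>+\<omega>. nsq (noise t \<omega>) \<partial>M))"
  proof -
    have [measurable]: "blinfun_apply (T t) \<in> borel_measurable borel"
      by (intro borel_measurable_continuous_onI continuous_intros)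
    show ?thesis by (simp add: nn_integral_cmult nn_integral_add)
  qed
  also have "\<dots> \<le> 3 * (ennreal (B\<^sup>2) * init_energy + ennreal (\<tau> * B\<^sup>2 * k\<^sup>2) * (ennreal \<kappa> * (ennreal \<gamma> * init_energy + ennreal (4 * \<gamma> * k\<^sup>2) * ?I))
      + 4 * (ennreal (B\<^sup>2) * (ennreal (k\<^sup>2) * ?I)))"
    by (intro mult_left_mono add_mono initial drift noise) simp
  also have "\<dots> = ennreal (3 * B\<^sup>2 * (1 + \<tau> * k\<^sup>2 * \<kappa> * \<gamma>)) * init_energy
    + ennreal (3 * B\<^sup>2 * k\<^sup>2 * (4 * \<tau> * \<kappa> * \<gamma> * k\<^sup>2 + 4)) * ?I"
  proof -
    have three: "(3 :: ennreal) = ennreal 3" and four: "(4 :: ennreal) = ennreal 4" by simp_all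
    have e1: "ennreal (3 * B\<^sup>2 * (1 + \<tau> * k\<^sup>2 * \<kappa> * \<gamma>)) = 3 * ennreal (B\<^sup>2) + 3 * (ennreal (\<tau> * B\<^sup>2 * k\<^sup>2) * (ennreal \<kappa> * ennreal \<gamma>))"
      unfolding three using \<tau>_pos \<kappa>_pos \<gamma>
      by (simp add: algebra_simps flip: ennreal_mult ennreal_plus ennreal_numeral)
    have e2: "ennreal (3 * B\<^sup>2 * k\<^sup>2 * (4 * \<tau> * \<kappa> * \<gamma> * k\<^sup>2 + 4))
        = 3 * (ennreal (\<tau> * B\<^sup>2 * k\<^sup>2) * (ennreal \<kappa> * ennreal (4 * \<gamma> * k\<^sup>2))) + 3 * (4 * (ennreal (B\<^sup>2) * ennreal (k\<^sup>2)))"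
      unfolding three four using \<tau>_pos \<kappa>_pos \<gamma>
      by (simp add: algebra_simps flip: ennreal_mult ennreal_plus ennreal_numeral)
    show ?thesis unfolding e1 e2 by (simp add: distrib_left distrib_right mult.assoc add_ac)
  qed
  finally show ?thesis .
qed

text \<open>The mean squares of both solutions are continuous on a compact interval.  Gronwall's lemma needs
  this a priori bound.\<close>

lemma gap_energy_bounded: "\<exists>b. \<forall>t\<in>{0..\<tau>}. gap_energy t \<le> ennreal b"
proof -
  have bound: "\<exists>b\<ge>0. \<forall>t\<in>{0..\<tau>}. (\<integral>\<^sup>+\<omega>. nsq (V t \<omega>) \<partial>M) \<le> ennreal b"
    if V: "V \<in> process_space M F \<tau>" for V :: "real \<Rightarrow> 'w \<Rightarrow> 'h"
  proof -
    have "continuous_on {0..\<tau>} (\<lambda>t. sqrt (\<integral>\<omega>. (norm (V t \<omega>))\<^sup>2 \<partial>M))"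
      using V by (simp add: process_space_def)
    then have "compact ((\<lambda>t. sqrt (\<integral>\<omega>. (norm (V t \<omega>))\<^sup>2 \<partial>M)) ` {0..\<tau>})"
      by (intro compact_continuous_image) auto
    then have "bounded ((\<lambda>t. sqrt (\<integral>\<omega>. (norm (V t \<omega>))\<^sup>2 \<partial>M)) ` {0..\<tau>})"
      by (rule compact_imp_bounded)
    then obtain b where "\<forall>x\<in>(\<lambda>t. sqrt (\<integral>\<omega>. (norm (V t \<omega>))\<^sup>2 \<partial>M)) ` {0..\<tau>}. \<bar>x\<bar> \<le> b"
      unfolding bounded_real ..
    then have b: "\<bar>sqrt (\<integral>\<omega>. (norm (V t \<omega>))\<^sup>2 \<partial>M)\<bar> \<le> b" if "t \<in> {0..\<tau>}" for t
      using that by simp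
    have "(\<integral>\<^sup>+\<omega>. nsq (V t \<omega>) \<partial>M) \<le> ennreal (b\<^sup>2)" if t: "t \<in> {0..\<tau>}" for t
    proof -
      have int: "integrable M (\<lambda>\<omega>. (norm (V t \<omega>))\<^sup>2)"
        using V t by (simp add: process_space_def L2_random_variable_def)
      have "(\<integral>\<^sup>+\<omega>. nsq (V t \<omega>) \<partial>M) = ennreal (\<integral>\<omega>. (norm (V t \<omega>))\<^sup>2 \<partial>M)"
        by (rule nn_integral_eq_integral[OF int]) simp
      also have "(\<integral>\<omega>. (norm (V t \<omega>))\<^sup>2 \<partial>M) = \<bar>sqrt (\<integral>\<omega>. (norm (V t \<omega>))\<^sup>2 \<partial>M)\<bar>\<^sup>2"
        by (simp add: integral_nonneg_AE)
      also have "ennreal \<dots> \<le> ennreal (b\<^sup>2)" using b[OF t] by (intro ennreal_leI power_mono) auto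
      finally show ?thesis .
    qed
    then show ?thesis by (intro exI[of _ "b\<^sup>2"]) auto
  qed
  have XY: "X \<in> process_space M F \<tau>" "Y \<in> process_space M F \<tau>"
    using X Y unfolding mild_solution_def by blast+
  obtain bx where bx: "bx \<ge> 0" "\<And>t. t \<in> {0..\<tau>} \<Longrightarrow> (\<integral>\<^sup>+\<omega>. nsq (X t \<omega>) \<partial>M) \<le> ennreal bx"
    using bound[OF XY(1)] by blast
  obtain bY where bY: "bY \<ge> 0" "\<And>t. t \<in> {0..\<tau>} \<Longrightarrow> (\<integral>\<^sup>+\<omega>. nsq (Y t \<omega>) \<partial>M) \<le> ennreal bY"
    using bound[OF XY(2)] by blast
  have "gap_energy t \<le> ennreal (2 * bx + 2 * bY)" if t: "t \<in> {0..\<tau>}" for t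
  proof -
    have "X t \<in> borel_measurable (F t)" "Y t \<in> borel_measurable (F t)"
      using XY t unfolding process_space_def L2_random_variable_def by blast+
    then have [measurable]: "X t \<in> borel_measurable M" "Y t \<in> borel_measurable M"
      using t by (auto intro: measurable_F[of t])
    have "gap_energy t \<le> (\<integral>\<^sup>+\<omega>. 2 * nsq (X t \<omega>) + 2 * nsq (Y t \<omega>) \<partial>M)"
      unfolding gap_energy_def gap_def clamp_time_eq[OF t] by (intro nn_integral_mono ennreal_norm_diff_sq_le)
    also have "\<dots> = 2 * (\<integral>\<^sup>+\<omega>. nsq (X t \<omega>) \<partial>M) + 2 * (\<integral>\<^sup>+\<omega>. nsq (Y t \<omega>) \<partial>M)"
      by (simp add: nn_integral_add nn_integral_cmult)
    also have "\<dots> \<le> 2 * ennreal bx + 2 * ennreal bY"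
      using t by (intro add_mono mult_left_mono bx bY) auto
    also have "\<dots> = ennreal (2 * bx + 2 * bY)" using bx bY by (simp add: ennreal_mult')
    finally show ?thesis .
  qed
  then show ?thesis by blast
qed

lemma mean_square_estimate:
  fixes L :: "nat \<Rightarrow> 'h \<Rightarrow>\<^sub>L 'h"
  assumes adm: "\<And>n x. (\<integral>\<^sup>+t\<in>{0..\<tau>}. nsq (L n (T t x)) \<partial>lborel) \<le> ennreal (\<gamma> * (norm x)\<^sup>2)"
    and \<gamma>: "\<gamma> \<ge> 0"
    and L_lim: "\<And>x. x \<in> yosida_domain DA A C \<Longrightarrow> (\<lambda>n. L n x) \<longlonglongrightarrow> yosida_extension DA A C x"
    and B: "B \<ge> 1" "\<And>s. s \<in> {0..\<tau>} \<Longrightarrow> norm (T s) \<le> B"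
    and t: "t \<in> {0..\<tau>}"
    and \<kappa>: "\<kappa> = 6 * exp (2 * (3 * \<gamma> * k\<^sup>2 + 1) * \<tau>)"
    and r: "r = 3 * B\<^sup>2 * k\<^sup>2 * (4 * \<tau> * \<kappa> * \<gamma> * k\<^sup>2 + 4)"
  shows "(\<integral>\<omega>. (norm (X t \<omega> - Y t \<omega>))\<^sup>2 \<partial>M)
    \<le> 2 * exp (2 * r * \<tau>) * (3 * B\<^sup>2 * (1 + \<tau> * k\<^sup>2 * \<kappa> * \<gamma>)) * (\<integral>\<omega>. (norm (\<xi> \<omega> - \<eta> \<omega>))\<^sup>2 \<partial>M)"
proof -
  have \<kappa>_pos: "\<kappa> > 0" by (simp add: \<kappa>)
  have r_pos: "r > 0"
    unfolding r using B(1) k_pos \<tau>_pos \<kappa>_pos \<gamma> by (intro mult_pos_pos add_nonneg_pos mult_nonneg_nonneg) auto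
  let ?a = "3 * B\<^sup>2 * (1 + \<tau> * k\<^sup>2 * \<kappa> * \<gamma>)"
  have a: "?a \<ge> 0" using \<tau>_pos \<kappa>_pos \<gamma> by simp
  obtain b where b: "\<And>t. t \<in> {0..\<tau>} \<Longrightarrow> gap_energy t \<le> ennreal b" using gap_energy_bounded by blast
  have "gap_energy t \<le> ennreal (2 * exp (2 * r * \<tau>)) * (ennreal ?a * init_energy)"
    by (rule gronwall_nn_integral[OF gap_energy_measurable r_pos b _ t])
       (use gap_energy_integral_inequality[OF adm \<gamma> L_lim B _ \<kappa>] r in auto)
  also have "\<dots> = ennreal (2 * exp (2 * r * \<tau>) * ?a) * init_energy"
  proof -
    have "ennreal (2 * exp (2 * r * \<tau>) * ?a) = ennreal (2 * exp (2 * r * \<tau>)) * ennreal ?a"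
      by (rule ennreal_mult') simp
    then show ?thesis by (simp only: mult.assoc)
  qed
  finally have main: "gap_energy t \<le> ennreal (2 * exp (2 * r * \<tau>) * ?a) * init_energy" .
  have sq_int: "integrable M (\<lambda>\<omega>. (norm (U \<omega> - V \<omega>))\<^sup>2)"
    if "U \<in> borel_measurable M" "V \<in> borel_measurable M" "integrable M (\<lambda>\<omega>. (norm (U \<omega>))\<^sup>2)" "integrable M (\<lambda>\<omega>. (norm (V \<omega>))\<^sup>2)"
    for U V :: "'w \<Rightarrow> 'h"
  proof (rule Bochner_Integration.integrable_bound)
    show "integrable M (\<lambda>\<omega>. 2 * (norm (U \<omega>))\<^sup>2 + 2 * (norm (V \<omega>))\<^sup>2)" using that by simp
    show "(\<lambda>\<omega>. (norm (U \<omega> - V \<omega>))\<^sup>2) \<in> borel_measurable M" using that(1,2) by measurable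
    show "AE \<omega> in M. norm ((norm (U \<omega> - V \<omega>))\<^sup>2) \<le> norm (2 * (norm (U \<omega>))\<^sup>2 + 2 * (norm (V \<omega>))\<^sup>2)"
      using norm_add_sq_le[of "U _" "- V _"] by (intro AE_I2) simp
  qed
  have "L2_random_variable M (F t) (X t)" "L2_random_variable M (F t) (Y t)"
    using X Y t unfolding mild_solution_def process_space_def by blast+
  then have "integrable M (\<lambda>\<omega>. (norm (X t \<omega> - Y t \<omega>))\<^sup>2)"
    using t measurable_F[of t "X t" borel] measurable_F[of t "Y t" borel]
    by (intro sq_int) (auto simp: L2_random_variable_def)
  then have gap_energy_eq: "gap_energy t = ennreal (\<integral>\<omega>. (norm (X t \<omega> - Y t \<omega>))\<^sup>2 \<partial>M)"
    unfolding gap_energy_def gap_def clamp_time_eq[OF t] by (rule nn_integral_eq_integral) simp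
  have "integrable M (\<lambda>\<omega>. (norm (\<xi> \<omega> - \<eta> \<omega>))\<^sup>2)"
  proof (rule sq_int)
    show "\<xi> \<in> borel_measurable M" "\<eta> \<in> borel_measurable M"
      using measurable_F[OF order_refl] \<xi> \<eta> unfolding L2_random_variable_def by blast+
    show "integrable M (\<lambda>\<omega>. (norm (\<xi> \<omega>))\<^sup>2)" "integrable M (\<lambda>\<omega>. (norm (\<eta> \<omega>))\<^sup>2)"
      using \<xi> \<eta> unfolding L2_random_variable_def by blast+
  qed
  then have init_energy_eq: "init_energy = ennreal (\<integral>\<omega>. (norm (\<xi> \<omega> - \<eta> \<omega>))\<^sup>2 \<partial>M)"
    unfolding init_energy_def init_gap_def by (rule nn_integral_eq_integral) simp
  have "ennreal (\<integral>\<omega>. (norm (X t \<omega> - Y t \<omega>))\<^sup>2 \<partial>M) \<le> ennreal (2 * exp (2 * r * \<tau>) * ?a * (\<integral>\<omega>. (norm (\<xi> \<omega> - \<eta> \<omega>))\<^sup>2 \<partial>M))"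
    using main a unfolding gap_energy_eq init_energy_eq by (subst ennreal_mult') auto
  then show ?thesis
    using a by (subst (asm) ennreal_le_iff) auto
qed

end

theorem theorem4p1:
  fixes M :: "'w measure"
    and F :: "real \<Rightarrow> 'w measure"
    and K :: "nat set"
    and Q :: "'v::{real_inner, banach, second_countable_topology} \<Rightarrow>\<^sub>L 'v"
    and lam :: "nat \<Rightarrow> real"
    and e :: "nat \<Rightarrow> 'v"
    and \<beta> :: "nat \<Rightarrow> real \<Rightarrow> 'w \<Rightarrow> real"
    and W :: "real \<Rightarrow> 'w \<Rightarrow> 'v"
    and T :: "real \<Rightarrow> 'h::{real_inner, banach, second_countable_topology} \<Rightarrow>\<^sub>L 'h"
    and DA Z :: "'h set"
    and A C CZ f :: "'h \<Rightarrow> 'h"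
    and m :: "'h \<Rightarrow> 'v \<Rightarrow> 'h"
    and k \<tau> :: real
  assumes "prob_space M" and "complete_measure M"
    and "normal_filtration M F"
    and "Q_wiener_process M F K Q lam e \<beta> W"
    and "C0_semigroup T" and "is_generator T DA A"
    and "linear_operator_on Z CZ" and "DA \<subseteq> Z" and "\<forall>x\<in>DA. C x = CZ x"
    and "graph_bounded_operator DA A C" and "admissible T DA C"
    and "\<forall>x. m x \<in> hs_operators K lam e"
    and "k > 0"
    and "\<forall>x y. norm (f x - f y) + hs_norm K lam e (\<lambda>v. m x v - m y v) \<le> k * norm (x - y)"
    and "\<tau> > 0"
  shows "\<exists>c>0. \<forall>\<xi> \<eta> X Y.
           L2_random_variable M (F 0) \<xi> \<longrightarrow> L2_random_variable M (F 0) \<eta> \<longrightarrow>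
           mild_solution M F K lam e W T DA A C f m \<tau> \<xi> X \<longrightarrow>
           mild_solution M F K lam e W T DA A C f m \<tau> \<eta> Y \<longrightarrow>
           (\<forall>t\<in>{0..\<tau>}. (\<integral>\<omega>. (norm (X t \<omega> - Y t \<omega>))\<^sup>2 \<partial>M)
                          \<le> c * (\<integral>\<omega>. (norm (\<xi> \<omega> - \<eta> \<omega>))\<^sup>2 \<partial>M))"
proof -
  note wiener_data = assms(4)[unfolded Q_wiener_process_def]
  have filtered: "brownian_family M F K \<beta>"
  proof (intro brownian_family.intro brownian_family_axioms.intro assms(1,3))
    show "brownian_motion M F (\<beta> k)" if "k \<in> K" for k
      using wiener_data that by (elim conjE) (rule bspec)
    show "prob_space.indep_vars M (\<lambda>_. \<Pi>\<^sub>M t\<in>{0..}. borel) (\<lambda>k \<omega>. \<lambda>t\<in>{0..}. \<beta> k t \<omega>) K"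
      using wiener_data by (elim conjE)
  qed
  have wiener: "wiener M F K \<beta> lam e W"
  proof (intro wiener.intro wiener_axioms.intro filtered assms(2))
    show "\<And>k. k \<in> K \<Longrightarrow> 0 \<le> lam k" "lam summable_on K"
      "\<And>t. 0 \<le> t \<Longrightarrow> AE \<omega> in M. ((\<lambda>k. (sqrt (lam k) * \<beta> k t \<omega>) *\<^sub>R e k) has_sum W t \<omega>) K"
      using wiener_data by blast+
    show "norm (e k) = 1" if "k \<in> K" for k
      using wiener_data that unfolding complete_orthonormal_def norm_eq_sqrt_inner by simp
  qed
  have observed: "observed_semigroup T DA A C"
    by unfold_locales fact+
  interpret observed_semigroup T DA A C by fact
  obtain B where B: "B \<ge> 1" "\<And>s. s \<in> {0..\<tau>} \<Longrightarrow> norm (T s) \<le> B"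
    using bounded_on_interval[of \<tau>] by blast
  \<comment> \<open>The approximations and all constants are fixed before the solutions are introduced.\<close>
  show ?thesis
  proof (rule yosida_approximation[of \<tau>])
    fix L :: "nat \<Rightarrow> 'h \<Rightarrow>\<^sub>L 'h" and \<gamma>
    assume \<gamma>: "\<gamma> \<ge> 0"
      and adm: "\<And>n x. (\<integral>\<^sup>+t\<in>{0..\<tau>}. nsq (L n (T t x)) \<partial>lborel) \<le> ennreal (\<gamma> * (norm x)\<^sup>2)"
      and L_lim: "\<And>x. x \<in> yosida_domain DA A C \<Longrightarrow> (\<lambda>n. L n x) \<longlonglongrightarrow> yosida_extension DA A C x"
    define \<kappa> where "\<kappa> = 6 * exp (2 * (3 * \<gamma> * k\<^sup>2 + 1) * \<tau>)"
    define r where "r = 3 * B\<^sup>2 * k\<^sup>2 * (4 * \<tau> * \<kappa> * \<gamma> * k\<^sup>2 + 4)"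
    define c where "c = 2 * exp (2 * r * \<tau>) * (3 * B\<^sup>2 * (1 + \<tau> * k\<^sup>2 * \<kappa> * \<gamma>))"
    have "\<kappa> > 0" by (simp add: \<kappa>_def)
    then have "0 \<le> \<tau> * k\<^sup>2 * \<kappa> * \<gamma>" using \<gamma> \<open>\<tau> > 0\<close> by simp
    then have "c > 0"
      unfolding c_def using B(1) by (intro mult_pos_pos add_pos_nonneg) auto
    moreover have "(\<integral>\<omega>. (norm (X t \<omega> - Y t \<omega>))\<^sup>2 \<partial>M) \<le> c * (\<integral>\<omega>. (norm (\<xi> \<omega> - \<eta> \<omega>))\<^sup>2 \<partial>M)"
      if sol: "L2_random_variable M (F 0) \<xi>" "L2_random_variable M (F 0) \<eta>"
        "mild_solution M F K lam e W T DA A C f m \<tau> \<xi> X" "mild_solution M F K lam e W T DA A C f m \<tau> \<eta> Y"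
        and t: "t \<in> {0..\<tau>}" for \<xi> \<eta> X Y t
    proof -
      have pair: "mild_pair M F K \<beta> lam e W T DA A C f m k \<tau> \<xi> \<eta> X Y"
      proof (intro mild_pair.intro mild_pair_axioms.intro wiener observed sol)
        show "\<And>x. m x \<in> hs_operators K lam e" using assms(12) by (rule spec)
        show "\<And>x y. norm (f x - f y) + hs_norm K lam e (\<lambda>v. m x v - m y v) \<le> k * norm (x - y)"
          using assms(14) by (elim allE)
      qed fact+
      show ?thesis
        unfolding c_def by (rule mild_pair.mean_square_estimate[OF pair adm \<gamma> L_lim B t \<kappa>_def r_def])
    qed
    ultimately show ?thesis by (intro exI[of _ c] conjI allI impI ballI)
  qed
qed

end
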